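(* Let $\ell=1$ or $\ell=n$ and $a\in\mathbb C^*$. The $\mathcal U_q(sl_{n+1}^{tor})$-module $T(e^{\varpi_\ell}Y_{\ell,a}Y_{0,aq}^{-1})$ is an extremal loop weight module of $\ell$-weight $e^{\varpi_\ell}Y_{\ell,a}Y_{0,aq}^{-1}$. Furthermore $T(e^{\varpi_\ell}Y_{\ell,a}Y_{0,aq}^{-1})$ is isomorphic to the extremal fundamental loop weight $\mathcal U_q(sl_{n+1}^{tor})$-module $V(e^{\varpi_\ell}Y_{\ell,a}Y_{0,aq}^{-1})$.
   Context: Fix an integer $n\ge 2$. $I=\{0,\dots,n\}$ is identified with $\mathbb Z/(n+1)\mathbb Z$ ($\bar j$ is the class of $j\in\mathbb Z$); $C=(C_{i,j})_{i,j\in I}$ is the Cartan matrix of type $A_n^{(1)}$ ($C_{i,i}=2$, $C_{i,i\pm1}=-1$, $C_{i,j}=0$ otherwise). Fix $t\in\mathbb C$ such that $q=e^t$ is not a root of unity; $q^x=e^{tx}$; $[l]_q=\frac{q^l-q^{-l}}{q-q^{-1}}$, $[r]_q!=[r]_q\cdots[1]_q$. $\mathfrak h=\mathbb Qh_0\oplus\dots\oplus\mathbb Qh_n\oplus\mathbb Qd$; $\alpha_i,\Lambda_i\in\mathfrak h^*$: $\alpha_i(h_j)=C_{j,i}$, $\alpha_i(d)=\delta_{0,i}$, $\Lambda_i(h_j)=\delta_{i,j}$, $\Lambda_i(d)=0$; $P=\{\lambda\in\mathfrak h^*:\lambda(h_i)\in\mathbb Z\ \forall i\}$; $\varpi_\ell=\Lambda_\ell-\Lambda_0$.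 $\mathcal U_q(sl_{n+1}^{tor})$ is the $\mathbb C$-algebra with generators $x_{i,r}^\pm$ ($i\in I,r\in\mathbb Z$), $k_h$ ($h\in\mathfrak h$), $h_{i,m}$ ($i\in I$, $m\in\mathbb Z\setminus\{0\}$). Put $x_i^\pm(z)=\sum_{r\in\mathbb Z}x_{i,r}^\pm z^r$, $\delta(z)=\sum_{s\in\mathbb Z}z^s$, $k_i^{\pm1}=k_{\pm h_i}$, $\phi_i^\pm(z)=\sum_{m\ge0}\phi^\pm_{i,\pm m}z^{\pm m}=k_i^{\pm1}\exp(\pm(q-q^{-1})\sum_{m\ge1}h_{i,\pm m}z^{\pm m})$. Relations: $k_hk_{h'}=k_{h+h'}$, $k_0=1$; the $k_h$ and all coefficients of all $\phi_i^\pm(z)$ commute; $k_hx_j^\pm(z)k_{-h}=q^{\pm\alpha_j(h)}x_j^\pm(z)$; $(w-q^{\pm C_{ij}}z)\phi_i^{\epsilon}(z)x_j^\pm(w)=(q^{\pm C_{ij}}w-z)x_j^\pm(w)\phi_i^{\epsilon}(z)$ for $\epsilon=+,-$; $[x_i^+(z),x_j^-(w)]=\frac{\delta_{i,j}}{q-q^{-1}}(\delta(\frac wz)\phi_i^+(w)-\delta(\frac zw)\phi_i^-(z))$; $(w-q^{\pm C_{ij}}z)x_i^\pm(z)x_j^\pm(w)=(q^{\pm C_{ij}}w-z)x_j^\pm(w)x_i^\pm(z)$; for $j=i\pm1$: $x_i^\pm(z_1)x_i^\pm(z_2)x_j^\pm(w)-(q+q^{-1})x_i^\pm(z_1)x_j^\pm(w)x_i^\pm(z_2)+x_j^\pm(w)x_i^\pm(z_1)x_i^\pm(z_2)+(z_1\leftrightarrow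 z_2)=0$; $[x_i^\pm(z),x_j^\pm(w)]=0$ for $i\ne j,j\pm1$. Let $\psi(z)=\frac{q-q^{-1}z}{1-z}$; rational functions describing $\phi_i^+$ (resp. $\phi_i^-$) are expanded at $z=0$ (resp. $z=\infty$). $V(e^{\Lambda_\ell}Y_{\ell,a})$ is the simple module generated by a vector $v^+$ with $x_{i,r}^+v^+=0$ for all $i,r$, $k_hv^+=q^{\Lambda_\ell(h)}v^+$, $\phi_i^\pm(z)v^+=\psi(aqz)^{\delta_{i,\ell}}v^+$. $V(e^{-\Lambda_0}Y_{0,b}^{-1})$ is the simple module generated by a vector $v^-$ with $x_{i,r}^-v^-=0$ for all $i,r$, $k_hv^-=q^{-\Lambda_0(h)}v^-$, $\phi_i^\pm(z)v^-=\psi(bqz)^{-\delta_{i,0}}v^-$. For $b=aq$ the tensor product $V(e^{\Lambda_\ell}Y_{\ell,a})\otimes V(e^{-\Lambda_0}Y_{0,b}^{-1})$ ($\ell\in\{1,n\}$) is a module through the Drinfeld coproduct $\Delta_D(x_i^+(z))=x_i^+(z)\otimes1+\phi_i^-(z)\otimes x_i^+(z)$, $\Delta_D(x_i^-(z))=x_i^-(z)\otimes\phi_i^+(z)+1\otimes x_i^-(z)$, $\Delta_D(\phi_i^\pm(z))=\phi_i^\pm(z)\otimes\phi_i^\pm(z)$, $\Delta_D(k_h)=k_h\otimes k_h$, where $x_{i,m}^+$ (resp. $x_{i,m}^-$) acts on $v\otimes w$ by the value at $u=1$ of the rational function in $u$ with expansion at $u=0$ equal to $x_{i,m}^+v\otimes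 w+\sum_{r\ge0}u^{m+r}\phi^-_{i,-r}v\otimes x^+_{i,m+r}w$ (resp. $\sum_{r\ge0}u^{r}x^-_{i,m-r}v\otimes\phi^+_{i,r}w+u^mv\otimes x^-_{i,m}w$). $T(e^{\varpi_\ell}Y_{\ell,a}Y_{0,aq}^{-1})$ is its submodule generated by $v^+\otimes v^-$. The module $V(e^{\varpi_1}Y_{1,a}Y_{0,aq}^{-1})$ (vector representation) has basis $\boxed{j}_a$, $j\in\mathbb Z$, with $x_i^+(z)\boxed j_a=\delta_{i,\overline{j-1}}\,\delta(aq^{j-1}z)\boxed{j-1}_a$, $x_i^-(z)\boxed j_a=\delta_{i,\bar j}\,\delta(aq^jz)\boxed{j+1}_a$, $\phi_i^\pm(z)\boxed j_a=\psi(aq^jz)\boxed j_a$ if $i=\bar j$, $=\psi(aq^{j+1}z)^{-1}\boxed j_a$ if $i=\overline{j-1}$, $=\boxed j_a$ otherwise, and $\boxed j_a$ has weight $\varpi_1-\sum_{s=1}^{j-1}\alpha_{\bar s}$ if $j\ge1$, $\varpi_1+\sum_{s=j}^{0}\alpha_{\bar s}$ if $j\le0$. $V(e^{\varpi_n}Y_{n,a}Y_{0,aq}^{-1})$ is the twist of it by the diagram automorphism $\iota$: $x_i^\pm(z)\mapsto x_{-i}^\pm(z)$, $\phi_i^\pm(z)\mapsto\phi_{-i}^\pm(z)$, $k_{h_i}\mapsto k_{h_{-i}}$, $k_d\mapsto k_d$. Integrable module: direct sum of its weight spaces $V_\lambda=\{v:k_hv=q^{\lambda(h)}v\ \forall h\}$,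 $\lambda\in P$, with all $x_{i,0}^\pm$ acting locally nilpotently. For a monomial $m=e^{\omega}\prod_{i\in I,c\in\mathbb C^*}Y_{i,c}^{u_{i,c}}$ (finite product, $\omega\in P$, $\sum_cu_{i,c}=\omega(h_i)$), $V_m$ is the subspace of $V_\omega$ on which the $\phi^\pm_{i,\pm s}$ act with generalized eigenvalues the coefficients of the expansions of $\prod_c\psi(cqz)^{u_{i,c}}$. A vector $w$ of weight $\lambda$ is $i$-extremal if $x_{i,0}^{\pm}w=0$ when $\pm\lambda(h_i)\ge0$; then $S_i(w)=\frac{(x_{i,0}^\mp)^{\pm\lambda(h_i)}}{[\pm\lambda(h_i)]_q!}w$ when $\pm\lambda(h_i)\geq 0$. It is extremal for the horizontal subalgebra (generated by the $x_{i,0}^\pm$, $k_h$) if every $S_{i_1}\circ\cdots\circ S_{i_l}(w)$ ($l\ge0$) is $i$-extremal for every $i$. An extremal loop weight module of $\ell$-weight $m$ is an integrable module $V$ with a $v\in V_m$ such that (i) $v$ generates $V$; (ii) $v$ is extremal for the horizontal subalgebra; (iii) for each $j\in I$ and $w\in V$, $\mathcal U_q^{v,j}(sl_{n+1}^{tor})\cdot w$ is finite-dimensional, where $\mathcal U_q^{v,j}(sl_{n+1}^{tor})$ is the subalgebra generated by $x_{i,r}^\pm,h_{i,m}$ ($i\ne j$) and $k_h$, $h\in\bigoplus_{i\ne j}\mathbb Qh_i$. *)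

theory Defs
  imports Complex_Main "HOL-Library.Poly_Mapping" "HOL-Computational_Algebra.Polynomial"
    "HOL-Computational_Algebra.Formal_Power_Series"
begin

section \<open>Complex vector spaces\<close>

class complex_vector = ab_group_add +
  fixes scaleC :: "complex \<Rightarrow> 'a \<Rightarrow> 'a"  (infixr "*\<^sub>C" 75)
  assumes scaleC_add_right: "c *\<^sub>C (x + y) = c *\<^sub>C x + c *\<^sub>C y"
    and scaleC_add_left: "(c + d) *\<^sub>C x = c *\<^sub>C x + d *\<^sub>C x"
    and scaleC_scaleC: "c *\<^sub>C (d *\<^sub>C x) = (c * d) *\<^sub>C x"
    and scaleC_one: "1 *\<^sub>C x = x"

global_interpretation cvec: vector_space "scaleC :: complex \<Rightarrow> 'a \<Rightarrow> 'a::complex_vector"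
  by unfold_locales (simp_all add: scaleC_add_right scaleC_add_left scaleC_scaleC scaleC_one)

instantiation complex :: complex_vector
begin
definition scaleC_complex :: "complex \<Rightarrow> complex \<Rightarrow> complex"
  where "scaleC_complex c x = c * x"
instance
  by standard (simp_all add: scaleC_complex_def algebra_simps)
end

instantiation poly_mapping :: (type, complex_vector) complex_vector
begin
lift_definition scaleC_poly_mapping :: "complex \<Rightarrow> ('a \<Rightarrow>\<^sub>0 'b) \<Rightarrow> ('a \<Rightarrow>\<^sub>0 'b)"
  is "\<lambda>c f x. c *\<^sub>C f x"
  by (rule finite_subset) (auto simp: cvec.scale_zero_right)
instance
proof
  fix c d :: complex and f g :: "'a \<Rightarrow>\<^sub>0 'b"
  show "c *\<^sub>C (f + g) = c *\<^sub>C f + c *\<^sub>C g"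
    by transfer (simp add: scaleC_add_right)
  show "(c + d) *\<^sub>C f = c *\<^sub>C f + d *\<^sub>C f"
    by transfer (simp add: scaleC_add_left)
  show "c *\<^sub>C (d *\<^sub>C f) = (c * d) *\<^sub>C f"
    by transfer (simp add: scaleC_scaleC)
  show "1 *\<^sub>C f = f"
    by transfer (simp add: scaleC_one)
qed
end

definition linear_on_space :: "'v::complex_vector set \<Rightarrow> ('v \<Rightarrow> 'w::complex_vector) \<Rightarrow> bool" where
  "linear_on_space S f \<longleftrightarrow>
     (\<forall>v\<in>S. \<forall>w\<in>S. f (v + w) = f v + f w) \<and> (\<forall>c. \<forall>v\<in>S. f (c *\<^sub>C v) = c *\<^sub>C f v)"

definition finite_dimensional :: "'v::complex_vector set \<Rightarrow> bool" where
  "finite_dimensional S \<longleftrightarrow> (\<exists>B. finite B \<and> S \<subseteq> cvec.span B)"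

text \<open>The smallest subspace containing \<open>v\<close> and stable under all operators in \<open>F\<close>,
  i.e. \<open>A v\<close> for the unital algebra \<open>A\<close> generated by \<open>F\<close>.\<close>

definition cyclic_span :: "('v::complex_vector \<Rightarrow> 'v) set \<Rightarrow> 'v \<Rightarrow> 'v set" where
  "cyclic_span F v = \<Inter>{N. cvec.subspace N \<and> v \<in> N \<and> (\<forall>f\<in>F. f ` N \<subseteq> N)}"


section \<open>Tensor products\<close>

definition tensor_relators ::
    "(('v::complex_vector \<times> 'w::complex_vector) \<Rightarrow>\<^sub>0 complex) set" where
  "tensor_relators =
     {Poly_Mapping.single (v + v', w) 1 - Poly_Mapping.single (v, w) 1
        - Poly_Mapping.single (v', w) 1 | v v' w. True}
   \<union> {Poly_Mapping.single (v, w + w') 1 - Poly_Mapping.single (v, w) 1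
        - Poly_Mapping.single (v, w') 1 | v w w'. True}
   \<union> {Poly_Mapping.single (c *\<^sub>C v, w) 1 - c *\<^sub>C Poly_Mapping.single (v, w) 1 | c v w. True}
   \<union> {Poly_Mapping.single (v, c *\<^sub>C w) 1 - c *\<^sub>C Poly_Mapping.single (v, w) 1 | c v w. True}"

definition tensor_rel ::
    "(('v::complex_vector \<times> 'w::complex_vector) \<Rightarrow>\<^sub>0 complex)
      \<Rightarrow> (('v \<times> 'w) \<Rightarrow>\<^sub>0 complex) \<Rightarrow> bool" where
  "tensor_rel f g \<longleftrightarrow> f - g \<in> cvec.span tensor_relators"

lemma equivp_tensor_rel:
  "equivp (tensor_rel :: (('v::complex_vector \<times> 'w::complex_vector) \<Rightarrow>\<^sub>0 complex) \<Rightarrow> _)"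
proof (rule equivpI)
  show "reflp (tensor_rel :: (('v \<times> 'w) \<Rightarrow>\<^sub>0 complex) \<Rightarrow> _)"
    by (auto simp: reflp_def tensor_rel_def cvec.span_zero)
  show "symp (tensor_rel :: (('v \<times> 'w) \<Rightarrow>\<^sub>0 complex) \<Rightarrow> _)"
    unfolding symp_def tensor_rel_def by (metis cvec.span_neg minus_diff_eq)
  show "transp (tensor_rel :: (('v \<times> 'w) \<Rightarrow>\<^sub>0 complex) \<Rightarrow> _)"
  proof (rule transpI)
    fix f g h :: "('v \<times> 'w) \<Rightarrow>\<^sub>0 complex"
    assume "tensor_rel f g" "tensor_rel g h"
    then have "(f - g) + (g - h) \<in> cvec.span tensor_relators"
      unfolding tensor_rel_def by (rule cvec.span_add)
    then show "tensor_rel f h"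
      unfolding tensor_rel_def by simp
  qed
qed

quotient_type (overloaded) ('v, 'w) tensor =
  "('v::complex_vector \<times> 'w::complex_vector) \<Rightarrow>\<^sub>0 complex" / tensor_rel
  by (rule equivp_tensor_rel)

instantiation tensor :: (complex_vector, complex_vector) complex_vector
begin
lift_definition zero_tensor :: "('a, 'b) tensor" is 0 .
lift_definition plus_tensor :: "('a, 'b) tensor \<Rightarrow> ('a, 'b) tensor \<Rightarrow> ('a, 'b) tensor" is "(+)"
  unfolding tensor_rel_def by (subst add_diff_add) (rule cvec.span_add)
lift_definition uminus_tensor :: "('a, 'b) tensor \<Rightarrow> ('a, 'b) tensor" is uminus
  unfolding tensor_rel_def by (subst minus_diff_minus) (rule cvec.span_neg)
lift_definition minus_tensor :: "('a, 'b) tensor \<Rightarrow> ('a, 'b) tensor \<Rightarrow> ('a, 'b) tensor" is "(-)"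
proof -
  fix f g f' g' :: "('a \<times> 'b) \<Rightarrow>\<^sub>0 complex"
  assume "tensor_rel f g" "tensor_rel f' g'"
  then have "(f - g) - (f' - g') \<in> cvec.span tensor_relators"
    unfolding tensor_rel_def by (rule cvec.span_diff)
  moreover have "(f - g) - (f' - g') = (f - f') - (g - g')"
    by (simp add: algebra_simps)
  ultimately show "tensor_rel (f - f') (g - g')"
    unfolding tensor_rel_def by simp
qed
lift_definition scaleC_tensor :: "complex \<Rightarrow> ('a, 'b) tensor \<Rightarrow> ('a, 'b) tensor" is scaleC
  unfolding tensor_rel_def
  by (subst cvec.scale_right_diff_distrib [symmetric]) (rule cvec.span_scale)
instance
proof
  fix c d :: complex and x y z :: "('a, 'b) tensor"
  have eq: "tensor_rel f g" if "f = g" for f g :: "('a \<times> 'b) \<Rightarrow>\<^sub>0 complex"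
    using that by (simp add: tensor_rel_def cvec.span_zero)
  show "x + y + z = x + (y + z)" by transfer (rule eq, simp add: algebra_simps)
  show "x + y = y + x" by transfer (rule eq, simp add: algebra_simps)
  show "0 + x = x" by transfer (rule eq, simp)
  show "- x + x = 0" by transfer (rule eq, simp)
  show "x - y = x + - y" by transfer (rule eq, simp)
  show "c *\<^sub>C (x + y) = c *\<^sub>C x + c *\<^sub>C y" by transfer (rule eq, rule scaleC_add_right)
  show "(c + d) *\<^sub>C x = c *\<^sub>C x + d *\<^sub>C x" by transfer (rule eq, rule scaleC_add_left)
  show "c *\<^sub>C (d *\<^sub>C x) = (c * d) *\<^sub>C x" by transfer (rule eq, rule scaleC_scaleC)
  show "1 *\<^sub>C x = x" by transfer (rule eq, rule scaleC_one)
qed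
end

lift_definition pure_tensor ::
    "'v::complex_vector \<Rightarrow> 'w::complex_vector \<Rightarrow> ('v, 'w) tensor"  (infixr "\<otimes>\<^sub>t" 70)
  is "\<lambda>v w. Poly_Mapping.single (v, w) 1" .

definition tensor_map ::
    "('v::complex_vector \<Rightarrow> 'v) \<Rightarrow> ('w::complex_vector \<Rightarrow> 'w)
      \<Rightarrow> ('v, 'w) tensor \<Rightarrow> ('v, 'w) tensor" where
  "tensor_map A B =
     (THE F. Vector_Spaces.linear scaleC scaleC F \<and> (\<forall>v w. F (v \<otimes>\<^sub>t w) = A v \<otimes>\<^sub>t B w))"


section \<open>Cartan data of type \<open>A\<^sub>n\<^sup>(\<^sup>1\<^sup>)\<close>\<close>

datatype pm = Pos | Neg

fun sgz :: "pm \<Rightarrow> int" where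
  "sgz Pos = 1"
| "sgz Neg = - 1"

text \<open>Vertices are the representatives \<open>0, \<dots>, n\<close> of the integers modulo \<open>n + 1\<close>.
  Elements of the Cartan subalgebra and of its (rational) dual are written in coordinates:
  position \<open>i \<le> n\<close> is the coefficient of \<open>h\<^sub>i\<close> (resp. of \<open>\<Lambda>\<^sub>i\<close>) and position \<open>n + 1\<close> the
  coefficient of \<open>d\<close> (resp. of the dual coordinate of \<open>d\<close>).\<close>

type_synonym cartan = "nat \<Rightarrow>\<^sub>0 rat"

definition cartan_space :: "nat \<Rightarrow> cartan set" where
  "cartan_space n = {h. Poly_Mapping.keys h \<subseteq> {..n + 1}}"

definition pairing :: "nat \<Rightarrow> cartan \<Rightarrow> cartan \<Rightarrow> rat" where
  "pairing n \<mu> h = (\<Sum>k\<le>n + 1. Poly_Mapping.lookup \<mu> k * Poly_Mapping.lookup h k)"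

definition vertex :: "nat \<Rightarrow> int \<Rightarrow> nat" where
  "vertex n j = nat (j mod (int n + 1))"

definition cartan_matrix :: "nat \<Rightarrow> nat \<Rightarrow> nat \<Rightarrow> int" where
  "cartan_matrix n i j =
     (if i = j then 2
      else if j = vertex n (int i + 1) \<or> j = vertex n (int i - 1) then - 1 else 0)"

definition coroot :: "nat \<Rightarrow> cartan" where
  "coroot i = Poly_Mapping.single i 1"

definition signed_coroot :: "pm \<Rightarrow> nat \<Rightarrow> cartan" where
  "signed_coroot \<epsilon> i = Poly_Mapping.single i (of_int (sgz \<epsilon>))"

definition fund_weight :: "nat \<Rightarrow> cartan" where
  "fund_weight i = Poly_Mapping.single i 1"

definition simple_root :: "nat \<Rightarrow> nat \<Rightarrow> cartan" where
  "simple_root n i =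
     (\<Sum>j\<le>n. Poly_Mapping.single j (of_int (cartan_matrix n j i)))
     + (if i = 0 then Poly_Mapping.single (n + 1) 1 else 0)"

definition weight_lattice :: "nat \<Rightarrow> cartan set" where
  "weight_lattice n = {\<mu> \<in> cartan_space n. \<forall>i\<le>n. pairing n \<mu> (coroot i) \<in> \<int>}"

definition varpi :: "nat \<Rightarrow> cartan" where
  "varpi l = fund_weight l - fund_weight 0"


section \<open>Quantum parameters\<close>

definition qexp :: "complex \<Rightarrow> rat \<Rightarrow> complex" where
  "qexp t x = exp (t * of_rat x)"

definition qint :: "complex \<Rightarrow> int \<Rightarrow> complex" where
  "qint t l = (exp t powi l - exp t powi (- l)) / (exp t - inverse (exp t))"

definition qfact :: "complex \<Rightarrow> nat \<Rightarrow> complex" where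
  "qfact t r = (\<Prod>l = 1..r. qint t (int l))"


section \<open>Modules over the quantum toroidal algebra\<close>

text \<open>Candidate module data: the underlying space and the actions of the generators
  \<open>x\<^sub>i\<^sub>,\<^sub>r\<^sup>\<plusminus>\<close>, \<open>k\<^sub>h\<close> and \<open>h\<^sub>i\<^sub>,\<^sub>m\<close>.  The values of \<open>xop\<close>, \<open>kop\<close>, \<open>hop\<close> at arguments
  that do not index a generator (\<open>i > n\<close>, \<open>h\<close> outside the Cartan subalgebra, \<open>m = 0\<close>) are
  irrelevant.\<close>

record 'v qmod =
  space :: "'v set"
  xop :: "pm \<Rightarrow> nat \<Rightarrow> int \<Rightarrow> 'v \<Rightarrow> 'v"
  kop :: "cartan \<Rightarrow> 'v \<Rightarrow> 'v"
  hop :: "nat \<Rightarrow> int \<Rightarrow> 'v \<Rightarrow> 'v"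

text \<open>\<open>series_power A k m\<close> is the coefficient of \<open>z\<^sup>m\<close> in
  \<open>(\<Sum>\<^sub>s\<^sub>\<ge>\<^sub>1 A\<^sub>s z\<^sup>s)\<^sup>k\<close> for operators \<open>A\<^sub>s\<close>.\<close>

primrec series_power :: "(nat \<Rightarrow> 'v \<Rightarrow> 'v) \<Rightarrow> nat \<Rightarrow> nat \<Rightarrow> 'v \<Rightarrow> 'v::complex_vector" where
  "series_power A 0 m = (\<lambda>v. if m = 0 then v else 0)"
| "series_power A (Suc k) m = (\<lambda>v. \<Sum>s = 1..m. A s (series_power A k (m - s) v))"

text \<open>\<open>phi t M \<epsilon> i s\<close> is the operator \<open>\<phi>\<^sup>\<epsilon>\<^sub>i\<^sub>,\<^sub>\<epsilon>\<^sub>s\<close>, i.e. the coefficient of \<open>z\<^sup>\<epsilon>\<^sup>s\<close> in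
  \<open>k\<^sub>i\<^sup>\<epsilon> exp (\<epsilon> (q - q\<^sup>-\<^sup>1) \<Sum>\<^sub>m\<^sub>\<ge>\<^sub>1 h\<^sub>i\<^sub>,\<^sub>\<epsilon>\<^sub>m z\<^sup>\<epsilon>\<^sup>m)\<close>.\<close>

definition phi ::
    "complex \<Rightarrow> ('v::complex_vector) qmod \<Rightarrow> pm \<Rightarrow> nat \<Rightarrow> nat \<Rightarrow> 'v \<Rightarrow> 'v" where
  "phi t M \<epsilon> i s v =
     kop M (signed_coroot \<epsilon> i)
       (\<Sum>k\<le>s. ((of_int (sgz \<epsilon>) * (exp t - inverse (exp t))) ^ k / fact k) *\<^sub>C
          series_power (\<lambda>m. hop M i (sgz \<epsilon> * int m)) k s v)"

definition phi_int ::
    "complex \<Rightarrow> ('v::complex_vector) qmod \<Rightarrow> pm \<Rightarrow> nat \<Rightarrow> int \<Rightarrow> 'v \<Rightarrow> 'v" where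
  "phi_int t M \<epsilon> i r v = (if sgz \<epsilon> * r \<ge> 0 then phi t M \<epsilon> i (nat (sgz \<epsilon> * r)) v else 0)"

definition generators :: "nat \<Rightarrow> 'v qmod \<Rightarrow> ('v \<Rightarrow> 'v) set" where
  "generators n M =
     {xop M \<epsilon> i r | \<epsilon> i r. i \<le> n} \<union> {kop M h | h. h \<in> cartan_space n}
     \<union> {hop M i m | i m. i \<le> n \<and> m \<noteq> 0}"

text \<open>Modules over the algebra presented by generators and relations: a complex vector space
  with linear operators for the generators that satisfy the relations.  Identities between
  formal distributions are written coefficient by coefficient: the coefficient of
  \<open>z\<^sup>r w\<^sup>s\<close>, and in the Serre relations that of \<open>z\<^sub>1\<^sup>r z\<^sub>2\<^sup>s w\<^sup>p\<close>.\<close>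

definition is_qmodule :: "nat \<Rightarrow> complex \<Rightarrow> ('v::complex_vector) qmod \<Rightarrow> bool" where
  "is_qmodule n t M \<longleftrightarrow>
    (let q = exp t; S = space M; x = xop M; k = kop M; \<phi> = phi_int t M; C = cartan_matrix n;
         adj = (\<lambda>i j. j = vertex n (int i + 1) \<or> j = vertex n (int i - 1)) in
     cvec.subspace S \<and>
     (\<forall>f\<in>generators n M. f ` S \<subseteq> S \<and> linear_on_space S f) \<and>
     (\<forall>v\<in>S.
       (\<forall>h\<in>cartan_space n. \<forall>h'\<in>cartan_space n. k h (k h' v) = k (h + h') v) \<and>
       k 0 v = v \<and>
       (\<forall>h\<in>cartan_space n. \<forall>\<epsilon>. \<forall>i\<le>n. \<forall>r. k h (\<phi> \<epsilon> i r v) = \<phi> \<epsilon> i r (k h v)) \<and>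
       (\<forall>\<epsilon> \<epsilon>'. \<forall>i\<le>n. \<forall>j\<le>n. \<forall>r s. \<phi> \<epsilon> i r (\<phi> \<epsilon>' j s v) = \<phi> \<epsilon>' j s (\<phi> \<epsilon> i r v)) \<and>
       (\<forall>h\<in>cartan_space n. \<forall>\<sigma>. \<forall>j\<le>n. \<forall>r.
          k h (x \<sigma> j r (k (- h) v)) =
            qexp t (of_int (sgz \<sigma>) * pairing n (simple_root n j) h) *\<^sub>C x \<sigma> j r v) \<and>
       (\<forall>\<epsilon> \<sigma>. \<forall>i\<le>n. \<forall>j\<le>n. \<forall>r s.
          \<phi> \<epsilon> i r (x \<sigma> j (s - 1) v) - (q powi (sgz \<sigma> * C i j)) *\<^sub>C \<phi> \<epsilon> i (r - 1) (x \<sigma> j s v) =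
          (q powi (sgz \<sigma> * C i j)) *\<^sub>C x \<sigma> j (s - 1) (\<phi> \<epsilon> i r v) - x \<sigma> j s (\<phi> \<epsilon> i (r - 1) v)) \<and>
       (\<forall>i\<le>n. \<forall>j\<le>n. \<forall>r s.
          x Pos i r (x Neg j s v) - x Neg j s (x Pos i r v) =
          (if i = j then inverse (q - inverse q) *\<^sub>C (\<phi> Pos i (r + s) v - \<phi> Neg i (r + s) v)
           else 0)) \<and>
       (\<forall>\<sigma>. \<forall>i\<le>n. \<forall>j\<le>n. \<forall>r s.
          x \<sigma> i r (x \<sigma> j (s - 1) v) - (q powi (sgz \<sigma> * C i j)) *\<^sub>C x \<sigma> i (r - 1) (x \<sigma> j s v) =
          (q powi (sgz \<sigma> * C i j)) *\<^sub>C x \<sigma> j (s - 1) (x \<sigma> i r v) - x \<sigma> j s (x \<sigma> i (r - 1) v)) \<and>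
       (\<forall>\<sigma>. \<forall>i\<le>n. \<forall>j\<le>n. adj i j \<longrightarrow> (\<forall>r s p.
          (x \<sigma> i r (x \<sigma> i s (x \<sigma> j p v)) - (q + inverse q) *\<^sub>C x \<sigma> i r (x \<sigma> j p (x \<sigma> i s v))
             + x \<sigma> j p (x \<sigma> i r (x \<sigma> i s v))) +
          (x \<sigma> i s (x \<sigma> i r (x \<sigma> j p v)) - (q + inverse q) *\<^sub>C x \<sigma> i s (x \<sigma> j p (x \<sigma> i r v))
             + x \<sigma> j p (x \<sigma> i s (x \<sigma> i r v))) = 0)) \<and>
       (\<forall>\<sigma>. \<forall>i\<le>n. \<forall>j\<le>n. i \<noteq> j \<and> \<not> adj i j \<longrightarrow>
          (\<forall>r s. x \<sigma> i r (x \<sigma> j s v) = x \<sigma> j s (x \<sigma> i r v)))))"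

definition simple_qmodule :: "nat \<Rightarrow> complex \<Rightarrow> ('v::complex_vector) qmod \<Rightarrow> bool" where
  "simple_qmodule n t M \<longleftrightarrow>
     is_qmodule n t M \<and> space M \<noteq> {0} \<and>
     (\<forall>N. cvec.subspace N \<and> N \<subseteq> space M \<and> (\<forall>f\<in>generators n M. f ` N \<subseteq> N)
        \<longrightarrow> N = {0} \<or> N = space M)"

definition qmodule_iso ::
    "nat \<Rightarrow> ('v::complex_vector) qmod \<Rightarrow> ('w::complex_vector) qmod \<Rightarrow> bool" where
  "qmodule_iso n M N \<longleftrightarrow>
     (\<exists>f. bij_betw f (space M) (space N) \<and> linear_on_space (space M) f \<and>
       (\<forall>v\<in>space M.
          (\<forall>\<epsilon>. \<forall>i\<le>n. \<forall>r. f (xop M \<epsilon> i r v) = xop N \<epsilon> i r (f v)) \<and>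
          (\<forall>h\<in>cartan_space n. f (kop M h v) = kop N h (f v)) \<and>
          (\<forall>i\<le>n. \<forall>m. m \<noteq> 0 \<longrightarrow> f (hop M i m v) = hop N i m (f v))))"

text \<open>Module data given by operators \<open>X\<close>, \<open>K\<close> and \<open>\<Phi> \<epsilon> i s\<close> (for \<open>\<phi>\<^sup>\<epsilon>\<^sub>i\<^sub>,\<^sub>\<epsilon>\<^sub>s\<close>): the operators
  \<open>h\<^sub>i\<^sub>,\<^sub>\<epsilon>\<^sub>m\<close> are recovered as the coefficients of
  \<open>\<epsilon> (q - q\<^sup>-\<^sup>1)\<^sup>-\<^sup>1 log (k\<^sub>i\<^sup>-\<^sup>\<epsilon> \<phi>\<^sub>i\<^sup>\<epsilon>(z))\<close>.\<close>

definition qmod_of_phi ::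
    "complex \<Rightarrow> 'v set \<Rightarrow> (pm \<Rightarrow> nat \<Rightarrow> int \<Rightarrow> 'v \<Rightarrow> 'v) \<Rightarrow> (cartan \<Rightarrow> 'v \<Rightarrow> 'v)
      \<Rightarrow> (pm \<Rightarrow> nat \<Rightarrow> nat \<Rightarrow> 'v \<Rightarrow> 'v) \<Rightarrow> ('v::complex_vector) qmod" where
  "qmod_of_phi t S X K \<Phi> =
     \<lparr> space = S, xop = X, kop = K,
       hop = (\<lambda>i m v. let \<epsilon> = (if m > 0 then Pos else Neg); N = nat \<bar>m\<bar> in
         (of_int (sgz \<epsilon>) / (exp t - inverse (exp t))) *\<^sub>C
         (\<Sum>k = 1..N. ((- 1) ^ (k + 1) / of_nat k) *\<^sub>C
            series_power (\<lambda>s. K (- signed_coroot \<epsilon> i) \<circ> \<Phi> \<epsilon> i s) k N v)) \<rparr>"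


section \<open>Monomials and \<open>\<ell>\<close>-weights\<close>

text \<open>A monomial \<open>e\<^sup>\<omega> \<Prod> Y\<^sub>i\<^sub>,\<^sub>c^(u i c)\<close> is the pair \<open>(\<omega>, u)\<close>.\<close>

type_synonym monomial = "cartan \<times> (nat \<Rightarrow> complex \<Rightarrow> int)"

definition Ymon :: "nat \<Rightarrow> complex \<Rightarrow> nat \<Rightarrow> complex \<Rightarrow> int" where
  "Ymon i c = (\<lambda>j d. if j = i \<and> d = c then 1 else 0)"

definition is_monomial :: "nat \<Rightarrow> monomial \<Rightarrow> bool" where
  "is_monomial n = (\<lambda>(\<omega>, u). \<omega> \<in> weight_lattice n \<and>
     (\<forall>i\<le>n. finite {c. u i c \<noteq> 0} \<and> u i 0 = 0 \<and>
        of_int (\<Sum>c | u i c \<noteq> 0. u i c) = pairing n \<omega> (coroot i)))"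

text \<open>Expansion of \<open>\<psi>(c z) = (q - q\<^sup>-\<^sup>1 c z) / (1 - c z)\<close>, as a series in \<open>Z = z\<close> at \<open>z = 0\<close>
  and as a series in \<open>Z = z\<^sup>-\<^sup>1\<close> at \<open>z = \<infinity>\<close> (numerator and denominator multiplied by \<open>Z\<close>).\<close>

fun psi_series :: "complex \<Rightarrow> pm \<Rightarrow> complex \<Rightarrow> complex fps" where
  "psi_series t Pos c =
     (fps_const (exp t) - fps_const (inverse (exp t) * c) * fps_X) / (1 - fps_const c * fps_X)"
| "psi_series t Neg c =
     (fps_const (exp t) * fps_X - fps_const (inverse (exp t) * c)) / (fps_X - fps_const c)"

text \<open>Coefficient \<open>s\<close> is the eigenvalue of \<open>\<phi>\<^sup>\<epsilon>\<^sub>i\<^sub>,\<^sub>\<epsilon>\<^sub>s\<close>.\<close>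

definition monomial_series ::
    "complex \<Rightarrow> (nat \<Rightarrow> complex \<Rightarrow> int) \<Rightarrow> pm \<Rightarrow> nat \<Rightarrow> complex fps" where
  "monomial_series t u \<epsilon> i = (\<Prod>c | u i c \<noteq> 0. psi_series t \<epsilon> (c * exp t) powi u i c)"

definition weight_space ::
    "nat \<Rightarrow> complex \<Rightarrow> ('v::complex_vector) qmod \<Rightarrow> cartan \<Rightarrow> 'v set" where
  "weight_space n t M \<mu> =
     {v \<in> space M. \<forall>h\<in>cartan_space n. kop M h v = qexp t (pairing n \<mu> h) *\<^sub>C v}"

definition lweight_space ::
    "nat \<Rightarrow> complex \<Rightarrow> ('v::complex_vector) qmod \<Rightarrow> monomial \<Rightarrow> 'v set" where
  "lweight_space n t M = (\<lambda>(\<omega>, u).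
     {v \<in> weight_space n t M \<omega>. \<forall>\<epsilon>. \<forall>i\<le>n. \<forall>s. \<exists>p.
        ((\<lambda>w. phi t M \<epsilon> i s w - fps_nth (monomial_series t u \<epsilon> i) s *\<^sub>C w) ^^ p) v = 0})"

text \<open>Simple modules \<open>V(m)\<close> generated by a vector of \<open>\<ell>\<close>-weight \<open>m\<close> annihilated by all
  \<open>x\<^sup>\<sigma>\<^sub>i\<^sub>,\<^sub>r\<close>: highest \<open>\<ell>\<close>-weight for \<open>\<sigma> = Pos\<close>, lowest for \<open>\<sigma> = Neg\<close>.\<close>

definition simple_lweight_module ::
    "nat \<Rightarrow> complex \<Rightarrow> pm \<Rightarrow> monomial \<Rightarrow> ('v::complex_vector) qmod \<Rightarrow> 'v \<Rightarrow> bool" where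
  "simple_lweight_module n t \<sigma> = (\<lambda>(\<omega>, u) M v.
     simple_qmodule n t M \<and> v \<in> space M \<and> cyclic_span (generators n M) v = space M \<and>
     (\<forall>i\<le>n. \<forall>r. xop M \<sigma> i r v = 0) \<and>
     (\<forall>h\<in>cartan_space n. kop M h v = qexp t (pairing n \<omega> h) *\<^sub>C v) \<and>
     (\<forall>\<epsilon>. \<forall>i\<le>n. \<forall>s. phi t M \<epsilon> i s v = fps_nth (monomial_series t u \<epsilon> i) s *\<^sub>C v))"


section \<open>Extremal loop weight modules\<close>

definition integrable :: "nat \<Rightarrow> complex \<Rightarrow> ('v::complex_vector) qmod \<Rightarrow> bool" where
  "integrable n t M \<longleftrightarrow>
     is_qmodule n t M \<and>
     space M = cvec.span (\<Union>\<mu>\<in>weight_lattice n. weight_space n t M \<mu>) \<and>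
     (\<forall>\<mu>\<in>weight_lattice n. weight_space n t M \<mu> \<inter>
        cvec.span (\<Union>\<nu>\<in>weight_lattice n - {\<mu>}. weight_space n t M \<nu>) = {0}) \<and>
     (\<forall>\<epsilon>. \<forall>i\<le>n. \<forall>v\<in>space M. \<exists>p. (xop M \<epsilon> i 0 ^^ p) v = 0)"

definition i_extremal ::
    "nat \<Rightarrow> ('v::complex_vector) qmod \<Rightarrow> cartan \<Rightarrow> nat \<Rightarrow> 'v \<Rightarrow> bool" where
  "i_extremal n M \<mu> i w \<longleftrightarrow>
     (pairing n \<mu> (coroot i) \<ge> 0 \<longrightarrow> xop M Pos i 0 w = 0) \<and>
     (pairing n \<mu> (coroot i) \<le> 0 \<longrightarrow> xop M Neg i 0 w = 0)"

definition S_op ::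
    "nat \<Rightarrow> complex \<Rightarrow> ('v::complex_vector) qmod \<Rightarrow> cartan \<Rightarrow> nat \<Rightarrow> 'v \<Rightarrow> 'v" where
  "S_op n t M \<mu> i w =
     (let a = \<lfloor>pairing n \<mu> (coroot i)\<rfloor>; r = nat \<bar>a\<bar> in
      inverse (qfact t r) *\<^sub>C (xop M (if a \<ge> 0 then Neg else Pos) i 0 ^^ r) w)"

text \<open>All vectors \<open>S\<^sub>i\<^sub>1 (\<dots> (S\<^sub>i\<^sub>l v))\<close>; each \<open>S\<^sub>i\<close> is formed with a weight \<open>\<mu>\<close> of the vector to
  which it is applied.\<close>

inductive_set S_orbit ::
    "nat \<Rightarrow> complex \<Rightarrow> ('v::complex_vector) qmod \<Rightarrow> 'v \<Rightarrow> 'v set"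
  for n t M v where
  start: "v \<in> S_orbit n t M v"
| step: "w \<in> S_orbit n t M v \<Longrightarrow> \<mu> \<in> weight_lattice n \<Longrightarrow> w \<in> weight_space n t M \<mu> \<Longrightarrow> i \<le> n
    \<Longrightarrow> S_op n t M \<mu> i w \<in> S_orbit n t M v"

definition extremal :: "nat \<Rightarrow> complex \<Rightarrow> ('v::complex_vector) qmod \<Rightarrow> 'v \<Rightarrow> bool" where
  "extremal n t M v \<longleftrightarrow>
     (\<forall>w\<in>S_orbit n t M v.
        (\<exists>\<mu>\<in>weight_lattice n. w \<in> weight_space n t M \<mu>) \<and>
        (\<forall>\<mu>\<in>weight_lattice n. w \<in> weight_space n t M \<mu> \<longrightarrow> (\<forall>i\<le>n. i_extremal n M \<mu> i w)))"

definition vertical_generators :: "nat \<Rightarrow> nat \<Rightarrow> 'v qmod \<Rightarrow> ('v \<Rightarrow> 'v) set" where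
  "vertical_generators n j M =
     {xop M \<epsilon> i r | \<epsilon> i r. i \<le> n \<and> i \<noteq> j}
     \<union> {hop M i m | i m. i \<le> n \<and> i \<noteq> j \<and> m \<noteq> 0}
     \<union> {kop M h | h. Poly_Mapping.keys h \<subseteq> {..n} - {j}}"

definition extremal_loop_weight_module ::
    "nat \<Rightarrow> complex \<Rightarrow> monomial \<Rightarrow> ('v::complex_vector) qmod \<Rightarrow> bool" where
  "extremal_loop_weight_module n t m M \<longleftrightarrow>
     is_monomial n m \<and> integrable n t M \<and>
     (\<exists>v\<in>lweight_space n t M m.
        cyclic_span (generators n M) v = space M \<and>
        extremal n t M v \<and>
        (\<forall>j\<le>n. \<forall>w\<in>space M. finite_dimensional (cyclic_span (vertical_generators n j M) w)))"


section \<open>The Drinfeld coproduct\<close>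

text \<open>\<open>s\<close> is the family of coefficients of a vector-valued Laurent series in \<open>u\<close>; it is the
  expansion at \<open>u = 0\<close> of the rational function \<open>(\<Sum>\<^sub>k c\<^sub>k u\<^sup>k) / p(u)\<close>, which is regular at
  \<open>u = 1\<close>.\<close>

definition is_expansion :: "(int \<Rightarrow> 'v::complex_vector) \<Rightarrow> (int \<Rightarrow> 'v) \<Rightarrow> complex poly \<Rightarrow> bool" where
  "is_expansion s c p \<longleftrightarrow>
     finite {k. c k \<noteq> 0} \<and> poly p 1 \<noteq> 0 \<and>
     (\<exists>B. \<forall>k<B. s k = 0) \<and>
     (\<forall>k. (\<Sum>j\<le>degree p. coeff p j *\<^sub>C s (k - int j)) = c k)"

definition value_at_one :: "(int \<Rightarrow> 'v::complex_vector) \<Rightarrow> 'v" where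
  "value_at_one s =
     (THE y. \<exists>c p. is_expansion s c p \<and> y = inverse (poly p 1) *\<^sub>C (\<Sum>k | c k \<noteq> 0. c k))"

text \<open>Coefficient of \<open>u\<^sup>k\<close> in the deformed action of \<open>x\<^sup>\<plusminus>\<^sub>i\<^sub>,\<^sub>m\<close>: on \<open>v \<otimes> w\<close> the series is
  \<open>x\<^sup>+\<^sub>i\<^sub>,\<^sub>m v \<otimes> w + \<Sum>\<^sub>r\<^sub>\<ge>\<^sub>0 u\<^sup>m\<^sup>+\<^sup>r \<phi>\<^sup>-\<^sub>i\<^sub>,\<^sub>-\<^sub>r v \<otimes> x\<^sup>+\<^sub>i\<^sub>,\<^sub>m\<^sub>+\<^sub>r w\<close> and
  \<open>\<Sum>\<^sub>r\<^sub>\<ge>\<^sub>0 u\<^sup>r x\<^sup>-\<^sub>i\<^sub>,\<^sub>m\<^sub>-\<^sub>r v \<otimes> \<phi>\<^sup>+\<^sub>i\<^sub>,\<^sub>r w + u\<^sup>m v \<otimes> x\<^sup>-\<^sub>i\<^sub>,\<^sub>m w\<close> respectively.\<close>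

fun drinfeld_coeff ::
    "complex \<Rightarrow> ('v::complex_vector) qmod \<Rightarrow> ('w::complex_vector) qmod
      \<Rightarrow> pm \<Rightarrow> nat \<Rightarrow> int \<Rightarrow> int \<Rightarrow> ('v, 'w) tensor \<Rightarrow> ('v, 'w) tensor" where
  "drinfeld_coeff t M N Pos i m k y =
     (if k = 0 then tensor_map (xop M Pos i m) id y else 0) +
     (if k \<ge> m then tensor_map (phi t M Neg i (nat (k - m))) (xop N Pos i k) y else 0)"
| "drinfeld_coeff t M N Neg i m k y =
     (if k \<ge> 0 then tensor_map (xop M Neg i (m - k)) (phi t N Pos i (nat k)) y else 0) +
     (if k = m then tensor_map id (xop N Neg i m) y else 0)"

text \<open>For modules \<open>M\<close> and \<open>N\<close> whose underlying spaces are the full types.\<close>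

definition drinfeld_tensor ::
    "complex \<Rightarrow> ('v::complex_vector) qmod \<Rightarrow> ('w::complex_vector) qmod
      \<Rightarrow> ('v, 'w) tensor qmod" where
  "drinfeld_tensor t M N =
     qmod_of_phi t UNIV
       (\<lambda>\<epsilon> i m y. value_at_one (\<lambda>k. drinfeld_coeff t M N \<epsilon> i m k y))
       (\<lambda>h. tensor_map (kop M h) (kop N h))
       (\<lambda>\<epsilon> i s y. \<Sum>r\<le>s. tensor_map (phi t M \<epsilon> i r) (phi t N \<epsilon> i (s - r)) y)"

definition generated_submodule ::
    "nat \<Rightarrow> ('v::complex_vector) qmod \<Rightarrow> 'v \<Rightarrow> 'v qmod" where
  "generated_submodule n M v = M\<lparr>space := cyclic_span (generators n M) v\<rparr>"


definition tensor_submodule ::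
    "nat \<Rightarrow> complex \<Rightarrow> ('v::complex_vector) qmod \<Rightarrow> ('w::complex_vector) qmod
      \<Rightarrow> 'v \<Rightarrow> 'w \<Rightarrow> ('v, 'w) tensor qmod" where
  "tensor_submodule n t M N v w =
     generated_submodule n (drinfeld_tensor t M N) (v \<otimes>\<^sub>t w)"


section \<open>The vector representation and its twist\<close>

definition box :: "int \<Rightarrow> (int \<Rightarrow>\<^sub>0 complex)" where
  "box j = Poly_Mapping.single j 1"

definition linear_extension ::
    "(int \<Rightarrow> (int \<Rightarrow>\<^sub>0 complex)) \<Rightarrow> (int \<Rightarrow>\<^sub>0 complex) \<Rightarrow> (int \<Rightarrow>\<^sub>0 complex)" where
  "linear_extension g f = (\<Sum>j\<in>Poly_Mapping.keys f. Poly_Mapping.lookup f j *\<^sub>C g j)"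

definition box_weight :: "nat \<Rightarrow> int \<Rightarrow> cartan" where
  "box_weight n j =
     (if j \<ge> 1 then varpi 1 - (\<Sum>s = 1..j - 1. simple_root n (vertex n s))
      else varpi 1 + (\<Sum>s = j..0. simple_root n (vertex n s)))"

fun box_x :: "nat \<Rightarrow> complex \<Rightarrow> complex \<Rightarrow> pm \<Rightarrow> nat \<Rightarrow> int \<Rightarrow> int \<Rightarrow> (int \<Rightarrow>\<^sub>0 complex)" where
  "box_x n t a Pos i r j =
     (if i = vertex n (j - 1) then ((a * exp t powi (j - 1)) powi r) *\<^sub>C box (j - 1) else 0)"
| "box_x n t a Neg i r j =
     (if i = vertex n j then ((a * exp t powi j) powi r) *\<^sub>C box (j + 1) else 0)"

definition box_phi :: "nat \<Rightarrow> complex \<Rightarrow> complex \<Rightarrow> pm \<Rightarrow> nat \<Rightarrow> int \<Rightarrow> complex fps" where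
  "box_phi n t a \<epsilon> i j =
     (if i = vertex n j then psi_series t \<epsilon> (a * exp t powi j)
      else if i = vertex n (j - 1) then inverse (psi_series t \<epsilon> (a * exp t powi (j + 1)))
      else 1)"

definition vector_rep :: "nat \<Rightarrow> complex \<Rightarrow> complex \<Rightarrow> (int \<Rightarrow>\<^sub>0 complex) qmod" where
  "vector_rep n t a =
     qmod_of_phi t UNIV
       (\<lambda>\<epsilon> i r. linear_extension (box_x n t a \<epsilon> i r))
       (\<lambda>h. linear_extension (\<lambda>j. qexp t (pairing n (box_weight n j) h) *\<^sub>C box j))
       (\<lambda>\<epsilon> i s. linear_extension (\<lambda>j. fps_nth (box_phi n t a \<epsilon> i j) s *\<^sub>C box j))"

definition neg_vertex :: "nat \<Rightarrow> nat \<Rightarrow> nat" where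
  "neg_vertex n i = vertex n (- int i)"

definition iota_cartan :: "nat \<Rightarrow> cartan \<Rightarrow> cartan" where
  "iota_cartan n h =
     (\<Sum>i\<le>n. Poly_Mapping.single (neg_vertex n i) (Poly_Mapping.lookup h i))
     + Poly_Mapping.single (n + 1) (Poly_Mapping.lookup h (n + 1))"

definition iota_twist :: "nat \<Rightarrow> 'v qmod \<Rightarrow> 'v qmod" where
  "iota_twist n M =
     \<lparr> space = space M,
       xop = (\<lambda>\<epsilon> i. xop M \<epsilon> (neg_vertex n i)),
       kop = (\<lambda>h. kop M (iota_cartan n h)),
       hop = (\<lambda>i. hop M (neg_vertex n i)) \<rparr>"

definition fund_loop_module ::
    "nat \<Rightarrow> complex \<Rightarrow> nat \<Rightarrow> complex \<Rightarrow> (int \<Rightarrow>\<^sub>0 complex) qmod" where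
  "fund_loop_module n t l a =
     (if l = 1 then vector_rep n t a else iota_twist n (vector_rep n t a))"

end

theory Submission
  imports Defs "HOL-Computational_Algebra.Polynomial_FPS"
begin

text \<open>In the highest weight factor the vectors \<open>r\<^sub>0, r\<^sub>1, \<dots>\<close> of the one-row Young diagrams can be computed
  without a model of the module: two candidates for the same vector differ by a vector that all
  raising operators annihilate, and in a simple module such a vector of positive degree is zero.
  Adding a box to a row of length at least one is possible at its end and below its first box.  The
  second possibility produces a pole of the lowering current which the zero of the current \<open>\<phi>\<close> on the
  other tensor factor cancels exactly when \<open>b = aq\<close>.  The same holds for the rows \<open>s\<^sub>0, s\<^sub>1, \<dots>\<close> of the
  lowest weight factor.  Hence the vectors \<open>r\<^sub>k \<otimes> s\<^sub>0\<close> and \<open>r\<^sub>0 \<otimes> s\<^sub>k\<close> span a submodule on which the operators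
  are those of the vector representation, and all required properties can be read off from the
  explicit basis of the latter.\<close>

section \<open>Linear maps and finitely supported functions\<close>

text \<open>Neither the Drinfeld tensor product nor its submodule is known beforehand to be a
  module: the deformed operators are values at u = 1 chosen by a definite description, under control
  only where the series is known to be rational. All relations are therefore checked for the
  explicit module \<open>F\<close> on its basis and carried to the range of an injective map
  \<open>g\<close> that intertwines the operators; nothing has to be known outside that range. The
  factors \<open>V\<close> and \<open>W\<close> are arbitrary simple modules, given without a weight
  space decomposition. Degree is measured by a single operator, k_h for the element
  \<open>coheight\<close> on which every simple root takes the value 1, and products of operators
  k_h - const replace the decomposition into eigenspaces. The lowest weight factor gets no separate
  treatment: raising and lowering operators are parameters of \<open>highest_module\<close>, and
  \<open>W\<close> is an instance after they are exchanged and 1/z is substituted for z. For b = aq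
  the parameters of both instances fit into one geometric sequence over all integers, with
  \<open>W.c k\<close> the inverse of \<open>c (1 - k)\<close>.\<close>

abbreviation clin :: "('a::complex_vector \<Rightarrow> 'b::complex_vector) \<Rightarrow> bool" where
  "clin f \<equiv> Vector_Spaces.linear scaleC scaleC f"

global_interpretation cpair: vector_space_pair
  "scaleC :: complex \<Rightarrow> 'a \<Rightarrow> 'a::complex_vector" "scaleC :: complex \<Rightarrow> 'b \<Rightarrow> 'b::complex_vector"
  by unfold_locales

lemma clin_iff: "clin f \<longleftrightarrow> (\<forall>x y. f (x + y) = f x + f y) \<and> (\<forall>c x. f (c *\<^sub>C x) = c *\<^sub>C f x)"
  by (auto simp: Vector_Spaces.linear_iff cvec.vector_space_axioms)

lemma linear_on_UNIV: "linear_on_space UNIV f \<longleftrightarrow> clin f"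
  by (simp add: linear_on_space_def clin_iff)

lemma clin_add: "clin f \<Longrightarrow> f (x + y) = f x + f y"
  and clin_scale: "clin f \<Longrightarrow> f (c *\<^sub>C x) = c *\<^sub>C f x"
  by (simp_all add: clin_iff)

lemma clin_zero: "clin f \<Longrightarrow> f 0 = 0"
  by (metis clin_scale cvec.scale_zero_left)

lemma clin_diff: "clin f \<Longrightarrow> f (x - y) = f x - f y"
  by (rule cpair.linear_diff)

lemma clin_neg: "clin f \<Longrightarrow> f (- x) = - f x"
  by (rule cpair.linear_neg)

lemma clin_sum: "clin f \<Longrightarrow> f (sum g A) = (\<Sum>x\<in>A. f (g x))"
  by (rule cpair.linear_sum)

lemma clin_compose: "clin f \<Longrightarrow> clin g \<Longrightarrow> clin (\<lambda>x. f (g x))"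
  by (simp add: clin_iff)

lemma clin_intros:
  "clin (\<lambda>x. x)" "clin (\<lambda>x. 0)" "clin id"
  "clin f \<Longrightarrow> clin g \<Longrightarrow> clin (\<lambda>x. f x + g x)"
  "clin f \<Longrightarrow> clin g \<Longrightarrow> clin (\<lambda>x. f x - g x)"
  "clin f \<Longrightarrow> clin (\<lambda>x. c *\<^sub>C f x)"
  "clin f \<Longrightarrow> clin g \<Longrightarrow> clin (\<lambda>x. if b then f x else g x)"
  by (auto simp: clin_iff scaleC_add_right cvec.scale_right_diff_distrib
      cvec.scale_left_commute)

lemma clin_sum_fun: "(\<And>k. k \<in> A \<Longrightarrow> clin (f k)) \<Longrightarrow> clin (\<lambda>x. \<Sum>k\<in>A. f k x)"
  by (simp add: clin_iff sum.distrib cvec.scale_sum_right)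

lemma poly_mapping_sum_single:
  "(p :: 'k \<Rightarrow>\<^sub>0 complex) = (\<Sum>k\<in>Poly_Mapping.keys p. Poly_Mapping.lookup p k *\<^sub>C Poly_Mapping.single k 1)"
proof (rule poly_mapping_eqI)
  fix k
  have "Poly_Mapping.lookup p x * (if x = k then 1 else 0) =
      (if k = x then Poly_Mapping.lookup p k else 0)" for x by simp
  then show "Poly_Mapping.lookup p k = Poly_Mapping.lookup
      (\<Sum>k\<in>Poly_Mapping.keys p. Poly_Mapping.lookup p k *\<^sub>C Poly_Mapping.single k 1) k"
    by (simp add: lookup_sum scaleC_poly_mapping.rep_eq scaleC_complex_def lookup_single when_def
      in_keys_iff)
qed

lemma clin_poly_mapping_eqI:
  fixes f g :: "('k \<Rightarrow>\<^sub>0 complex) \<Rightarrow> 'b::complex_vector"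
  assumes "clin f" "clin g" "\<And>k. f (Poly_Mapping.single k 1) = g (Poly_Mapping.single k 1)"
  shows "f p = g p"
  by (subst (1 2) poly_mapping_sum_single) (simp add: clin_sum clin_scale assms)

text \<open>\<open>linear_extension\<close> for arbitrary index and target types; the lift of
  bilinear maps out of a tensor product and the intertwiner \<open>g\<close> both use it.\<close>

definition pm_extend :: "('k \<Rightarrow> 'b::complex_vector) \<Rightarrow> ('k \<Rightarrow>\<^sub>0 complex) \<Rightarrow> 'b" where
  "pm_extend g f = (\<Sum>j\<in>Poly_Mapping.keys f. Poly_Mapping.lookup f j *\<^sub>C g j)"

lemma pm_extend_superset:
  "finite A \<Longrightarrow> Poly_Mapping.keys f \<subseteq> A \<Longrightarrow> pm_extend g f = (\<Sum>j\<in>A. Poly_Mapping.lookup f j *\<^sub>C g j)"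
  unfolding pm_extend_def by (rule sum.mono_neutral_left) (auto simp: in_keys_iff)

lemma clin_pm_extend: "clin (pm_extend g)"
  unfolding clin_iff
proof (intro conjI allI)
  fix x y :: "'a \<Rightarrow>\<^sub>0 complex" and c
  let ?A = "Poly_Mapping.keys x \<union> Poly_Mapping.keys y"
  have "pm_extend g (x + y) = (\<Sum>j\<in>?A. Poly_Mapping.lookup (x + y) j *\<^sub>C g j)"
    by (rule pm_extend_superset) (auto dest: subsetD[OF keys_add])
  then show "pm_extend g (x + y) = pm_extend g x + pm_extend g y"
    by (simp add: pm_extend_superset[of ?A] lookup_add scaleC_add_left sum.distrib)
  have "pm_extend g (c *\<^sub>C x) = (\<Sum>j\<in>Poly_Mapping.keys x. Poly_Mapping.lookup (c *\<^sub>C x) j *\<^sub>C g j)"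
    by (rule pm_extend_superset)
      (auto simp: in_keys_iff scaleC_poly_mapping.rep_eq scaleC_complex_def)
  then show "pm_extend g (c *\<^sub>C x) = c *\<^sub>C pm_extend g x"
    by (simp add: pm_extend_def scaleC_poly_mapping.rep_eq scaleC_complex_def cvec.scale_sum_right)
qed

lemma pm_extend_single [simp]: "pm_extend g (Poly_Mapping.single k 1) = g k"
  by (simp add: pm_extend_def)

section \<open>Linear maps out of a tensor product\<close>

lemma tensor_add_left: "(v + v') \<otimes>\<^sub>t w = v \<otimes>\<^sub>t w + v' \<otimes>\<^sub>t w"
  by transfer (force simp: tensor_rel_def tensor_relators_def diff_diff_eq intro!: cvec.span_base)

lemma tensor_add_right: "v \<otimes>\<^sub>t (w + w') = v \<otimes>\<^sub>t w + v \<otimes>\<^sub>t w'"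
  by transfer (force simp: tensor_rel_def tensor_relators_def diff_diff_eq intro!: cvec.span_base)

lemma tensor_scale_left: "(c *\<^sub>C v) \<otimes>\<^sub>t w = c *\<^sub>C (v \<otimes>\<^sub>t w)"
  by transfer (force simp: tensor_rel_def tensor_relators_def intro!: cvec.span_base)

lemma tensor_scale_right: "v \<otimes>\<^sub>t (c *\<^sub>C w) = c *\<^sub>C (v \<otimes>\<^sub>t w)"
  by transfer (force simp: tensor_rel_def tensor_relators_def intro!: cvec.span_base)

lemma clin_tensor_left: "clin (\<lambda>v. v \<otimes>\<^sub>t w)"
  and clin_tensor_right: "clin (\<lambda>w. v \<otimes>\<^sub>t w)"
  by (simp_all add: clin_iff tensor_add_left tensor_add_right tensor_scale_left tensor_scale_right)

lemma clin_abs_tensor: "clin abs_tensor"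
  by (simp add: clin_iff plus_tensor.abs_eq scaleC_tensor.abs_eq)

lemma pure_tensor_abs: "v \<otimes>\<^sub>t w = abs_tensor (Poly_Mapping.single (v, w) 1)"
  by (simp add: pure_tensor.abs_eq)

lemma clin_tensor_eqI:
  assumes "clin F" "clin G" "\<And>v w. F (v \<otimes>\<^sub>t w) = G (v \<otimes>\<^sub>t w)"
  shows "F y = G y"
proof -
  have "F (abs_tensor p) = G (abs_tensor p)" for p
    by (rule clin_poly_mapping_eqI[OF clin_compose[OF assms(1) clin_abs_tensor]
          clin_compose[OF assms(2) clin_abs_tensor]])
      (metis assms(3) pure_tensor_abs surj_pair)
  then show ?thesis
    by (metis Quotient3_abs_rep Quotient3_tensor)
qed

text \<open>The linear extension of \<beta> to formal combinations of pairs kills the relators,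
  hence descends to the quotient. With the uniqueness in \<open>clin_tensor_eqI\<close> this gives
  meaning to the definite description in \<open>tensor_map\<close>.\<close>

lemma tensor_lift_exists:
  fixes \<beta> :: "'v::complex_vector \<Rightarrow> 'w::complex_vector \<Rightarrow> 'x::complex_vector"
  assumes l: "\<And>w. clin (\<lambda>v. \<beta> v w)" and r: "\<And>v. clin (\<beta> v)"
  shows "\<exists>F. clin F \<and> (\<forall>v w. F (v \<otimes>\<^sub>t w) = \<beta> v w)"
proof -
  define G where "G = pm_extend (\<lambda>(v, w). \<beta> v w)"
  have G: "clin G" by (simp add: G_def clin_pm_extend)
  have S: "G (Poly_Mapping.single (v, w) 1) = \<beta> v w" for v w by (simp add: G_def)
  have "G x = 0" if "x \<in> cvec.span tensor_relators" for x :: "('v \<times> 'w) \<Rightarrow>\<^sub>0 complex"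
    using that
  proof (rule cvec.span_induct)
    show "cvec.subspace {x. G x = 0}"
      by (rule cpair.linear_subspace_kernel[OF G])
  next
    fix x :: "('v \<times> 'w) \<Rightarrow>\<^sub>0 complex" assume "x \<in> tensor_relators"
    then show "G x = 0"
      using l r by (auto simp: tensor_relators_def clin_diff[OF G] clin_scale[OF G] S clin_iff)
  qed
  then have eq: "G f = G g" if "tensor_rel f g" for f g
    using that clin_diff[OF G, of f g] by (simp add: tensor_rel_def)
  define F where "F = (\<lambda>y. G (rep_tensor y))"
  have FA: "F (abs_tensor p) = G p" for p
    unfolding F_def
    by (metis Quotient3_rel_abs Quotient3_tensor Quotient3_rep_abs eq equivp_reflp equivp_tensor_rel)
  have FF: "F x = F (abs_tensor (rep_tensor x))" for x
    by (metis Quotient3_abs_rep Quotient3_tensor)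
  have "clin F"
    unfolding clin_iff
  proof (intro conjI allI)
    fix x y :: "('v, 'w) tensor" and c
    have "x + y = abs_tensor (rep_tensor x + rep_tensor y)" "c *\<^sub>C x = abs_tensor (c *\<^sub>C rep_tensor x)"
      by (metis Quotient3_abs_rep Quotient3_tensor plus_tensor.abs_eq scaleC_tensor.abs_eq)+
    then show "F (x + y) = F x + F y" "F (c *\<^sub>C x) = c *\<^sub>C F x"
      by (simp_all add: FA clin_add[OF G] clin_scale[OF G]) (simp_all add: F_def)
  qed
  moreover have "F (v \<otimes>\<^sub>t w) = \<beta> v w" for v w
    by (simp add: pure_tensor_abs FA S)
  ultimately show ?thesis by blast
qed

lemma tensor_map_props:
  assumes "clin A" "clin B"
  shows clin_tensor_map: "clin (tensor_map A B)"
    and tensor_map_pure: "tensor_map A B (v \<otimes>\<^sub>t w) = A v \<otimes>\<^sub>t B w"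
proof -
  have "\<exists>F. clin F \<and> (\<forall>v w. F (v \<otimes>\<^sub>t w) = A v \<otimes>\<^sub>t B w)"
    by (rule tensor_lift_exists)
      (use assms in \<open>simp_all add: clin_iff tensor_add_left tensor_add_right
        tensor_scale_left tensor_scale_right\<close>)
  then have "\<exists>!F. clin F \<and> (\<forall>v w. F (v \<otimes>\<^sub>t w) = A v \<otimes>\<^sub>t B w)"
    using clin_tensor_eqI by (metis ext)
  from theI'[OF this] show "clin (tensor_map A B)" "tensor_map A B (v \<otimes>\<^sub>t w) = A v \<otimes>\<^sub>t B w"
    unfolding tensor_map_def by auto
qed

lemma functional_exists:
  assumes "(v::'a::complex_vector) \<noteq> 0"
  shows "\<exists>f :: 'a \<Rightarrow> complex. clin f \<and> f v = 1"
  using cpair.linear_independent_extend[of "{v}" "\<lambda>_. 1::complex"] assms by auto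

text \<open>Functionals with value 1 on the two vectors multiply to a functional with value 1 on
  their tensor product.\<close>

lemma tensor_nonzero:
  assumes "v \<noteq> 0" "w \<noteq> 0"
  shows "v \<otimes>\<^sub>t w \<noteq> 0"
proof -
  obtain f g :: "_ \<Rightarrow> complex" where fg: "clin f" "f v = 1" "clin g" "g w = 1"
    using functional_exists assms by metis
  obtain F where F: "clin F" "\<And>v w. F (v \<otimes>\<^sub>t w) = f v * g w"
    using tensor_lift_exists[of "\<lambda>v w. f v * g w"] fg
    by (auto simp: clin_iff scaleC_complex_def algebra_simps)
  have "F (v \<otimes>\<^sub>t w) = 1" using F fg by simp
  then show ?thesis using clin_zero[OF F(1)] by auto
qed

section \<open>Values of rational functions\<close>

text \<open>Coefficient of u^k in p(u) times the series s(u), so that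
  \<open>is_expansion s c p\<close> asks for \<open>conv p s = c\<close>.\<close>

definition conv :: "complex poly \<Rightarrow> (int \<Rightarrow> 'v::complex_vector) \<Rightarrow> int \<Rightarrow> 'v" where
  "conv p s k = (\<Sum>j\<le>degree p. coeff p j *\<^sub>C s (k - int j))"

lemma conv_superset: "degree p \<le> m \<Longrightarrow> conv p s k = (\<Sum>j\<le>m. coeff p j *\<^sub>C s (k - int j))"
  unfolding conv_def by (rule sum.mono_neutral_left) (auto simp: coeff_eq_0)

lemma conv_0 [simp]: "conv 0 s = (\<lambda>k. 0)"
  by (auto simp: conv_def)

lemma conv_pCons: "conv (pCons a p) s k = a *\<^sub>C s k + conv p s (k - 1)"
proof -
  have "conv (pCons a p) s k = (\<Sum>j\<le>Suc (degree p). coeff (pCons a p) j *\<^sub>C s (k - int j))"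
    by (rule conv_superset) (rule degree_pCons_le)
  also have "\<dots> = a *\<^sub>C s k + (\<Sum>j\<le>degree p. coeff p j *\<^sub>C s (k - int (Suc j)))"
    by (subst sum.atMost_Suc_shift) simp
  finally show ?thesis by (simp add: conv_def algebra_simps)
qed

lemma conv_add: "conv (p + r) s k = conv p s k + conv r s k"
  by (simp add: conv_superset[of _ "max (degree p) (degree r)"] degree_add_le scaleC_add_left
      sum.distrib)

lemma conv_smult: "conv (smult a p) s k = a *\<^sub>C conv p s k"
  by (simp add: conv_superset[of "smult a p" "degree p"] degree_smult_le)
    (simp add: conv_def cvec.scale_sum_right)

lemma conv_mult: "conv (p * r) s k = conv p (conv r s) k"
  by (induction p arbitrary: k) (simp_all add: conv_pCons conv_add conv_smult)

lemma conv_fun_add: "conv p (\<lambda>k. s k + s' k) k = conv p s k + conv p s' k"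
  by (simp add: conv_def scaleC_add_right sum.distrib)

lemma finite_support_conv: "finite {k. c k \<noteq> 0} \<Longrightarrow> finite {k. conv p c k \<noteq> 0}"
proof (induction p)
  case 0 then show ?case by simp
next
  case (pCons a p)
  have "{k. conv (pCons a p) c k \<noteq> 0} \<subseteq> {k. c k \<noteq> 0} \<union> (\<lambda>k. k + 1) ` {k. conv p c k \<noteq> 0}"
  proof
    fix k assume "k \<in> {k. conv (pCons a p) c k \<noteq> 0}"
    then have "c k \<noteq> 0 \<or> conv p c (k - 1) \<noteq> 0" by (auto simp: conv_pCons)
    then show "k \<in> {k. c k \<noteq> 0} \<union> (\<lambda>k. k + 1) ` {k. conv p c k \<noteq> 0}"
      by (auto intro!: image_eqI[of k _ "k - 1"])
  qed
  then show ?case using pCons by (meson finite_UnI finite_imageI finite_subset)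
qed

lemma Sum_any_shift: "Sum_any (\<lambda>k::int. (f (k - 1) :: 'b::comm_monoid_add)) = Sum_any f"
proof -
  have "bij (\<lambda>k::int. k - 1)" by (rule bij_diff_right)
  then show ?thesis by (intro Sum_any.reindex_cong[of "\<lambda>k. k + 1"]) (auto simp: o_def bij_plus_right)
qed

text \<open>Summing the finitely many coefficients is evaluation at u = 1, which is
  multiplicative.\<close>

lemma Sum_any_conv:
  "finite {k. c k \<noteq> 0} \<Longrightarrow> Sum_any (conv p c) = poly p 1 *\<^sub>C Sum_any c"
proof (induction p)
  case 0 then show ?case by simp
next
  case (pCons a p)
  have f1: "finite {k. a *\<^sub>C c k \<noteq> 0}"
    by (rule finite_subset[OF _ pCons.prems]) auto
  have f2: "finite {k. conv p c (k - 1) \<noteq> 0}"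
    using finite_imageI[OF finite_support_conv[OF pCons.prems, of p], of "\<lambda>k. k + 1"]
    by (rule rev_finite_subset) (auto intro!: image_eqI[of _ _ "_ - 1"])
  have "Sum_any (conv (pCons a p) c) = Sum_any (\<lambda>k. a *\<^sub>C c k + conv p c (k - 1))"
    by (simp add: conv_pCons)
  also have "\<dots> = Sum_any (\<lambda>k. a *\<^sub>C c k) + Sum_any (conv p c)"
    by (simp add: Sum_any.distrib[OF f1 f2] Sum_any_shift)
  also have "Sum_any (\<lambda>k. a *\<^sub>C c k) = a *\<^sub>C Sum_any c"
    by (simp add: Sum_any.expand_superset[OF pCons.prems, of "\<lambda>k. a *\<^sub>C c k"]
        Sum_any.expand_set[of c] cvec.scale_sum_right subset_eq)
  finally show ?case using pCons by (simp add: scaleC_add_left)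
qed

text \<open>The relation behind \<open>value_at_one\<close>, without the definite description. Sums
  and linear images are formed with it, since \<open>value_at_one\<close> says nothing until a value
  is known to exist.\<close>

definition has_value :: "(int \<Rightarrow> 'v::complex_vector) \<Rightarrow> 'v \<Rightarrow> bool" where
  "has_value s y \<longleftrightarrow> (\<exists>c p. is_expansion s c p \<and> y = inverse (poly p 1) *\<^sub>C (\<Sum>k | c k \<noteq> 0. c k))"

lemma has_value_iff:
  "has_value s y \<longleftrightarrow> (\<exists>p. finite {k. conv p s k \<noteq> 0} \<and> poly p 1 \<noteq> 0 \<and> (\<exists>B. \<forall>k<B. s k = 0) \<and>
      y = inverse (poly p 1) *\<^sub>C Sum_any (conv p s))"
  (is "_ \<longleftrightarrow> ?R")
proof -
  have *: "is_expansion s c p \<longleftrightarrow> c = conv p s \<and> finite {k. c k \<noteq> 0} \<and> poly p 1 \<noteq> 0 \<and>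
      (\<exists>B. \<forall>k<B. s k = 0)" for c p
    by (auto simp: is_expansion_def conv_def fun_eq_iff)
  show ?thesis unfolding has_value_def * Sum_any.expand_set by blast
qed

text \<open>Cross multiplication: for denominators p and r the products r(ps) and p(rs) are the same
  finite series, and evaluating it at u = 1 in both ways compares the two values.\<close>

lemma has_value_unique: "has_value s y \<Longrightarrow> has_value s y' \<Longrightarrow> y = y'"
proof -
  assume "has_value s y" "has_value s y'"
  then obtain p r where p: "finite {k. conv p s k \<noteq> 0}" "poly p 1 \<noteq> 0"
     "y = inverse (poly p 1) *\<^sub>C Sum_any (conv p s)"
   and r: "finite {k. conv r s k \<noteq> 0}" "poly r 1 \<noteq> 0"
     "y' = inverse (poly r 1) *\<^sub>C Sum_any (conv r s)"
    unfolding has_value_iff by blast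
  have "conv r (conv p s) = conv p (conv r s)"
    by (simp add: fun_eq_iff mult.commute flip: conv_mult)
  then have "poly r 1 *\<^sub>C Sum_any (conv p s) = poly p 1 *\<^sub>C Sum_any (conv r s)"
    using Sum_any_conv[OF p(1), of r] Sum_any_conv[OF r(1), of p] by simp
  moreover have "(poly r 1 * poly p 1) *\<^sub>C y = poly r 1 *\<^sub>C Sum_any (conv p s)"
    "(poly r 1 * poly p 1) *\<^sub>C y' = poly p 1 *\<^sub>C Sum_any (conv r s)"
    using p(2) r(2) unfolding p(3) r(3) scaleC_scaleC by (simp_all add: field_simps)
  ultimately have "(poly r 1 * poly p 1) *\<^sub>C y = (poly r 1 * poly p 1) *\<^sub>C y'"
    using p r by simp
  then show ?thesis using p(2) r(2) by (metis cvec.scale_left_imp_eq no_zero_divisors)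
qed

lemma value_at_one_eq: "has_value s y \<Longrightarrow> value_at_one s = y"
  unfolding value_at_one_def has_value_def[symmetric]
  by (rule the_equality) (auto intro: has_value_unique)

lemma has_value_add:
  assumes "has_value s y" "has_value s' y'"
  shows "has_value (\<lambda>k. s k + s' k) (y + y')"
proof -
  obtain p r B B' where p: "finite {k. conv p s k \<noteq> 0}" "poly p 1 \<noteq> 0"
     "y = inverse (poly p 1) *\<^sub>C Sum_any (conv p s)" "\<forall>k<B. s k = 0"
   and r: "finite {k. conv r s' k \<noteq> 0}" "poly r 1 \<noteq> 0"
     "y' = inverse (poly r 1) *\<^sub>C Sum_any (conv r s')" "\<forall>k<B'. s' k = 0"
    using assms unfolding has_value_iff by blast
  have eq: "conv (p * r) (\<lambda>k. s k + s' k) = (\<lambda>k. conv r (conv p s) k + conv p (conv r s') k)"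
    by (simp add: fun_eq_iff conv_fun_add mult.commute flip: conv_mult)
  have f: "finite {k. conv r (conv p s) k \<noteq> 0}" "finite {k. conv p (conv r s') k \<noteq> 0}"
    using p r finite_support_conv by blast+
  show ?thesis
    unfolding has_value_iff
  proof (intro exI[of _ "p * r"] conjI)
    show "finite {k. conv (p * r) (\<lambda>k. s k + s' k) k \<noteq> 0}"
      unfolding eq by (rule finite_subset[OF _ finite_UnI[OF f]]) auto
    show "poly (p * r) 1 \<noteq> 0" using p r by simp
    show "\<exists>B. \<forall>k<B. s k + s' k = 0" using p(4) r(4) by (intro exI[of _ "min B B'"]) auto
    show "y + y' = inverse (poly (p * r) 1) *\<^sub>C Sum_any (conv (p * r) (\<lambda>k. s k + s' k))"
      unfolding eq Sum_any.distrib[OF f] Sum_any_conv[OF p(1)] Sum_any_conv[OF r(1)]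
      using p r by (simp add: scaleC_add_right field_simps)
  qed
qed

lemma conv_map: "clin f \<Longrightarrow> conv p (\<lambda>k. f (s k)) k = f (conv p s k)"
  by (simp add: conv_def clin_sum clin_scale)

lemma has_value_map:
  assumes "has_value s y" "clin f"
  shows "has_value (\<lambda>k. f (s k)) (f y)"
proof -
  obtain p B where p: "finite {k. conv p s k \<noteq> 0}" "poly p 1 \<noteq> 0"
     "y = inverse (poly p 1) *\<^sub>C Sum_any (conv p s)" "\<forall>k<B. s k = 0"
    using assms unfolding has_value_iff by blast
  have sub: "{k. f (conv p s k) \<noteq> 0} \<subseteq> {k. conv p s k \<noteq> 0}"
    using clin_zero[OF assms(2)] by auto
  have "Sum_any (\<lambda>k. f (conv p s k)) = f (Sum_any (conv p s))"
    unfolding Sum_any.expand_superset[OF p(1) sub] Sum_any.expand_set[of "conv p s"]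
    by (simp add: clin_sum[OF assms(2)])
  then show ?thesis
    unfolding has_value_iff conv_map[OF assms(2)]
    using p finite_subset[OF sub p(1)] clin_zero[OF assms(2)] clin_scale[OF assms(2)]
    by (intro exI[of _ p] conjI exI[of _ B]) auto
qed

lemma has_value_scale: "has_value s y \<Longrightarrow> has_value (\<lambda>k. c *\<^sub>C s k) (c *\<^sub>C y)"
  by (rule has_value_map) (auto intro!: clin_intros)

lemma has_value_single: "has_value (\<lambda>k. if k = m then v else 0) v"
  unfolding has_value_iff
proof (intro exI[of _ "1 :: complex poly"] conjI)
  have c: "conv 1 s = s" for s :: "int \<Rightarrow> 'a" by (auto simp: conv_def)
  show "finite {k. conv 1 (\<lambda>k. if k = m then v else 0) k \<noteq> 0}"
    unfolding c by (rule finite_subset[of _ "{m}"]) auto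
  show "\<exists>B. \<forall>k<B. (if k = m then v else 0) = 0" by (rule exI[of _ m]) auto
  show "v = inverse (poly 1 1) *\<^sub>C Sum_any (conv 1 (\<lambda>k. if k = m then v else 0))"
    unfolding c by simp
qed simp

lemma has_value_zero: "has_value (\<lambda>k. 0) 0"
  using has_value_single[of 0 0] by simp

lemma has_value_sum:
  "finite A \<Longrightarrow> (\<And>a. a \<in> A \<Longrightarrow> has_value (s a) (y a)) \<Longrightarrow> has_value (\<lambda>k. \<Sum>a\<in>A. s a k) (\<Sum>a\<in>A. y a)"
  by (induction A rule: finite_induct) (auto intro: has_value_zero has_value_add)

section \<open>Expansions of the function psi\<close>

primrec opp :: "pm \<Rightarrow> pm" where "opp Pos = Neg" | "opp Neg = Pos"

lemma opp_opp [simp]: "opp (opp \<epsilon>) = \<epsilon>"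
  by (cases \<epsilon>) auto

lemma sgz_opp [simp]: "sgz (opp \<epsilon>) = - sgz \<epsilon>"
  by (cases \<epsilon>) auto

text \<open>The factor x - y z in the local parameter: z itself at 0, and z^-1 at infinity, where
  the factor is first multiplied by z^-1.\<close>

fun fps_lin :: "pm \<Rightarrow> complex \<Rightarrow> complex \<Rightarrow> complex fps" where
  "fps_lin Pos x y = fps_const x - fps_const y * fps_X"
| "fps_lin Neg x y = fps_const x * fps_X - fps_const y"

definition coef :: "pm \<Rightarrow> complex fps \<Rightarrow> int \<Rightarrow> complex" where
  "coef \<epsilon> f r = (if sgz \<epsilon> * r \<ge> 0 then fps_nth f (nat (sgz \<epsilon> * r)) else 0)"

lemma coef_opp: "coef (opp \<epsilon>) f (- r) = coef \<epsilon> f r"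
  by (simp add: coef_def)

lemma coef_one: "coef \<epsilon> 1 r = (if r = 0 then 1 else 0)"
  by (cases \<epsilon>) (auto simp: coef_def)

text \<open>The left side is the coefficient of z^r in (x - y z) f. At infinity
  \<open>fps_lin\<close> carries an extra z^-1, hence the index r - 1 on the right.\<close>

lemma fps_lin_coef:
  "x * coef \<epsilon> f r - y * coef \<epsilon> f (r - 1) =
     coef \<epsilon> (fps_lin \<epsilon> x y * f) (if \<epsilon> = Pos then r else r - 1)"
proof (cases \<epsilon>)
  case Pos
  have "fps_nth (fps_const y * fps_X * f) m = y * (if m = 0 then 0 else fps_nth f (m - 1))" for m
    by (simp add: mult.assoc)
  moreover have "nat (r - 1) = nat r - 1" by simp
  ultimately show ?thesis using Pos by (auto simp: coef_def left_diff_distrib)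
next
  case Neg
  have "fps_nth (fps_const x * fps_X * f) m = x * (if m = 0 then 0 else fps_nth f (m - 1))" for m
    by (simp add: mult.assoc)
  moreover have "nat (- r) = nat (1 - r) - 1" by simp
  ultimately show ?thesis using Neg by (auto simp: coef_def left_diff_distrib)
qed

text \<open>The extra shift at infinity occurs on both sides and drops out, so an identity of
  rational functions becomes a recurrence over all integers of the same form for both
  expansions.\<close>

lemma coef_recurrence:
  "fps_lin \<epsilon> x y * f = fps_lin \<epsilon> x' y' * g \<Longrightarrow>
     x * coef \<epsilon> f r - y * coef \<epsilon> f (r - 1) = x' * coef \<epsilon> g r - y' * coef \<epsilon> g (r - 1)"
  by (simp add: fps_lin_coef)

lemma psi_series_lin:
  "psi_series t \<epsilon> c = fps_lin \<epsilon> (exp t) (inverse (exp t) * c) / fps_lin \<epsilon> 1 c"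
  by (cases \<epsilon>) auto

declare psi_series.simps [simp del]

lemma fps_lin_nth_0: "fps_nth (fps_lin \<epsilon> x y) 0 = (if \<epsilon> = Pos then x else - y)"
  by (cases \<epsilon>) auto

lemma psi_mult:
  assumes "c \<noteq> 0"
  shows "fps_lin \<epsilon> 1 c * psi_series t \<epsilon> c = fps_lin \<epsilon> (exp t) (c / exp t)"
  unfolding psi_series_lin using assms
  by (subst fps_divide_unit)
    (auto simp: fps_lin_nth_0 divide_inverse mult.commute[of c] inverse_mult_eq_1' mult.left_commute)

lemma psi_nth_0:
  "c \<noteq> 0 \<Longrightarrow> fps_nth (psi_series t \<epsilon> c) 0 = (if \<epsilon> = Pos then exp t else inverse (exp t))"
  using arg_cong[OF psi_mult, of c "\<lambda>f. fps_nth f 0" \<epsilon> t]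
  by (auto simp: fps_lin_nth_0 field_simps split: if_splits)

lemma psi_inverse_mult:
  assumes "c \<noteq> 0"
  shows "psi_series t \<epsilon> c * inverse (psi_series t \<epsilon> c) = 1"
  by (rule inverse_mult_eq_1') (simp add: psi_nth_0 assms)

lemma inverse_psi_mult:
  assumes "c \<noteq> 0"
  shows "fps_lin \<epsilon> (exp t) (c / exp t) * inverse (psi_series t \<epsilon> c) = fps_lin \<epsilon> 1 c"
  unfolding psi_mult[OF assms, symmetric] by (simp add: mult.assoc psi_inverse_mult assms)

lemma fps_lin_scale: "fps_lin \<epsilon> (z * x) (z * y) = fps_const z * fps_lin \<epsilon> x y"
  by (cases \<epsilon>) (simp_all add: algebra_simps flip: fps_const_mult)

text \<open>The effect of substituting 1/z for z: both sides expand (q^-1 - q c z) / (1 - c z). This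
  turns the eigenvalues on the lowest weight factor into those of a highest weight module.\<close>

lemma psi_opp:
  assumes "c \<noteq> 0"
  shows "psi_series t (opp \<epsilon>) (inverse c) =
    inverse (psi_series t \<epsilon> (exp t ^ 2 * c))"
proof -
  let ?e = "opp \<epsilon>"
  have lin: "fps_lin ?e x y = - fps_lin \<epsilon> y x" for x y by (cases \<epsilon>) auto
  \<comment> \<open>Both sides are compared after multiplication by the common denominator 1 - c
    z.\<close>
  have eq: "fps_lin \<epsilon> 1 c * psi_series t ?e (inverse c) =
    fps_lin \<epsilon> 1 c * inverse (psi_series t \<epsilon> (exp t ^ 2 * c))"
  proof -
    have "fps_lin \<epsilon> 1 c = - (fps_const c * fps_lin ?e 1 (inverse c))"
      using assms fps_lin_scale[of \<epsilon> c "inverse c" 1] by (simp add: lin)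
    then have "fps_lin \<epsilon> 1 c * psi_series t ?e (inverse c) =
        - (fps_const c * (fps_lin ?e 1 (inverse c) * psi_series t ?e (inverse c)))"
      by (simp add: mult.assoc)
    also have "\<dots> = - (fps_const c * fps_lin ?e (exp t) (inverse c / exp t))"
      using assms by (simp add: psi_mult)
    also have "\<dots> = fps_const (inverse (exp t)) * fps_lin \<epsilon> 1 (exp t ^ 2 * c)"
      using assms by (simp add: lin power2_eq_square field_simps flip: fps_lin_scale)
    also have "\<dots> = fps_const (inverse (exp t)) *
        (fps_lin \<epsilon> (exp t) (exp t ^ 2 * c / exp t) * inverse (psi_series t \<epsilon> (exp t ^ 2 * c)))"
      using assms by (subst inverse_psi_mult) auto
    also have "\<dots> = fps_lin \<epsilon> 1 c * inverse (psi_series t \<epsilon> (exp t ^ 2 * c))"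
      using fps_lin_scale[of \<epsilon> "inverse (exp t)" "exp t" "exp t ^ 2 * c / exp t"]
      by (simp add: power2_eq_square flip: mult.assoc)
    finally show ?thesis .
  qed
  have "fps_lin \<epsilon> 1 c \<noteq> 0"
    by (metis fps_lin_nth_0 fps_zero_nth neg_equal_0_iff_equal zero_neq_one assms)
  with eq show ?thesis by simp
qed

section \<open>Values of series with geometric coefficients\<close>

lemma conv_shift: "conv p (\<lambda>k. s (k - r)) k = conv p s (k - r)"
  by (simp add: conv_def algebra_simps)

lemma Sum_any_shift_by: "Sum_any (\<lambda>k::int. (f (k - r) :: 'b::comm_monoid_add)) = Sum_any f"
  by (rule Sum_any.reindex_cong[of "\<lambda>k. k + r"]) (auto simp: o_def bij_plus_right)

lemma has_value_shift:
  assumes "has_value s y"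
  shows "has_value (\<lambda>k. s (k - r)) y"
proof -
  obtain p B where p: "finite {k. conv p s k \<noteq> 0}" "poly p 1 \<noteq> 0"
     "y = inverse (poly p 1) *\<^sub>C Sum_any (conv p s)" "\<forall>k<B. s k = 0"
    using assms unfolding has_value_iff by blast
  have "finite {k. conv p s (k - r) \<noteq> 0}"
    using finite_imageI[OF p(1), of "\<lambda>k. k + r"]
    by (rule rev_finite_subset) (auto intro!: image_eqI[of _ _ "_ - r"])
  moreover have "\<forall>k<B + r. s (k - r) = 0" using p(4) by auto
  ultimately show ?thesis
    unfolding has_value_iff conv_shift using p(2,3) Sum_any_shift_by[of "conv p s" r]
    by (intro exI[of _ p]) auto
qed

text \<open>The point \<open>b\<close> refers to the expansion variable of \<open>f\<close>, which
  is the inverse of the spectral variable for series belonging to \<open>Neg\<close>.\<close>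

definition fps_value :: "complex fps \<Rightarrow> complex \<Rightarrow> complex \<Rightarrow> bool" where
  "fps_value f b z \<longleftrightarrow> (\<exists>N D. fps_of_poly D * f = fps_of_poly N \<and> poly D b \<noteq> 0 \<and> z = poly N b / poly D b)"

lemma fps_value_one: "fps_value 1 b 1"
  unfolding fps_value_def by (intro exI[of _ 1]) simp

lemma fps_value_mult:
  assumes "fps_value f b z" "fps_value f' b z'"
  shows "fps_value (f * f') b (z * z')"
proof -
  obtain N D N' D' where "fps_of_poly D * f = fps_of_poly N" "poly D b \<noteq> 0" "z = poly N b / poly D b"
    "fps_of_poly D' * f' = fps_of_poly N'" "poly D' b \<noteq> 0" "z' = poly N' b / poly D' b"
    using assms unfolding fps_value_def by blast
  moreover from this have "fps_of_poly (D * D') * (f * f') = fps_of_poly (N * N')"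
    unfolding fps_of_poly_mult by (metis mult.assoc mult.left_commute)
  ultimately show ?thesis
    unfolding fps_value_def by (intro exI[of _ "N * N'"] exI[of _ "D * D'"]) simp
qed

fun poly_lin :: "pm \<Rightarrow> complex \<Rightarrow> complex \<Rightarrow> complex poly" where
  "poly_lin Pos x y = [:x, - y:]"
| "poly_lin Neg x y = [:- y, x:]"

lemma fps_of_poly_lin: "fps_of_poly (poly_lin \<epsilon> x y) = fps_lin \<epsilon> x y"
  by (cases \<epsilon>) (simp_all add: fps_of_poly_pCons fps_const_neg[symmetric] del: fps_const_neg)

lemma fps_value_psi:
  assumes "c \<noteq> 0" "poly (poly_lin \<epsilon> 1 c) b \<noteq> 0"
  shows "fps_value (psi_series t \<epsilon> c) b (poly (poly_lin \<epsilon> (exp t) (c / exp t)) b / poly (poly_lin \<epsilon> 1 c) b)"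
  unfolding fps_value_def
  by (intro exI[of _ "poly_lin \<epsilon> (exp t) (c / exp t)"] exI[of _ "poly_lin \<epsilon> 1 c"])
    (simp add: fps_of_poly_lin psi_mult assms)

lemma fps_value_inverse_psi:
  assumes "c \<noteq> 0" "poly (poly_lin \<epsilon> (exp t) (c / exp t)) b \<noteq> 0"
  shows "fps_value (inverse (psi_series t \<epsilon> c)) b (poly (poly_lin \<epsilon> 1 c) b / poly (poly_lin \<epsilon> (exp t) (c / exp t)) b)"
  unfolding fps_value_def
  by (intro exI[of _ "poly_lin \<epsilon> (exp t) (c / exp t)"] exI[of _ "poly_lin \<epsilon> 1 c"])
    (simp add: fps_of_poly_lin inverse_psi_mult assms)

lemma has_value_fps:
  assumes "fps_value f b z"
  shows "has_value (\<lambda>k. if k \<ge> 0 then (fps_nth f (nat k) * b ^ nat k) *\<^sub>C y else 0) (z *\<^sub>C y)"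
proof -
  obtain N D where ND: "fps_of_poly D * f = fps_of_poly N" "poly D b \<noteq> 0" "z = poly N b / poly D b"
    using assms unfolding fps_value_def by blast
  \<comment> \<open>D(b u) is a denominator of f(b u), and its value at u = 1 is D(b).\<close>
  define p where "p = pcompose D [:0, b:]"
  let ?s = "\<lambda>k. if k \<ge> 0 then (fps_nth f (nat k) * b ^ nat k) *\<^sub>C y else 0"
  have cp: "coeff p j = coeff D j * b ^ j" for j
    unfolding p_def by (induction D arbitrary: j) (auto simp: pcompose_pCons coeff_pCons split: nat.splits)
  have conv: "conv p ?s k = (if k \<ge> 0 then (coeff N (nat k) * b ^ nat k) *\<^sub>C y else 0)" for k
  proof (cases "k \<ge> 0")
    case False
    then show ?thesis by (simp add: conv_def)
  next
    case True
    define K where "K = nat k"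
    have k: "k = int K" using True by (simp add: K_def)
    have "conv p ?s k = (\<Sum>j\<le>max (degree p) K. coeff p j *\<^sub>C ?s (k - int j))"
      by (rule conv_superset) simp
    also have "\<dots> = (\<Sum>j\<le>K. coeff p j *\<^sub>C ?s (k - int j))"
      by (rule sum.mono_neutral_right) (auto simp: k)
    also have "\<dots> = (\<Sum>j\<le>K. (coeff D j * fps_nth f (K - j) * b ^ K) *\<^sub>C y)"
    proof (rule sum.cong)
      fix j assume "j \<in> {..K}"
      then have "nat (k - int j) = K - j" "k - int j \<ge> 0" "b ^ j * b ^ (K - j) = b ^ K"
        by (auto simp: k nat_diff_distrib simp flip: power_add)
      then show "coeff p j *\<^sub>C ?s (k - int j) = (coeff D j * fps_nth f (K - j) * b ^ K) *\<^sub>C y"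
        by (simp add: cp scaleC_scaleC mult_ac)
    qed simp
    also have "\<dots> = ((\<Sum>j=0..K. coeff D j * fps_nth f (K - j)) * b ^ K) *\<^sub>C y"
      by (simp add: sum_distrib_right cvec.scale_sum_left atMost_atLeast0)
    also have "(\<Sum>j=0..K. coeff D j * fps_nth f (K - j)) = coeff N K"
      using arg_cong[OF ND(1), of "\<lambda>f. fps_nth f K"] by (simp add: fps_mult_nth)
    finally show ?thesis using True by (simp add: K_def)
  qed
  have sub: "{k. conv p ?s k \<noteq> 0} \<subseteq> int ` {..degree N}"
    unfolding conv by (auto simp: image_iff le_degree intro!: bexI[of _ "nat _"] split: if_splits)
  have "Sum_any (conv p ?s) = (\<Sum>k\<in>int ` {..degree N}. conv p ?s k)"
    by (rule Sum_any.expand_superset[OF _ sub]) simp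
  also have "\<dots> = (\<Sum>k\<le>degree N. (coeff N k * b ^ k) *\<^sub>C y)"
    by (subst sum.reindex) (auto simp: conv)
  also have "\<dots> = poly N b *\<^sub>C y"
    by (simp add: poly_altdef cvec.scale_sum_left)
  finally have S: "Sum_any (conv p ?s) = poly N b *\<^sub>C y" .
  have p1: "poly p 1 = poly D b" by (simp add: p_def poly_pcompose)
  show ?thesis
    unfolding has_value_iff
  proof (intro exI[of _ p] conjI)
    show "finite {k. conv p ?s k \<noteq> 0}" by (rule finite_subset[OF sub]) simp
    show "\<exists>B. \<forall>k<B. ?s k = 0" by (intro exI[of _ 0]) auto
    show "z *\<^sub>C y = inverse (poly p 1) *\<^sub>C Sum_any (conv p ?s)"
      unfolding S p1 ND(3) by (simp add: scaleC_scaleC field_simps)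
  qed (use ND(2) p1 in simp)
qed

text \<open>The product of a rational function with a delta function at 1/c is its value there times
  the delta function. This is the shape of the series for x^-, where the modes of the lowering
  current on the left factor are proportional to c^(r - k).\<close>

lemma has_value_geometric:
  assumes "fps_value f (inverse c) z" "c \<noteq> 0"
  shows "has_value (\<lambda>k. if k \<ge> 0 then (fps_nth f (nat k) * c powi (r - k)) *\<^sub>C y else 0) ((z * c powi r) *\<^sub>C y)"
proof -
  have "c powi (r - k) = inverse c ^ nat k * c powi r" if "k \<ge> 0" for k
  proof -
    have "c powi k = c ^ nat k" using that by (simp add: power_int_def)
    then show ?thesis using assms(2) by (simp add: power_int_diff power_inverse divide_inverse mult.commute)
  qed
  then show ?thesis
    using has_value_fps[OF assms(1), of "c powi r *\<^sub>C y"]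
    by (auto simp: scaleC_scaleC mult.assoc cong: if_cong)
qed

text \<open>The same principle for x^+. It is applied to expansions of phi at infinity, and the
  modes of the raising current on the right factor are proportional to b^k.\<close>

lemma has_value_geometric_shift:
  assumes "fps_value f b z" "b \<noteq> 0"
  shows "has_value (\<lambda>k. if k \<ge> r then (fps_nth f (nat (k - r)) * b powi k) *\<^sub>C y else 0) ((z * b powi r) *\<^sub>C y)"
proof -
  have P: "b powi k = b ^ nat (k - r) * b powi r" if "k \<ge> r" for k
  proof -
    have "b powi k = b powi ((k - r) + r)" by simp
    also have "\<dots> = b powi (k - r) * b powi r" by (rule power_int_add) (simp add: assms(2))
    also have "b powi (k - r) = b ^ nat (k - r)" using that by (simp add: power_int_def)
    finally show ?thesis .
  qed
  have "(if k \<ge> r then (fps_nth f (nat (k - r)) * b powi k) *\<^sub>C y else 0) =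
      (if k - r \<ge> 0 then (fps_nth f (nat (k - r)) * b ^ nat (k - r)) *\<^sub>C (b powi r *\<^sub>C y) else 0)" for k
  proof (cases "k \<ge> r")
    case True
    show ?thesis unfolding P[OF True] using True by (simp add: scaleC_scaleC mult.assoc)
  qed simp
  then show ?thesis
    using has_value_shift[OF has_value_fps[OF assms(1), of "b powi r *\<^sub>C y"], of r]
    by (simp only: scaleC_scaleC)
qed

section \<open>The commutator of raising and lowering currents\<close>

text \<open>If \<open>f Pos\<close> and \<open>f Neg\<close> expand the same rational function at 0 and at infinity, then this is a
  sum of geometric sequences, one for each simple pole.\<close>

definition jump :: "(pm \<Rightarrow> complex fps) \<Rightarrow> int \<Rightarrow> complex" where
  "jump f m = coef Pos (f Pos) m - coef Neg (f Neg) m"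

lemma jump_one: "jump (\<lambda>\<epsilon>. 1) m = 0"
  by (simp add: jump_def coef_one)

lemma jump_recurrence:
  assumes "\<And>\<epsilon>. fps_lin \<epsilon> x y * f \<epsilon> = fps_lin \<epsilon> x' y' * g \<epsilon>"
  shows "x * jump f m - y * jump f (m - 1) = x' * jump g m - y' * jump g (m - 1)"
proof -
  have "x * jump f m - y * jump f (m - 1) =
      (x * coef Pos (f Pos) m - y * coef Pos (f Pos) (m - 1)) -
      (x * coef Neg (f Neg) m - y * coef Neg (f Neg) (m - 1))"
    by (simp add: jump_def algebra_simps)
  also have "\<dots> = x' * jump g m - y' * jump g (m - 1)"
    unfolding coef_recurrence[OF assms[of Pos], of m] coef_recurrence[OF assms[of Neg], of m]
    by (simp add: jump_def algebra_simps)
  finally show ?thesis .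
qed

lemma int_geometric:
  fixes f :: "int \<Rightarrow> complex"
  assumes "\<And>m. f (m + 1) = c * f m" "c \<noteq> 0"
  shows "f m = c powi m * f 0"
proof (induction m rule: int_induct[of _ 0])
  case base then show ?case by simp
next
  case (step1 i) then show ?case using assms by (simp add: power_int_add)
next
  case (step2 i) then show ?case
    using assms(1)[of "i - 1"] assms(2) by (simp add: power_int_diff field_simps)
qed

text \<open>Multiplying by 1 - c z leaves a polynomial, whose two expansions agree; so the
  differences form a geometric sequence with ratio c, and the entry at 0 is read off from the
  constant terms.\<close>

lemma jump_psi:
  assumes "c \<noteq> 0"
  shows "jump (\<lambda>\<epsilon>. psi_series t \<epsilon> c) m = (exp t - inverse (exp t)) * c powi m"
proof -
  have "jump (\<lambda>\<epsilon>. psi_series t \<epsilon> c) (m + 1) = c * jump (\<lambda>\<epsilon>. psi_series t \<epsilon> c) m" for m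
    using jump_recurrence[of 1 c "\<lambda>\<epsilon>. psi_series t \<epsilon> c" "exp t" "c / exp t" "\<lambda>\<epsilon>. 1" "m + 1"]
    by (simp add: psi_mult assms jump_one)
  from int_geometric[of "jump (\<lambda>\<epsilon>. psi_series t \<epsilon> c)", OF this assms, of m] show ?thesis
    by (simp add: jump_def coef_def psi_nth_0 assms)
qed

lemma jump_inverse_psi:
  assumes "c \<noteq> 0"
  shows "jump (\<lambda>\<epsilon>. inverse (psi_series t \<epsilon> (exp t ^ 2 * c))) m =
    - (exp t - inverse (exp t)) * c powi m"
proof -
  let ?f = "\<lambda>\<epsilon>. inverse (psi_series t \<epsilon> (exp t ^ 2 * c))"
  have c: "exp t ^ 2 * c \<noteq> 0" using assms by simp
  have rec: "fps_lin \<epsilon> (exp t) (exp t ^ 2 * c / exp t) * ?f \<epsilon> = fps_lin \<epsilon> 1 (exp t ^ 2 * c) * 1" for \<epsilon>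
    by (simp add: inverse_psi_mult[OF c])
  have "jump ?f (m + 1) = c * jump ?f m" for m
    using jump_recurrence[OF rec, of "m + 1"] by (simp add: jump_one power2_eq_square)
  from int_geometric[of "jump ?f", OF this assms, of m] show ?thesis
    using psi_nth_0[OF c, of t] by (simp add: jump_def coef_def)
qed

lemma jump_mult_psi:
  assumes "d \<noteq> 0"
  shows "jump (\<lambda>\<epsilon>. g \<epsilon> * psi_series t \<epsilon> d) (m + 1) - d * jump (\<lambda>\<epsilon>. g \<epsilon> * psi_series t \<epsilon> d) m =
    exp t * jump g (m + 1) - d / exp t * jump g m"
proof -
  have "fps_lin \<epsilon> 1 d * (g \<epsilon> * psi_series t \<epsilon> d) = fps_lin \<epsilon> (exp t) (d / exp t) * g \<epsilon>" for \<epsilon>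
    using psi_mult[OF assms, of \<epsilon> t] by (metis mult.assoc mult.commute)
  from jump_recurrence[of 1 d "\<lambda>\<epsilon>. g \<epsilon> * psi_series t \<epsilon> d", OF this[unfolded mult_1], of "m + 1"]
  show ?thesis by simp
qed

text \<open>Both sequences vanish on one side of 0, and the recurrence propagates their agreement
  from there: upwards for \<open>Pos\<close>, downwards for \<open>Neg\<close>, where it is divided
  by b.\<close>

lemma eigenvalues_determined:
  fixes f :: "int \<Rightarrow> 'v::complex_vector" and E :: "int \<Rightarrow> complex"
  assumes supp: "\<And>r. sgz \<epsilon> * r < 0 \<Longrightarrow> f r = 0" "\<And>r. sgz \<epsilon> * r < 0 \<Longrightarrow> E r = 0"
    and rec: "\<And>r. f r - b *\<^sub>C f (r - 1) = (E r - b * E (r - 1)) *\<^sub>C z" and b: "b \<noteq> 0"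
  shows "f r = E r *\<^sub>C z"
proof -
  define g where "g r = f r - E r *\<^sub>C z" for r
  have g0: "g r = 0" if "sgz \<epsilon> * r < 0" for r using supp that by (simp add: g_def)
  have g: "g r = b *\<^sub>C g (r - 1)" for r
    using rec[of r] by (simp add: g_def cvec.scale_right_diff_distrib cvec.scale_left_diff_distrib
        algebra_simps)
  have "g r = 0"
  proof (cases \<epsilon>)
    case Pos
    have "g (int m - 1) = 0" for m
    proof (induction m)
      case 0 then show ?case using g0[of "-1"] Pos by simp
    next
      case (Suc m) then show ?case using g[of "int m"] by simp
    qed
    from this[of "nat (r + 1)"] show ?thesis using g0[of r] Pos by (cases "r < 0") auto
  next
    case Neg
    have "g (1 - int m) = 0" for m
    proof (induction m)
      case 0 then show ?case using g0[of 1] Neg by simp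
    next
      case (Suc m) then show ?case using g[of "1 - int m"] b by simp
    qed
    from this[of "nat (1 - r)"] show ?thesis using g0[of r] Neg by (cases "r > 0") auto
  qed
  then show ?thesis by (simp add: g_def)
qed

section \<open>Colours and Cartan data\<close>

lemma vertex_le: "vertex n j \<le> n"
proof -
  have "j mod (int n + 1) < int n + 1" by (rule pos_mod_bound) simp
  then show ?thesis by (simp add: vertex_def)
qed

lemma vertex_eq_iff: "vertex n x = vertex n y \<longleftrightarrow> (int n + 1) dvd (x - y)"
proof -
  have "0 \<le> x mod (int n + 1)" "0 \<le> y mod (int n + 1)" by simp_all
  then have "vertex n x = vertex n y \<longleftrightarrow> x mod (int n + 1) = y mod (int n + 1)"
    unfolding vertex_def by linarith
  then show ?thesis by (simp add: mod_eq_dvd_iff)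
qed

lemma vertex_of_nat: "i \<le> n \<Longrightarrow> vertex n (int i) = i"
  by (simp add: vertex_def)

lemma vertex_int_vertex: "vertex n (int (vertex n x) + z) = vertex n (x + z)"
proof -
  have "int (vertex n x) = x mod (int n + 1)" by (simp add: vertex_def)
  then show ?thesis by (simp add: vertex_def mod_simps)
qed

lemma vertex_int_vertex_diff: "vertex n (int (vertex n x) - z) = vertex n (x - z)"
  using vertex_int_vertex[of n x "- z"] by simp

lemma cartan_matrix_vertex:
  "cartan_matrix n (vertex n x) (vertex n y) =
    (if vertex n x = vertex n y then 2
     else if vertex n x = vertex n (y + 1) \<or> vertex n x = vertex n (y - 1) then - 1 else 0)"
proof -
  have "vertex n y = vertex n (x + 1) \<longleftrightarrow> vertex n x = vertex n (y - 1)"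
    "vertex n y = vertex n (x - 1) \<longleftrightarrow> vertex n x = vertex n (y + 1)"
    by (simp_all add: vertex_eq_iff) (metis add_diff_eq diff_add_eq_diff_diff_swap dvd_minus_iff minus_diff_eq diff_diff_eq)+
  then show ?thesis by (auto simp: cartan_matrix_def vertex_int_vertex vertex_int_vertex_diff)
qed

lemma vertex_neq_small:
  assumes "n \<ge> 2" "x \<noteq> y" "\<bar>x - y\<bar> \<le> 2"
  shows "vertex n x \<noteq> vertex n y"
proof
  assume "vertex n x = vertex n y"
  then have "int n + 1 \<le> \<bar>x - y\<bar>"
    using assms by (metis vertex_eq_iff dvd_imp_le_int abs_of_nat diff_eq_eq add_0 of_nat_Suc add.commute)
  then show False using assms by simp
qed

lemma lookup_single_if: "Poly_Mapping.lookup (Poly_Mapping.single k v) k' = (if k' = k then v else 0)"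
  by (simp add: lookup_single when_def)

lemma lookup_simple_root:
  "Poly_Mapping.lookup (simple_root n i) k =
    (if k \<le> n then of_int (cartan_matrix n k i) else if k = n + 1 \<and> i = 0 then 1 else 0)"
  by (auto simp: simple_root_def lookup_add lookup_sum lookup_single_if)

text \<open>An element on which every simple root takes the value 1. The quadratic j (n + 1 - j) / 2
  has second difference -1, which settles the vertices 1, ..., n; at the vertex 0 it contributes -n,
  and the coefficient n + 1 of d corrects this to 1.\<close>

definition coheight :: "nat \<Rightarrow> cartan" where
  "coheight n = (\<Sum>j\<le>n. Poly_Mapping.single j (of_nat j * (of_nat n + 1 - of_nat j) / 2))
     + Poly_Mapping.single (n + 1) (of_nat n + 1)"

lemma lookup_coheight:
  "Poly_Mapping.lookup (coheight n) k =
    (if k \<le> n then of_nat k * (of_nat n + 1 - of_nat k) / 2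
     else if k = n + 1 then of_nat n + 1 else 0)"
  by (auto simp: coheight_def lookup_add lookup_sum lookup_single_if)

lemma coheight_in: "coheight n \<in> cartan_space n"
  by (auto simp: cartan_space_def in_keys_iff lookup_coheight split: if_splits)

lemma pairing_simple_root:
  assumes "n \<ge> 2" "i \<le> n"
  shows "pairing n (simple_root n i) h =
    2 * Poly_Mapping.lookup h i - Poly_Mapping.lookup h (vertex n (int i + 1))
    - Poly_Mapping.lookup h (vertex n (int i - 1))
    + (if i = 0 then Poly_Mapping.lookup h (n + 1) else 0)"
proof -
  define u where "u = vertex n (int i + 1)"
  define v where "v = vertex n (int i - 1)"
  have i: "i = vertex n (int i)" using assms by (simp add: vertex_of_nat)
  \<comment> \<open>A vertex and its two neighbours are three different vertices because the cycle
    has at least three.\<close>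
  have d: "i \<noteq> u" "i \<noteq> v" "u \<noteq> v"
    using vertex_neq_small[OF assms(1), of "int i" "int i + 1"] vertex_neq_small[OF assms(1), of "int i" "int i - 1"]
      vertex_neq_small[OF assms(1), of "int i + 1" "int i - 1"] i
    by (simp_all add: u_def v_def)
  have uv: "u \<le> n" "v \<le> n" by (simp_all add: u_def v_def vertex_le)
  have C: "cartan_matrix n k i = (if k = i then 2 else if k = u \<or> k = v then - 1 else 0)"
    if "k \<le> n" for k
    using cartan_matrix_vertex[of n "int k" "int i"] that assms
    by (simp add: vertex_of_nat u_def v_def)
  have "(\<Sum>k\<le>n. of_int (cartan_matrix n k i) * Poly_Mapping.lookup h k) =
    (\<Sum>k\<le>n. (if k = i then 2 * Poly_Mapping.lookup h i else 0)
      - (if k = u then Poly_Mapping.lookup h u else 0) - (if k = v then Poly_Mapping.lookup h v else 0))"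
    by (rule sum.cong) (use d in \<open>auto simp: C\<close>)
  also have "\<dots> = 2 * Poly_Mapping.lookup h i - Poly_Mapping.lookup h u - Poly_Mapping.lookup h v"
    using uv assms by (simp add: sum_subtractf)
  finally show ?thesis
    unfolding pairing_def u_def v_def by (simp add: lookup_simple_root)
qed

lemma pairing_coheight:
  assumes "n \<ge> 2" "i \<le> n"
  shows "pairing n (simple_root n i) (coheight n) = 1"
proof -
  have "vertex n (int n + 1) = vertex n 0" "vertex n (- 1) = vertex n (int n)"
    unfolding vertex_eq_iff by (auto intro: dvdI[of _ _ "- 1"])
  then have v: "vertex n (int i + 1) = (if i = n then 0 else i + 1)"
    "vertex n (int i - 1) = (if i = 0 then n else i - 1)"
    using assms vertex_of_nat[of "i + 1" n] vertex_of_nat[of "i - 1" n] vertex_of_nat[of 0 n]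
      vertex_of_nat[of n n]
    by (auto simp: of_nat_diff add.commute)
  show ?thesis
    unfolding pairing_simple_root[OF assms] v using assms
    by (auto simp: lookup_coheight of_nat_diff field_simps)
qed

lemma qexp_add: "qexp t (x + y) = qexp t x * qexp t y"
  by (simp add: qexp_def of_rat_add ring_distribs exp_add)

lemma qexp_neg: "qexp t (- x) = inverse (qexp t x)"
  by (simp add: qexp_def of_rat_minus exp_minus)

lemma qexp_diff: "qexp t (x - y) = qexp t x / qexp t y"
  by (simp add: qexp_def of_rat_diff ring_distribs exp_diff)

lemma qexp_nonzero [simp]: "qexp t x \<noteq> 0"
  by (simp add: qexp_def)

lemma qexp_1: "qexp t 1 = exp t"
  by (simp add: qexp_def)

lemma qexp_0 [simp]: "qexp t 0 = 1"
  by (simp add: qexp_def)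

lemma pairing_diff_left: "pairing n (\<mu> - \<nu>) h = pairing n \<mu> h - pairing n \<nu> h"
  and pairing_neg_left: "pairing n (- \<mu>) h = - pairing n \<mu> h"
  and pairing_neg_right: "pairing n \<mu> (- h) = - pairing n \<mu> h"
  by (simp_all add: pairing_def lookup_add lookup_minus sum.distrib sum_subtractf sum_negf
      algebra_simps)

lemma root_of_unity_powi:
  assumes "\<And>k::nat. k > 0 \<Longrightarrow> (q::complex) ^ k \<noteq> 1" "q \<noteq> 0"
  shows "q powi m = q powi m' \<longleftrightarrow> m = m'"
proof
  assume eq: "q powi m = q powi m'"
  have "q powi (m - m') = 1" "q powi (m' - m) = 1"
    using eq assms by (simp_all add: power_int_diff)
  moreover have "q powi k \<noteq> 1" if "k > 0" for k
    using assms(1)[of "nat k"] that by (simp add: power_int_def)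
  ultimately show "m = m'" by (metis diff_gt_0_iff_gt linorder_neqE)
qed simp

section \<open>Simple highest weight modules\<close>

text \<open>An inductive form of the generated subspace, so that stability under further operators
  can be proved by rule induction.\<close>

inductive_set op_span :: "('v::complex_vector \<Rightarrow> 'v) set \<Rightarrow> 'v set \<Rightarrow> 'v set" for F S where
  base: "v \<in> S \<Longrightarrow> v \<in> op_span F S"
| zero: "0 \<in> op_span F S"
| add: "v \<in> op_span F S \<Longrightarrow> w \<in> op_span F S \<Longrightarrow> v + w \<in> op_span F S"
| scale: "v \<in> op_span F S \<Longrightarrow> c *\<^sub>C v \<in> op_span F S"
| step: "f \<in> F \<Longrightarrow> v \<in> op_span F S \<Longrightarrow> f v \<in> op_span F S"

lemma subspace_op_span: "cvec.subspace (op_span F S)"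
  by (auto simp: cvec.subspace_def intro: op_span.intros)

text \<open>A walk around the cyclic diagram from the vertex \<open>l0\<close> in direction
  \<open>sg\<close>. The line of the vector representation and the rows of \<open>V\<close> have
  \<open>l0\<close> equal to \<open>sg\<close>; the rows of \<open>W\<close> start at 0 and run in
  the opposite direction.\<close>

locale colored_line =
  fixes n :: nat and t :: complex and l0 sg :: int and a :: complex
  assumes n2: "n \<ge> 2" and not_root: "\<And>k::nat. k > 0 \<Longrightarrow> exp t ^ k \<noteq> 1"
    and sg: "sg = 1 \<or> sg = - 1" and a0: "a \<noteq> 0"
begin

abbreviation "q \<equiv> exp t"

lemma q_powi_inj: "q powi x = q powi y \<longleftrightarrow> x = y"
  by (rule root_of_unity_powi) (simp_all add: not_root)

lemma q_diff: "q - inverse q \<noteq> 0"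
  using q_powi_inj[of 1 "-1"] by (simp add: power_int_minus)

definition color :: "int \<Rightarrow> nat" where "color m = vertex n (l0 + sg * m)"

definition c :: "int \<Rightarrow> complex" where "c k = a * q powi k"

lemma c_nonzero [simp]: "c k \<noteq> 0"
  by (simp add: c_def a0)

lemma c_shift: "c (k + int m) = q ^ m * c k"
  by (simp add: c_def power_int_add)

lemma c_inj: "c k = c k' \<longleftrightarrow> k = k'"
  using q_powi_inj by (simp add: c_def a0)

lemma color_le: "color m \<le> n"
  by (simp add: color_def vertex_le)

lemma color_eq_iff: "color x = color y \<longleftrightarrow> (int n + 1) dvd (x - y)"
proof -
  have "l0 + sg * x - (l0 + sg * y) = sg * (x - y)" by (simp add: algebra_simps)
  moreover have "(int n + 1) dvd (sg * (x - y)) \<longleftrightarrow> (int n + 1) dvd (x - y)"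
    using sg by (auto simp: dvd_diff_commute)
  ultimately show ?thesis unfolding color_def vertex_eq_iff by simp
qed

lemma color_neq: "x \<noteq> y \<Longrightarrow> \<bar>x - y\<bar> \<le> 2 \<Longrightarrow> color x \<noteq> color y"
  using vertex_neq_small[OF n2, of x y] unfolding color_eq_iff vertex_eq_iff by simp

lemma cartan_matrix_color:
  assumes "i \<le> n"
  shows "cartan_matrix n i (color y) =
    (if i = color y then 2 else if i = color (y + 1) \<or> i = color (y - 1) then - 1 else 0)"
  using cartan_matrix_vertex[of n "int i" "l0 + sg * y"] assms sg
  by (auto simp: vertex_of_nat color_def algebra_simps)

text \<open>Eigenvalues of phi_i on the vector representation. The index is one less than the number
  of the box, which accounts for the shift against \<open>box_phi\<close>.\<close>

definition linephi :: "pm \<Rightarrow> nat \<Rightarrow> int \<Rightarrow> complex fps" where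
  "linephi \<epsilon> i k =
     (if i = color k then psi_series t \<epsilon> (c (k + 1))
      else if i = color (k - 1) then inverse (psi_series t \<epsilon> (c (k + 2))) else 1)"

text \<open>A step of the line multiplies the eigenvalue by (Q - c z) / (1 - Q c z) with c =
  \<open>c (k + 1)\<close>, the factor by which the exchange relation moves phi_i past a lowering
  mode of colour \<open>color k\<close>.\<close>

lemma linephi_step:
  assumes "i \<le> n" and Q_def: "Q = q powi (- cartan_matrix n i (color k))"
  shows "fps_lin \<epsilon> 1 (Q * c (k + 1)) * linephi \<epsilon> i (k + 1) = fps_lin \<epsilon> Q (c (k + 1)) * linephi \<epsilon> i k"
proof -
  let ?p = "psi_series t \<epsilon>"
  have d: "color (k + 1) \<noteq> color k" "color (k + 1) \<noteq> color (k - 1)" "color k \<noteq> color (k - 1)"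
    by (rule color_neq; simp)+
  have c2: "c (k + 2) = q * c (k + 1)" "c (k + 3) = q ^ 2 * c (k + 1)"
    using c_shift[of "k + 1" 1] c_shift[of "k + 1" 2] by (simp_all add: add.assoc)
  let ?G = "if i = color (k + 1) then ?p (c (k + 2))
      else if i = color k then inverse (?p (c (k + 3))) else 1"
  let ?H = "if i = color k then ?p (c (k + 1))
      else if i = color (k - 1) then inverse (?p (c (k + 2))) else 1"
  consider "i = color k" | "i = color (k + 1)" | "i = color (k - 1)"
    | "i \<noteq> color k" "i \<noteq> color (k + 1)" "i \<noteq> color (k - 1)" by blast
  then have "fps_lin \<epsilon> 1 (Q * c (k + 1)) * (if i = color (k + 1) then ?p (c (k + 2))
      else if i = color k then inverse (?p (c (k + 3))) else 1)
    = fps_lin \<epsilon> Q (c (k + 1)) * (if i = color k then ?p (c (k + 1))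
      else if i = color (k - 1) then inverse (?p (c (k + 2))) else 1)"
  proof cases
    \<comment> \<open>Here psi passes into an inverse psi. In cases 2 and 3 one of the two
      eigenvalues is 1, in case 4 both are.\<close>
    case 1
    have Q: "Q = inverse q ^ 2"
      using 1 cartan_matrix_color[OF assms(1), of k]
      by (simp add: Q_def power_int_minus power_inverse power2_eq_square)
    have A: "fps_lin \<epsilon> 1 (Q * c (k + 1)) = fps_const (inverse q) * fps_lin \<epsilon> q (c (k + 1) / q)"
      using fps_lin_scale[of \<epsilon> "inverse q" q "c (k + 1) / q"]
      by (simp add: Q power2_eq_square divide_inverse mult_ac)
    have B: "fps_lin \<epsilon> Q (c (k + 1)) = fps_const (inverse q ^ 2) * fps_lin \<epsilon> 1 (c (k + 3))"
    proof -
      have "inverse q ^ 2 * c (k + 3) = c (k + 1)"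
        by (simp add: c2 field_simps power2_eq_square)
      then show ?thesis using fps_lin_scale[of \<epsilon> "inverse q ^ 2" 1 "c (k + 3)"] by (simp add: Q)
    qed
    have "fps_lin \<epsilon> q (c (k + 3) / q) = fps_const q * fps_lin \<epsilon> 1 (c (k + 1))"
      using fps_lin_scale[of \<epsilon> q 1 "c (k + 1)"] by (simp add: c2 power2_eq_square)
    then have L: "fps_const q * (fps_lin \<epsilon> 1 (c (k + 1)) * inverse (?p (c (k + 3)))) =
        fps_lin \<epsilon> 1 (c (k + 3))"
      using inverse_psi_mult[of "c (k + 3)" \<epsilon> t] by (simp add: mult.assoc)
    have "fps_lin \<epsilon> 1 (Q * c (k + 1)) * inverse (?p (c (k + 3))) =
        fps_const (inverse q) * (?p (c (k + 1)) * (fps_lin \<epsilon> 1 (c (k + 1)) * inverse (?p (c (k + 3)))))"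
      unfolding A psi_mult[OF c_nonzero, symmetric] by (simp only: mult_ac)
    also have "\<dots> = fps_const (inverse q ^ 2) * (?p (c (k + 1)) *
        (fps_const q * (fps_lin \<epsilon> 1 (c (k + 1)) * inverse (?p (c (k + 3))))))"
    proof -
      have "inverse q = inverse q ^ 2 * q" by (simp add: power2_eq_square)
      then have "fps_const (inverse q) = fps_const (inverse q ^ 2) * fps_const q"
        by (metis fps_const_mult)
      then show ?thesis by (simp only: mult_ac)
    qed
    also have "\<dots> = fps_lin \<epsilon> Q (c (k + 1)) * ?p (c (k + 1))"
      unfolding L B by (simp only: mult_ac)
    finally show ?thesis using 1 d by auto
  next
    case 2
    have Q: "Q = q" using 2 d cartan_matrix_color[OF assms(1), of k] by (simp add: Q_def)
    show ?thesis
      using 2 d psi_mult[of "c (k + 2)" \<epsilon> t] by (simp add: Q c2)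
  next
    case 3
    have Q: "Q = q" using 3 d cartan_matrix_color[OF assms(1), of k] by (simp add: Q_def)
    show ?thesis
      using 3 d inverse_psi_mult[of "c (k + 2)" \<epsilon> t] by (simp add: Q c2)
  next
    case 4
    have Q: "Q = 1" using 4 cartan_matrix_color[OF assms(1), of k] by (simp add: Q_def)
    show ?thesis using 4 by (simp add: Q)
  qed
  moreover have "linephi \<epsilon> i (k + 1) = ?G" "linephi \<epsilon> i k = ?H"
    by (simp_all add: linephi_def add.assoc)
  ultimately show ?thesis by simp
qed

lemma jump_linephi:
  "jump (\<lambda>\<epsilon>. linephi \<epsilon> i k) m = (if i = color k then (q - inverse q) * c (k + 1) powi m
      else if i = color (k - 1) then - (q - inverse q) * c k powi m else 0)"
proof -
  have "c (k + 2) = q ^ 2 * c k" using c_shift[of k 2] by simp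
  then show ?thesis
    using jump_inverse_psi[of "c k" t m] by (simp add: linephi_def jump_psi jump_one)
qed

end

text \<open>Raising and lowering operators are parameters, so that the lowest weight factor is an
  instance too. Simplicity is stated with the modes of phi_i in place of the h_{i,m};
  \<open>qmodule_hop_stable\<close> justifies this for submodules.\<close>

locale highest_module = colored_line n t l0 sg a
  for n :: nat and t :: complex and l0 sg :: int and a :: complex +
  fixes xp xm :: "nat \<Rightarrow> int \<Rightarrow> 'v::complex_vector \<Rightarrow> 'v"
    and ph :: "pm \<Rightarrow> nat \<Rightarrow> int \<Rightarrow> 'v \<Rightarrow> 'v" and kk :: "cartan \<Rightarrow> 'v \<Rightarrow> 'v"
    and v0 :: 'v and lam :: cartan
  assumes clin_xp: "i \<le> n \<Longrightarrow> clin (xp i r)" and clin_xm: "i \<le> n \<Longrightarrow> clin (xm i r)"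
    and clin_ph: "i \<le> n \<Longrightarrow> clin (ph \<epsilon> i r)" and clin_kk: "h \<in> cartan_space n \<Longrightarrow> clin (kk h)"
    and k_xp: "h \<in> cartan_space n \<Longrightarrow> i \<le> n \<Longrightarrow>
      kk h (xp i r v) = qexp t (pairing n (simple_root n i) h) *\<^sub>C xp i r (kk h v)"
    and k_xm: "h \<in> cartan_space n \<Longrightarrow> i \<le> n \<Longrightarrow>
      kk h (xm i r v) = inverse (qexp t (pairing n (simple_root n i) h)) *\<^sub>C xm i r (kk h v)"
    and k_ph: "h \<in> cartan_space n \<Longrightarrow> i \<le> n \<Longrightarrow> kk h (ph \<epsilon> i r v) = ph \<epsilon> i r (kk h v)"
    and k_k: "h \<in> cartan_space n \<Longrightarrow> h' \<in> cartan_space n \<Longrightarrow> kk h (kk h' v) = kk h' (kk h v)"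
    and ph_xp: "i \<le> n \<Longrightarrow> j \<le> n \<Longrightarrow>
      ph \<epsilon> i r (xp j (s - 1) v) - (exp t powi cartan_matrix n i j) *\<^sub>C ph \<epsilon> i (r - 1) (xp j s v) =
      (exp t powi cartan_matrix n i j) *\<^sub>C xp j (s - 1) (ph \<epsilon> i r v) - xp j s (ph \<epsilon> i (r - 1) v)"
    and ph_xm: "i \<le> n \<Longrightarrow> j \<le> n \<Longrightarrow>
      ph \<epsilon> i r (xm j (s - 1) v) - (exp t powi (- cartan_matrix n i j)) *\<^sub>C ph \<epsilon> i (r - 1) (xm j s v) =
      (exp t powi (- cartan_matrix n i j)) *\<^sub>C xm j (s - 1) (ph \<epsilon> i r v) - xm j s (ph \<epsilon> i (r - 1) v)"
    and xp_xm: "i \<le> n \<Longrightarrow> j \<le> n \<Longrightarrow>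
      xp i r (xm j s v) - xm j s (xp i r v) = (if i = j then inverse (exp t - inverse (exp t)) *\<^sub>C
        (ph Pos i (r + s) v - ph Neg i (r + s) v) else 0)"
    and ph_support: "i \<le> n \<Longrightarrow> sgz \<epsilon> * r < 0 \<Longrightarrow> ph \<epsilon> i r v = 0"
    and simple: "cvec.subspace N \<Longrightarrow> (\<And>i r v. i \<le> n \<Longrightarrow> v \<in> N \<Longrightarrow> xp i r v \<in> N) \<Longrightarrow>
      (\<And>i r v. i \<le> n \<Longrightarrow> v \<in> N \<Longrightarrow> xm i r v \<in> N) \<Longrightarrow>
      (\<And>\<epsilon> i r v. i \<le> n \<Longrightarrow> v \<in> N \<Longrightarrow> ph \<epsilon> i r v \<in> N) \<Longrightarrow>
      (\<And>h v. h \<in> cartan_space n \<Longrightarrow> v \<in> N \<Longrightarrow> kk h v \<in> N) \<Longrightarrow> N = {0} \<or> N = UNIV"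
    and v0: "v0 \<noteq> 0" and xp_v0: "i \<le> n \<Longrightarrow> xp i r v0 = 0"
    and k_v0: "h \<in> cartan_space n \<Longrightarrow> kk h v0 = qexp t (pairing n lam h) *\<^sub>C v0"
    and ph_v0: "i \<le> n \<Longrightarrow> ph \<epsilon> i r v0 =
      coef \<epsilon> (if i = vertex n l0 then psi_series t \<epsilon> (a * exp t) else 1) r *\<^sub>C v0"
begin

section \<open>Degree and singular vectors\<close>

definition kr :: "'v \<Rightarrow> 'v" where "kr = kk (coheight n)"

definition kap :: complex where "kap = qexp t (pairing n lam (coheight n))"

lemma clin_kr: "clin kr"
  by (simp add: kr_def clin_kk coheight_in)

lemma kr_xm: "i \<le> n \<Longrightarrow> kr (xm i r v) = inverse q *\<^sub>C xm i r (kr v)"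
  by (simp add: kr_def k_xm coheight_in pairing_coheight n2 qexp_1)

text \<open>The product of the operators kr - kap q^-k over k = 1, ..., m. It kills the degrees 1 to
  m but acts by a nonzero scalar on \<open>v0\<close>, which has degree 0; so it separates degrees
  without a decomposition of the module.\<close>

primrec annihilator :: "nat \<Rightarrow> 'v \<Rightarrow> 'v" where
  "annihilator 0 v = v"
| "annihilator (Suc m) v =
     kr (annihilator m v) - (kap * inverse q ^ Suc m) *\<^sub>C annihilator m v"

lemma clin_annihilator: "clin (annihilator m)"
  by (induction m) (auto simp: clin_iff clin_add[OF clin_kr] clin_scale[OF clin_kr]
      scaleC_add_right cvec.scale_right_diff_distrib cvec.scale_left_commute)

text \<open>A lowering mode shifts the degree by one: the factors for k = 1, ..., m + 1 turn into
  those for k = 0, ..., m, and the bracket is the new factor for k = 0.\<close>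

lemma annihilator_xm:
  assumes "i \<le> n"
  shows "annihilator (Suc m) (xm i r v) =
    inverse q ^ Suc m *\<^sub>C xm i r (kr (annihilator m v) - kap *\<^sub>C annihilator m v)"
proof (induction m)
  case 0
  then show ?case
    by (simp add: kr_xm assms clin_diff[OF clin_xm] clin_scale[OF clin_xm] scaleC_scaleC
        cvec.scale_right_diff_distrib mult.commute)
next
  case (Suc m)
  have "annihilator (Suc (Suc m)) (xm i r v) =
      kr (annihilator (Suc m) (xm i r v)) - (kap * inverse q ^ Suc (Suc m)) *\<^sub>C annihilator (Suc m) (xm i r v)"
    by (rule annihilator.simps)
  also have "\<dots> = inverse q ^ Suc (Suc m) *\<^sub>C
      xm i r (kr (annihilator (Suc m) v) - kap *\<^sub>C annihilator (Suc m) v)"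
    unfolding Suc.IH
    by (simp add: kr_xm assms clin_diff[OF clin_xm] clin_scale[OF clin_xm] clin_diff[OF clin_kr]
        clin_add[OF clin_xm] clin_add[OF clin_kr] clin_scale[OF clin_kr] scaleC_scaleC cvec.scale_right_diff_distrib algebra_simps)
  finally show ?case .
qed

lemma annihilator_eigenvector:
  "kr w = (kap * inverse q ^ d) *\<^sub>C w \<Longrightarrow>
     annihilator m w = (\<Prod>k=1..m. kap * inverse q ^ d - kap * inverse q ^ k) *\<^sub>C w"
  by (induction m)
    (simp_all add: clin_scale[OF clin_kr] scaleC_scaleC scaleC_one flip: cvec.scale_left_diff_distrib,
     simp add: algebra_simps)

lemma kap_distinct: "kap * inverse q ^ d = kap * inverse q ^ k \<longleftrightarrow> d = k"
  using q_powi_inj[of "- int d" "- int k"]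
  by (simp add: kap_def power_int_minus power_inverse)

definition sing :: "nat \<Rightarrow> 'v set" where
  "sing d = {w. kr w = (kap * inverse q ^ d) *\<^sub>C w \<and> (\<forall>i\<le>n. \<forall>r. xp i r w = 0)}"

text \<open>The candidate for a proper submodule. Lowering modes are built in;
  \<open>ph_descent\<close>, \<open>k_descent\<close> and \<open>xp_descent\<close> add the other
  operators.\<close>

definition descent :: "nat \<Rightarrow> 'v set" where
  "descent d = op_span {xm i r | i r. i \<le> n} (sing d)"

text \<open>On a vector killed by all raising modes the exchange relation ties raising modes applied
  to phi_r w to raising modes applied to phi_(r-1) w, with no further terms. Since phi has one-sided
  support, induction from the vanishing end gives zero throughout.\<close>

lemma ph_sing:
  assumes "w \<in> sing d" "i \<le> n"
  shows "ph \<epsilon> i r w \<in> sing d"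
proof -
  have w: "kr w = (kap * inverse q ^ d) *\<^sub>C w" "\<And>j r. j \<le> n \<Longrightarrow> xp j r w = 0"
    using assms by (auto simp: sing_def)
  have rec: "(q powi cartan_matrix n i j) *\<^sub>C xp j (s - 1) (ph \<epsilon> i r w) = xp j s (ph \<epsilon> i (r - 1) w)"
    if "j \<le> n" for j r s
    using ph_xp[OF assms(2) that, of \<epsilon> r s w] w(2)[OF that] clin_zero[OF clin_ph[OF assms(2)]]
    by simp
  have "xp j s (ph \<epsilon> i r w) = 0" if j: "j \<le> n" for j s
  proof (cases \<epsilon>)
    case Pos
    have "\<forall>s. xp j s (ph \<epsilon> i (int m - 1) w) = 0" for m
    proof (induction m)
      case 0 then show ?case using ph_support[OF assms(2), of \<epsilon> "-1"] Pos clin_zero[OF clin_xp[OF j]]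
        by simp
    next
      case (Suc m) then show ?case using rec[OF j, of _ "int m"] by (metis add_diff_cancel_right'
          cvec.scale_eq_0_iff diff_add_cancel exp_not_eq_zero of_nat_Suc power_int_not_zero add.commute)
    qed
    from this[of "nat (r + 1)"] show ?thesis
      using ph_support[OF assms(2), of \<epsilon> r] Pos clin_zero[OF clin_xp[OF j]] by (cases "r < 0") auto
  next
    case Neg
    have "\<forall>s. xp j s (ph \<epsilon> i (1 - int m) w) = 0" for m
    proof (induction m)
      case 0 then show ?case using ph_support[OF assms(2), of \<epsilon> "1"] Neg clin_zero[OF clin_xp[OF j]]
        by simp
    next
      case (Suc m)
      have "1 - int m - 1 = 1 - int (Suc m)" by simp
      then show ?case using rec[OF j, of _ "1 - int m"] Suc by (metis cvec.scale_zero_right)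
    qed
    from this[of "nat (1 - r)"] show ?thesis
      using ph_support[OF assms(2), of \<epsilon> r] Neg clin_zero[OF clin_xp[OF j]] by (cases "r > 0") auto
  qed
  moreover have "kr (ph \<epsilon> i r w) = (kap * inverse q ^ d) *\<^sub>C ph \<epsilon> i r w"
    using w(1) k_ph[OF coheight_in assms(2), of \<epsilon> r w] clin_scale[OF clin_ph[OF assms(2)]]
    by (simp add: kr_def)
  ultimately show ?thesis by (simp add: sing_def)
qed

lemmas subspace_descent = subspace_op_span[of "{xm i r | i r. i \<le> n}" "sing d" for d,
    folded descent_def]

lemma descent_step: "i \<le> n \<Longrightarrow> v \<in> descent d \<Longrightarrow> xm i r v \<in> descent d"
  unfolding descent_def by (rule op_span.step) auto

lemma descent_induct [consumes 1, case_names base zero add scale step]: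
  assumes "v \<in> descent d" "\<And>v. v \<in> sing d \<Longrightarrow> P v" "P 0"
    "\<And>v w. v \<in> descent d \<Longrightarrow> P v \<Longrightarrow> w \<in> descent d \<Longrightarrow> P w \<Longrightarrow> P (v + w)"
    "\<And>v c. v \<in> descent d \<Longrightarrow> P v \<Longrightarrow> P (c *\<^sub>C v)"
    "\<And>i r v. i \<le> n \<Longrightarrow> v \<in> descent d \<Longrightarrow> P v \<Longrightarrow> P (xm i r v)"
  shows "P v"
  using assms(1) unfolding descent_def
  by (induction rule: op_span.induct) (use assms in \<open>auto simp: descent_def\<close>)

text \<open>In the lowering step the exchange relation is read modulo \<open>descent d\<close> as a
  recurrence in r that starts from the vanishing modes of phi. It also shifts s, so the induction
  runs over all s at once.\<close>

lemma ph_descent: "v \<in> descent d \<Longrightarrow> i \<le> n \<Longrightarrow> ph \<epsilon> i r v \<in> descent d"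
proof (induction arbitrary: r rule: descent_induct)
  case (base v)
  then show ?case unfolding descent_def by (intro op_span.base ph_sing)
next
  case zero
  then show ?case using subspace_descent by (simp add: clin_zero[OF clin_ph] cvec.subspace_0)
next
  case (add v w)
  then show ?case using subspace_descent by (simp add: clin_add[OF clin_ph] cvec.subspace_add)
next
  case (scale v c)
  then show ?case using subspace_descent by (simp add: clin_scale[OF clin_ph] cvec.subspace_scale)
next
  case (step j s v)
  let ?Q = "q powi (- cartan_matrix n i j)"
  let ?z = "\<lambda>r s. ?Q *\<^sub>C xm j (s - 1) (ph \<epsilon> i r v) - xm j s (ph \<epsilon> i (r - 1) v)"
  have z: "?z r s \<in> descent d" for r s
    using step by (intro cvec.subspace_diff cvec.subspace_scale subspace_descent descent_step) auto
  have rec: "ph \<epsilon> i r (xm j (s - 1) v) - ?Q *\<^sub>C ph \<epsilon> i (r - 1) (xm j s v) = ?z r s" for r s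
    using step by (intro ph_xm) auto
  show ?case
  proof (cases \<epsilon>)
    case Pos
    have "\<forall>s. ph \<epsilon> i (int m - 1) (xm j s v) \<in> descent d" for m
    proof (induction m)
      case 0 then show ?case using ph_support[OF step(4), of \<epsilon> "-1"] Pos cvec.subspace_0[OF subspace_descent]
        by simp
    next
      case (Suc m)
      show ?case
      proof
        fix s
        have "ph \<epsilon> i (int m) (xm j s v) = ?z (int m) (s + 1) + ?Q *\<^sub>C ph \<epsilon> i (int m - 1) (xm j (s + 1) v)"
          using rec[of "int m" "s + 1"] by (simp add: algebra_simps)
        also have "\<dots> \<in> descent d"
          using Suc by (intro cvec.subspace_add cvec.subspace_scale subspace_descent z) auto
        finally show "ph \<epsilon> i (int (Suc m) - 1) (xm j s v) \<in> descent d" by simp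
      qed
    qed
    from this[of "nat (r + 1)"] show ?thesis
      using ph_support[OF step(4), of \<epsilon> r] Pos cvec.subspace_0[OF subspace_descent]
      by (cases "r < 0") auto
  next
    case Neg
    have "\<forall>s. ph \<epsilon> i (1 - int m) (xm j s v) \<in> descent d" for m
    proof (induction m)
      case 0 then show ?case using ph_support[OF step(4), of \<epsilon> 1] Neg cvec.subspace_0[OF subspace_descent]
        by simp
    next
      case (Suc m)
      show ?case
      proof
        fix s
        have "?Q *\<^sub>C ph \<epsilon> i (1 - int m - 1) (xm j s v) = ph \<epsilon> i (1 - int m) (xm j (s - 1) v) - ?z (1 - int m) s"
          using rec[of "1 - int m" s] by (simp add: algebra_simps)
        then have "ph \<epsilon> i (1 - int m - 1) (xm j s v) =
            inverse ?Q *\<^sub>C (ph \<epsilon> i (1 - int m) (xm j (s - 1) v) - ?z (1 - int m) s)"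
          by (metis cvec.scale_right_imp_eq cvec.scale_cancel_left scaleC_scaleC scaleC_one left_inverse
              exp_not_eq_zero power_int_not_zero)
        also have "\<dots> \<in> descent d"
          using Suc by (intro cvec.subspace_diff cvec.subspace_scale subspace_descent z) auto
        finally show "ph \<epsilon> i (1 - int (Suc m)) (xm j s v) \<in> descent d" by simp
      qed
    qed
    from this[of "nat (1 - r)"] show ?thesis
      using ph_support[OF step(4), of \<epsilon> r] Neg cvec.subspace_0[OF subspace_descent]
      by (cases "r > 0") auto
  qed
qed

lemma k_descent: "v \<in> descent d \<Longrightarrow> h \<in> cartan_space n \<Longrightarrow> kk h v \<in> descent d"
proof (induction rule: descent_induct)
  case (base v)
  have "kk h v \<in> sing d"
    using base clin_scale[OF clin_kk[OF base(2)], symmetric] clin_zero[OF clin_kk[OF base(2)]]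
      k_k[OF coheight_in base(2), of v] k_xp[OF base(2)]
    by (auto simp: sing_def kr_def) (metis cvec.scale_eq_0_iff qexp_nonzero)
  then show ?case unfolding descent_def by (rule op_span.base)
next
  case zero
  then show ?case using subspace_descent by (simp add: clin_zero[OF clin_kk] cvec.subspace_0)
next
  case (add v w)
  then show ?case using subspace_descent by (simp add: clin_add[OF clin_kk] cvec.subspace_add)
next
  case (scale v c)
  then show ?case using subspace_descent by (simp add: clin_scale[OF clin_kk] cvec.subspace_scale)
next
  case (step i r v)
  then show ?case
    using cvec.subspace_scale[OF subspace_descent descent_step] by (simp add: k_xm)
qed

text \<open>Moving a raising mode past a lowering mode leaves modes of phi, which
  \<open>ph_descent\<close> has already dealt with.\<close>

lemma xp_descent: "v \<in> descent d \<Longrightarrow> i \<le> n \<Longrightarrow> xp i r v \<in> descent d"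
proof (induction rule: descent_induct)
  case (base v)
  then show ?case using cvec.subspace_0[OF subspace_descent] by (simp add: sing_def)
next
  case zero
  then show ?case using subspace_descent by (simp add: clin_zero[OF clin_xp] cvec.subspace_0)
next
  case (add v w)
  then show ?case using subspace_descent by (simp add: clin_add[OF clin_xp] cvec.subspace_add)
next
  case (scale v c)
  then show ?case using subspace_descent by (simp add: clin_scale[OF clin_xp] cvec.subspace_scale)
next
  case (step j s v)
  have "xp i r (xm j s v) = xm j s (xp i r v) + (if i = j then inverse (q - inverse q) *\<^sub>C
        (ph Pos i (r + s) v - ph Neg i (r + s) v) else 0)"
    using xp_xm[OF step(4) step(1), of r s v] by (simp add: algebra_simps)
  also have "\<dots> \<in> descent d"
    using step by (auto intro!: cvec.subspace_add cvec.subspace_diff cvec.subspace_scale subspace_descent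
        descent_step ph_descent cvec.subspace_0)
  finally show ?case .
qed

text \<open>A singular vector of positive degree generates a proper submodule, by the grading of
  the module by the eigenvalues of the principal element of the Cartan subalgebra.\<close>

lemma singular_zero:
  assumes "kr w = (kap * inverse q ^ d) *\<^sub>C w" "d > 0" "\<And>i r. i \<le> n \<Longrightarrow> xp i r w = 0"
  shows "w = 0"
proof -
  have w: "w \<in> descent d"
    unfolding descent_def by (rule op_span.base) (use assms in \<open>auto simp: sing_def\<close>)
  have suc: "annihilator (m + m') v = 0" if "annihilator m v = 0" for m m' v
    using that by (induction m') (simp_all add: clin_zero[OF clin_kr])
  have "\<exists>m. annihilator m v = 0" if "v \<in> descent d" for v
    using that
  proof (induction rule: descent_induct)
    case (base v)
    \<comment> \<open>The scalar is a product whose factor at k = d vanishes; d > 0 places this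
      factor in the range.\<close>
    then have "annihilator d v = 0"
      using annihilator_eigenvector[of v d d] assms(2) by (auto simp: sing_def prod_zero_iff)
    then show ?case ..
  next
    case zero then show ?case by (intro exI[of _ 0]) simp
  next
    case (add v w)
    then obtain m m' where "annihilator m v = 0" "annihilator m' w = 0" by blast
    then have "annihilator (m + m') v = 0" "annihilator (m + m') w = 0"
      using suc[of m v m'] suc[of m' w m] by (simp_all add: add.commute)
    then show ?case by (intro exI[of _ "m + m'"]) (simp add: clin_add[OF clin_annihilator])
  next
    case (scale v c)
    then show ?case by (auto simp: clin_scale[OF clin_annihilator])
  next
    case (step i r v)
    then obtain m where "annihilator m v = 0" by blast
    then have "annihilator (Suc m) (xm i r v) = 0"
      unfolding annihilator_xm[OF step(1)]
      by (simp add: clin_zero[OF clin_kr] clin_zero[OF clin_xm[OF step(1)]])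
    then show ?case ..
  qed
  moreover have "annihilator m v0 \<noteq> 0" for m
  proof -
    have "kr v0 = (kap * inverse q ^ 0) *\<^sub>C v0"
      by (simp add: kr_def kap_def k_v0 coheight_in)
    from annihilator_eigenvector[OF this, of m] show ?thesis
      using v0 by (auto simp: prod_zero_iff kap_distinct[of 0, simplified])
  qed
  ultimately have "v0 \<notin> descent d" by metis
  then have "descent d \<noteq> UNIV" by auto
  then have "descent d = {0}"
    using simple[OF subspace_descent xp_descent descent_step ph_descent k_descent] by blast
  then show ?thesis using w by simp
qed

section \<open>One-row diagrams in a highest weight module\<close>

definition bad :: nat where "bad = color (- 1)"

lemma bad_le: "bad \<le> n"
  by (simp add: bad_def color_le)

text \<open>The colour \<open>bad\<close> is that of the box below the first one. For k = 0 the
  extra psi cancels the inverse psi in \<open>linephi\<close>, which leaves the eigenvalues of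
  \<open>v0\<close>. For \<open>V\<close> this colour is the vertex 0 and for \<open>W\<close> it is
  \<open>color 0\<close>: in each case the colour in which phi is nontrivial on the highest or
  lowest weight vector of the other factor.\<close>

definition rowphi :: "pm \<Rightarrow> nat \<Rightarrow> int \<Rightarrow> complex fps" where
  "rowphi \<epsilon> i k = linephi \<epsilon> i k * (if i = bad then psi_series t \<epsilon> (c 2) else 1)"

lemma rowphi_step:
  assumes "i \<le> n" "Q = q powi (- cartan_matrix n i (color k))"
  shows "fps_lin \<epsilon> 1 (Q * c (k + 1)) * rowphi \<epsilon> i (k + 1) = fps_lin \<epsilon> Q (c (k + 1)) * rowphi \<epsilon> i k"
  unfolding rowphi_def mult.assoc[symmetric] linephi_step[OF assms] ..

text \<open>Up to the factor q - q^-1, the scalar of the commutator of a raising mode with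
  \<open>ym\<close> on the row; the two neighbouring values are combined as the modes in
  \<open>ym\<close> are.\<close>

definition rowjump :: "nat \<Rightarrow> int \<Rightarrow> int \<Rightarrow> complex" where
  "rowjump i k m = (let J = jump (\<lambda>\<epsilon>. rowphi \<epsilon> i k) in
     if i = bad \<and> k > 0 then J (m + 1) - c 2 * J m else J m)"

text \<open>Removing the pole at \<open>c 2\<close> leaves the numerator of psi, here evaluated at
  the remaining pole. The argument counts the new box, so the box added to a row of length k carries
  \<open>cst (k + 1)\<close>.\<close>

definition cst :: "int \<Rightarrow> complex" where
  "cst k = (if color (k - 1) = bad then q * c k - c 2 / q else 1)"

lemma cst_nonzero: "k > 0 \<Longrightarrow> cst k \<noteq> 0"
proof -
  assume "k > 0"
  then have "c (k + 1) \<noteq> c 1" by (simp add: c_inj)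
  moreover have "c (k + 1) = q * c k" "c 2 / q = c 1"
    using c_shift[of k 1] c_shift[of 1 1] by simp_all
  ultimately show ?thesis by (simp add: cst_def)
qed

text \<open>The poles that remain are the addable end and, for k > 0, the removable end of the row.
  Outside the colour \<open>bad\<close> no psi is present, for k = 0 it cancels, and otherwise the
  combination clears its denominator and \<open>jump_mult_psi\<close> evaluates its
  numerator.\<close>

lemma rowjump_eq:
  assumes "k \<ge> 0"
  shows "rowjump i k m = (q - inverse q) *
    (if i = color k then cst (k + 1) * c (k + 1) powi m
     else if k > 0 \<and> i = color (k - 1) then - cst k * c k powi m else 0)"
proof -
  let ?g = "\<lambda>\<epsilon>. linephi \<epsilon> i k"
  note g = jump_linephi
  have d: "color k \<noteq> color (k - 1)" by (rule color_neq; simp)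
  consider "i \<noteq> bad" | "i = bad" "k > 0" | "i = bad" "k = 0" using assms by linarith
  then show ?thesis
  proof cases
    case 1
    then have "rowphi \<epsilon> i k = ?g \<epsilon>" for \<epsilon> by (simp add: rowphi_def)
    moreover have "i = color k \<Longrightarrow> cst (k + 1) = 1" "i = color (k - 1) \<Longrightarrow> cst k = 1"
      using 1 by (auto simp: cst_def)
    moreover have "k = 0 \<Longrightarrow> i \<noteq> color (k - 1)" using 1 by (auto simp: bad_def)
    ultimately show ?thesis using 1 d g[of i k m] assms by (auto simp: rowjump_def left_diff_distrib)
  next
    case 2
    then have "rowphi \<epsilon> i k = ?g \<epsilon> * psi_series t \<epsilon> (c 2)" for \<epsilon> by (simp add: rowphi_def)
    then have J: "rowjump i k m = q * jump ?g (m + 1) - c 2 / q * jump ?g m"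
      using 2 jump_mult_psi[OF c_nonzero, where g = ?g and m = m and t = t and k1 = 2] by (simp add: rowjump_def)
    have "i = color k \<Longrightarrow> cst (k + 1) = q * c (k + 1) - c 2 / q"
      "i = color (k - 1) \<Longrightarrow> cst k = q * c k - c 2 / q"
      using 2 by (auto simp: cst_def)
    moreover have "q * (x * z powi (m + 1)) - c 2 / q * (x * z powi m) = x * ((q * z - c 2 / q) * z powi m)"
      if "z \<noteq> 0" for x z using that by (simp add: power_int_add algebra_simps)
    ultimately have G: "rowjump i k m = (if i = color k then (q - inverse q) * (cst (k + 1) * c (k + 1) powi m)
        else if i = color (k - 1) then - (q - inverse q) * (cst k * c k powi m) else 0)"
      unfolding J g by (simp only: c_nonzero not_False_eq_True mult_zero_right diff_zero if_cancel split: if_split) simp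
    show ?thesis unfolding G using 2 by (simp add: left_diff_distrib)
  next
    case 3
    then have "rowphi \<epsilon> i k = 1" for \<epsilon>
      using d psi_inverse_mult[of "c 2" t \<epsilon>]
      by (simp add: rowphi_def linephi_def bad_def mult.commute)
    then show ?thesis using 3 d by (simp add: rowjump_def jump_one bad_def)
  qed
qed

text \<open>In the colour \<open>bad\<close> a box can also be added below the first one, which gives the lowering
  current a second pole with parameter \<open>c 2\<close>; this combination removes it.\<close>

definition ym :: "nat \<Rightarrow> int \<Rightarrow> int \<Rightarrow> 'v \<Rightarrow> 'v" where
  "ym i k s v = (if i = bad \<and> k > 0 then xm i (s + 1) v - c 2 *\<^sub>C xm i s v else xm i s v)"

text \<open>The vector of the Young diagram with a single row of \<open>k\<close> boxes, normalized so that the raising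
  currents act without scalar factors.\<close>

primrec row :: "nat \<Rightarrow> 'v" where
  "row 0 = v0"
| "row (Suc k) = inverse (cst (int k + 1)) *\<^sub>C ym (color (int k)) (int k) 0 (row k)"

declare row.simps(2) [simp del]

definition rowweight :: "nat \<Rightarrow> cartan \<Rightarrow> rat" where
  "rowweight k h = pairing n lam h - (\<Sum>m<k. pairing n (simple_root n (color (int m))) h)"

lemma clin_ym: "i \<le> n \<Longrightarrow> clin (ym i k s)"
  unfolding ym_def using clin_xm by (intro clin_intros) auto

lemma xp_ym:
  assumes "i \<le> n" "j \<le> n"
  shows "xp i r (ym j k s v) = ym j k s (xp i r v) +
    (if i = j then inverse (q - inverse q) *\<^sub>C
      (if j = bad \<and> k > 0
       then (ph Pos i (r + s + 1) v - ph Neg i (r + s + 1) v) - c 2 *\<^sub>C (ph Pos i (r + s) v - ph Neg i (r + s) v)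
       else ph Pos i (r + s) v - ph Neg i (r + s) v) else 0)"
proof -
  have X: "xp i r (xm j s v) = xm j s (xp i r v) + (if i = j then inverse (q - inverse q) *\<^sub>C
        (ph Pos i (r + s) v - ph Neg i (r + s) v) else 0)" for s
    using xp_xm[OF assms, of r s v] by (simp add: algebra_simps)
  show ?thesis
  proof (cases "j = bad \<and> k > 0")
    case True
    then have y: "ym j k s v = xm j (s + 1) v - c 2 *\<^sub>C xm j s v" for s v
      by (simp add: ym_def)
    show ?thesis
      unfolding y clin_diff[OF clin_xp[OF assms(1)]] clin_scale[OF clin_xp[OF assms(1)]] X
      using True by (simp add: scaleC_add_right cvec.scale_right_diff_distrib add.assoc
          mult.commute[of "c 2"])
  next
    case False
    then have y: "ym j k s v = xm j s v" for s v
      by (auto simp: ym_def)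
    show ?thesis unfolding y X using False by auto
  qed
qed

text \<open>The exchange relation is invariant under shifts of s, hence passes to combinations of
  shifted modes with constant coefficients.\<close>

lemma ph_ym:
  assumes "i \<le> n" "j \<le> n"
  shows "ph \<epsilon> i r (ym j k (s - 1) v) - (q powi (- cartan_matrix n i j)) *\<^sub>C ph \<epsilon> i (r - 1) (ym j k s v) =
      (q powi (- cartan_matrix n i j)) *\<^sub>C ym j k (s - 1) (ph \<epsilon> i r v) - ym j k s (ph \<epsilon> i (r - 1) v)"
proof (cases "j = bad \<and> k > 0")
  case False
  then show ?thesis using ph_xm[OF assms] by (auto simp: ym_def)
next
  case True
  let ?Q = "q powi (- cartan_matrix n i j)"
  let ?L = "\<lambda>s. ph \<epsilon> i r (xm j (s - 1) v) - ?Q *\<^sub>C ph \<epsilon> i (r - 1) (xm j s v)"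
  let ?R = "\<lambda>s. ?Q *\<^sub>C xm j (s - 1) (ph \<epsilon> i r v) - xm j s (ph \<epsilon> i (r - 1) v)"
  have "ph \<epsilon> i r (ym j k (s - 1) v) - ?Q *\<^sub>C ph \<epsilon> i (r - 1) (ym j k s v) = ?L (s + 1) - c 2 *\<^sub>C ?L s"
    using True by (simp add: ym_def clin_diff[OF clin_ph[OF assms(1)]] clin_scale[OF clin_ph[OF assms(1)]]
        cvec.scale_right_diff_distrib cvec.scale_left_commute[of "c 2"])
  also have "\<dots> = ?R (s + 1) - c 2 *\<^sub>C ?R s"
    by (simp only: ph_xm[OF assms])
  also have "\<dots> = ?Q *\<^sub>C ym j k (s - 1) (ph \<epsilon> i r v) - ym j k s (ph \<epsilon> i (r - 1) v)"
    using True by (simp add: ym_def cvec.scale_right_diff_distrib cvec.scale_left_commute[of "c 2"])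
  finally show ?thesis .
qed

lemma k_ym:
  assumes "h \<in> cartan_space n" "j \<le> n"
  shows "kk h (ym j k s v) = inverse (qexp t (pairing n (simple_root n j) h)) *\<^sub>C ym j k s (kk h v)"
  using assms by (simp add: ym_def k_xm clin_diff[OF clin_kk] clin_scale[OF clin_kk]
      cvec.scale_right_diff_distrib cvec.scale_left_commute[of "c 2"])

text \<open>One half of a simultaneous induction; \<open>row_lower\<close> is the other. Raising
  after lowering meets row k through the commutator and row k - 1 through the shortened row, so the
  step uses \<open>row_inv k\<close> together with \<open>row_lower (k - 1)\<close>.\<close>

definition row_inv :: "nat \<Rightarrow> bool" where
  "row_inv k \<longleftrightarrow>
     (\<forall>h\<in>cartan_space n. kk h (row k) = qexp t (rowweight k h) *\<^sub>C row k) \<and>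
     (\<forall>\<epsilon>. \<forall>i\<le>n. \<forall>r. ph \<epsilon> i r (row k) = coef \<epsilon> (rowphi \<epsilon> i (int k)) r *\<^sub>C row k) \<and>
     (\<forall>i\<le>n. \<forall>r. xp i r (row k) =
        (if k > 0 \<and> i = color (int k - 1) then c (int k) powi r *\<^sub>C row (k - 1) else 0))"

definition row_lower :: "nat \<Rightarrow> bool" where
  "row_lower k \<longleftrightarrow> (\<forall>i\<le>n. \<forall>s. ym i (int k) s (row k) =
     (if i = color (int k) then (cst (int k + 1) * c (int k + 1) powi s) *\<^sub>C row (k + 1) else 0))"

text \<open>When a raising mode has shortened the row first, the index of \<open>ym\<close> is one
  too large. This matters only for the empty row in the colour \<open>bad\<close>, and there all
  lowering modes vanish.\<close>

lemma ym_row_prev: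
  assumes "row_lower k" "i \<le> n"
  shows "ym i (int k + 1) s (row k) =
    (if i = color (int k) then (cst (int k + 1) * c (int k + 1) powi s) *\<^sub>C row (k + 1) else 0)"
proof (cases "k > 0 \<or> i \<noteq> bad")
  case True
  then have "ym i (int k + 1) s (row k) = ym i (int k) s (row k)" by (auto simp: ym_def)
  then show ?thesis using assms by (simp add: row_lower_def)
next
  case False
  then have "i \<noteq> color (int k)" using color_neq[of "-1" 0] by (auto simp: bad_def)
  moreover from this have "xm i s (row k) = 0" for s
    using assms False by (auto simp: row_lower_def ym_def)
  ultimately show ?thesis by (auto simp: ym_def)
qed

text \<open>Two contributions in the colour \<open>color (k - 1)\<close> cancel: the pole of the
  commutator at the removable end, with coefficient - \<open>cst k\<close>, and the last box being
  removed and added again. Only the addable end survives.\<close>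

lemma xp_ym_row:
  assumes "row_inv k" "k > 0 \<Longrightarrow> row_lower (k - 1)" "i \<le> n" "j \<le> n"
  shows "xp j m (ym i (int k) s (row k)) =
    (if j = i \<and> i = color (int k) then (cst (int k + 1) * c (int k + 1) powi (m + s)) *\<^sub>C row k else 0)"
proof -
  have P: "xp j m (row k) = (if k > 0 \<and> j = color (int k - 1) then c (int k) powi m *\<^sub>C row (k - 1) else 0)"
    and F: "\<And>\<epsilon> i r. i \<le> n \<Longrightarrow> ph \<epsilon> i r (row k) = coef \<epsilon> (rowphi \<epsilon> i (int k)) r *\<^sub>C row k"
    using assms by (auto simp: row_inv_def)
  have d: "color (int k) \<noteq> color (int k - 1)" by (rule color_neq; simp)
  have D: "ph Pos j r (row k) - ph Neg j r (row k) = jump (\<lambda>\<epsilon>. rowphi \<epsilon> j (int k)) r *\<^sub>C row k" for r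
    using F[OF assms(4)] by (simp add: jump_def cvec.scale_left_diff_distrib)
  have "xp j m (ym i (int k) s (row k)) = ym i (int k) s (xp j m (row k)) +
      (if j = i then inverse (q - inverse q) *\<^sub>C (rowjump i (int k) (m + s) *\<^sub>C row k) else 0)"
    unfolding xp_ym[OF assms(4,3)] D
    by (auto simp: rowjump_def Let_def cvec.scale_left_diff_distrib scaleC_scaleC algebra_simps)
  also have "ym i (int k) s (xp j m (row k)) =
      (if k > 0 \<and> j = color (int k - 1) \<and> i = color (int k - 1)
       then (cst (int k) * c (int k) powi (m + s)) *\<^sub>C row k else 0)"
  proof (cases "k > 0")
    case True
    then have k: "int (k - 1) + 1 = int k" "k - 1 + 1 = k" by auto
    from True show ?thesis
      using ym_row_prev[OF assms(2)[OF True] assms(3), of s, unfolded k] P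
      by (auto simp: clin_scale[OF clin_ym] clin_zero[OF clin_ym] assms(3) color_le
          scaleC_scaleC power_int_add of_nat_diff mult_ac)
  next
    case False
    then show ?thesis using P by (simp add: clin_zero[OF clin_ym[OF assms(3)]])
  qed
  finally show ?thesis
    using d q_diff by (auto simp: rowjump_eq scaleC_scaleC scaleC_one)
qed

lemma kr_row:
  assumes "row_inv k"
  shows "kr (row k) = (kap * inverse q ^ k) *\<^sub>C row k"
proof -
  have "rowweight k (coheight n) = pairing n lam (coheight n) - of_nat k"
    by (simp add: rowweight_def pairing_coheight n2 color_le)
  moreover have "qexp t (of_nat k) = q ^ k"
    by (simp add: qexp_def exp_of_nat2_mult)
  ultimately show ?thesis
    using assms by (simp add: row_inv_def kr_def coheight_in kap_def qexp_diff divide_inverse power_inverse)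
qed

lemma kr_ym_row:
  assumes "row_inv k" "i \<le> n"
  shows "kr (ym i k' s (row k)) = (kap * inverse q ^ Suc k) *\<^sub>C ym i k' s (row k)"
  using kr_row[OF assms(1)] unfolding kr_def
  by (simp add: k_ym[OF coheight_in assms(2)] pairing_coheight n2 assms qexp_1
      clin_scale[OF clin_ym[OF assms(2)]] scaleC_scaleC mult_ac)

lemma row_lower_step:
  assumes "row_inv k" "k > 0 \<Longrightarrow> row_lower (k - 1)"
  shows "row_lower k"
  unfolding row_lower_def
proof (intro allI impI)
  fix i s assume i: "i \<le> n"
  let ?y = "\<lambda>s. ym i (int k) s (row k)"
  show "?y s = (if i = color (int k) then (cst (int k + 1) * c (int k + 1) powi s) *\<^sub>C row (k + 1) else 0)"
  proof (cases "i = color (int k)")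
    case False
    have "?y s = 0"
      by (rule singular_zero[OF kr_ym_row[OF assms(1) i]])
        (use False in \<open>auto simp: xp_ym_row[OF assms i]\<close>)
    then show ?thesis using False by simp
  next
    case True
    \<comment> \<open>Both terms have the same image under every raising mode, because the scalar in
      \<open>xp_ym_row\<close> is geometric in s.\<close>
    have "?y s - c (int k + 1) powi s *\<^sub>C ?y 0 = 0"
    proof (rule singular_zero)
      show "kr (?y s - c (int k + 1) powi s *\<^sub>C ?y 0) =
          (kap * inverse q ^ Suc k) *\<^sub>C (?y s - c (int k + 1) powi s *\<^sub>C ?y 0)"
        by (simp only: clin_diff[OF clin_kr] clin_scale[OF clin_kr] kr_ym_row[OF assms(1) i]
            cvec.scale_right_diff_distrib cvec.scale_left_commute)
      show "xp j m (?y s - c (int k + 1) powi s *\<^sub>C ?y 0) = 0" if j: "j \<le> n" for j m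
        by (simp add: clin_diff[OF clin_xp[OF j]] clin_scale[OF clin_xp[OF j]]
            xp_ym_row[OF assms i j] scaleC_scaleC power_int_add mult_ac)
    qed simp
    then show ?thesis
      using True cst_nonzero[of "int k + 1"] by (simp add: row.simps(2) scaleC_scaleC mult_ac)
  qed
qed

lemma row_inv_step:
  assumes "row_inv k" "k > 0 \<Longrightarrow> row_lower (k - 1)"
  shows "row_inv (Suc k)"
proof -
  let ?i = "color (int k)"
  let ?y = "\<lambda>s. ym ?i (int k) s (row k)"
  let ?c = "c (int k + 1)"
  have cn: "cst (int k + 1) \<noteq> 0" by (rule cst_nonzero) simp
  have i: "?i \<le> n" by (rule color_le)
  have lower: "row_lower k" by (rule row_lower_step[OF assms])
  then have y: "?y s = (cst (int k + 1) * ?c powi s) *\<^sub>C row (Suc k)" for s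
    using i by (simp add: row_lower_def)
  have K: "kk h (row (Suc k)) = qexp t (rowweight (Suc k) h) *\<^sub>C row (Suc k)" if h: "h \<in> cartan_space n" for h
  proof -
    have "kk h (row k) = qexp t (rowweight k h) *\<^sub>C row k"
      using assms(1) h by (simp add: row_inv_def)
    then have "kk h (?y 0) = (qexp t (rowweight k h) / qexp t (pairing n (simple_root n ?i) h)) *\<^sub>C ?y 0"
      by (simp add: k_ym[OF h i] clin_scale[OF clin_ym[OF i]] scaleC_scaleC divide_inverse mult_ac)
    also have "qexp t (rowweight k h) / qexp t (pairing n (simple_root n ?i) h) = qexp t (rowweight (Suc k) h)"
      by (simp add: rowweight_def flip: qexp_diff) (simp add: algebra_simps)
    finally show ?thesis by (simp add: row.simps(2) clin_scale[OF clin_kk[OF h]] cvec.scale_left_commute)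
  qed
  have F: "ph \<epsilon> j r (row (Suc k)) = coef \<epsilon> (rowphi \<epsilon> j (int (Suc k))) r *\<^sub>C row (Suc k)"
    if j: "j \<le> n" for \<epsilon> j r
  proof (rule eigenvalues_determined[of \<epsilon> "\<lambda>r. ph \<epsilon> j r (row (Suc k))"
        "coef \<epsilon> (rowphi \<epsilon> j (int (Suc k)))"])
    let ?Q = "q powi (- cartan_matrix n j ?i)"
    let ?E = "coef \<epsilon> (rowphi \<epsilon> j (int k))"
    show "ph \<epsilon> j r (row (Suc k)) = 0" "coef \<epsilon> (rowphi \<epsilon> j (int (Suc k))) r = 0" if "sgz \<epsilon> * r < 0" for r
      using that j by (auto simp: ph_support coef_def)
    show "?Q * ?c \<noteq> 0" by simp
    fix r
    have E: "ph \<epsilon> j r (row k) = ?E r *\<^sub>C row k" for r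
      using assms(1) j by (simp add: row_inv_def)
    \<comment> \<open>The modes 0 and 1 are both multiples of the next row, with ratio
      \<open>c (k + 1)\<close>; thus the exchange relation closes to a first-order recurrence for
      the eigenvalues there.\<close>
    have "ph \<epsilon> j r (?y 0) - ?Q *\<^sub>C ph \<epsilon> j (r - 1) (?y 1) =
        ?Q *\<^sub>C ym ?i (int k) 0 (ph \<epsilon> j r (row k)) - ym ?i (int k) 1 (ph \<epsilon> j (r - 1) (row k))"
      using ph_ym[OF j i, of \<epsilon> r "int k" 1 "row k"] by simp
    then have "cst (int k + 1) *\<^sub>C (ph \<epsilon> j r (row (Suc k)) - (?Q * ?c) *\<^sub>C ph \<epsilon> j (r - 1) (row (Suc k))) =
        cst (int k + 1) *\<^sub>C ((?Q * ?E r - ?c * ?E (r - 1)) *\<^sub>C row (Suc k))"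
      unfolding E clin_scale[OF clin_ym[OF i]] y clin_scale[OF clin_ph[OF j]]
      by (simp add: cvec.scale_right_diff_distrib cvec.scale_left_diff_distrib scaleC_scaleC mult_ac)
    then have "ph \<epsilon> j r (row (Suc k)) - (?Q * ?c) *\<^sub>C ph \<epsilon> j (r - 1) (row (Suc k)) =
        (?Q * ?E r - ?c * ?E (r - 1)) *\<^sub>C row (Suc k)"
      by (rule cvec.scale_left_imp_eq[OF cn])
    also have "?Q * ?E r - ?c * ?E (r - 1) =
        coef \<epsilon> (rowphi \<epsilon> j (int (Suc k))) r - ?Q * ?c * coef \<epsilon> (rowphi \<epsilon> j (int (Suc k))) (r - 1)"
      using coef_recurrence[OF rowphi_step[OF j refl], of \<epsilon> "int k" r] by (simp add: add.commute)
    finally show "ph \<epsilon> j r (row (Suc k)) - (?Q * ?c) *\<^sub>C ph \<epsilon> j (r - 1) (row (Suc k)) =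
        (coef \<epsilon> (rowphi \<epsilon> j (int (Suc k))) r - ?Q * ?c * coef \<epsilon> (rowphi \<epsilon> j (int (Suc k))) (r - 1)) *\<^sub>C row (Suc k)" .
  qed
  have P: "xp j r (row (Suc k)) = (if j = ?i then ?c powi r *\<^sub>C row k else 0)" if j: "j \<le> n" for j r
    using cn by (simp add: row.simps(2) clin_scale[OF clin_xp[OF j]] xp_ym_row[OF assms i j] scaleC_scaleC scaleC_one)
  show ?thesis
    unfolding row_inv_def using K F P by (simp add: add.commute)
qed

lemma row_inv_0: "row_inv 0"
proof -
  have "coef \<epsilon> (rowphi \<epsilon> i 0) r = coef \<epsilon> (if i = vertex n l0 then psi_series t \<epsilon> (a * q) else 1) r" for \<epsilon> i r
  proof -
    have d: "color 0 \<noteq> bad" unfolding bad_def by (rule color_neq) auto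
    have "c 1 = a * q" "vertex n l0 = color 0" by (simp_all add: c_def color_def)
    then show ?thesis
      using d psi_inverse_mult[of "c 2" t \<epsilon>] by (auto simp: rowphi_def linephi_def bad_def mult.commute)
  qed
  then show ?thesis
    by (simp add: row_inv_def rowweight_def k_v0 ph_v0 xp_v0)
qed

lemma row_facts: "row_inv k \<and> row_lower k \<and> (k > 0 \<longrightarrow> row_lower (k - 1))"
proof (induction k)
  case 0 then show ?case using row_inv_0 row_lower_step[of 0] by simp
next
  case (Suc k)
  then have "row_inv (Suc k)" by (intro row_inv_step) auto
  then show ?case using Suc row_lower_step[of "Suc k"] by simp
qed

lemma row_nonzero: "row k \<noteq> 0"
proof (induction k)
  case 0 then show ?case using v0 by simp
next
  case (Suc k)
  have "xp (color (int k)) 0 (row (Suc k)) = row k"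
    using row_facts[of "Suc k"] by (simp add: row_inv_def color_le)
  then show ?case using Suc clin_zero[OF clin_xp[OF color_le]] by metis
qed

text \<open>On modes proportional to z^s the combination in \<open>ym\<close> multiplies by z -
  \<open>c 2\<close>; the unmodified lowering current therefore carries \<open>cst\<close> divided
  by this factor.\<close>

definition rowcoeff :: "int \<Rightarrow> complex" where
  "rowcoeff k = (if color (k - 1) = bad then (q * c k - c 2 / q) / (c k - c 2) else 1)"

text \<open>A first-order inhomogeneous recurrence in s, solved by a particular solution with ratio
  \<open>c (k + 1)\<close> and a homogeneous one with ratio \<open>c 2\<close>. The vector
  \<open>u\<close> stands for the diagram with a box below the first one and stays undetermined: in
  the tensor product its coefficient becomes zero.\<close>

lemma xm_row:
  "\<exists>u. \<forall>i\<le>n. \<forall>s. xm i s (row k) =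
     (if i = color (int k) then (rowcoeff (int k + 1) * c (int k + 1) powi s) *\<^sub>C row (k + 1) else 0)
     + (if i = bad \<and> k > 0 then c 2 powi s *\<^sub>C u else 0)"
proof -
  let ?k = "int k"
  let ?A = "\<lambda>i. if i = color ?k then cst (?k + 1) *\<^sub>C row (k + 1) else 0"
  have L: "ym i ?k s (row k) = c (?k + 1) powi s *\<^sub>C ?A i" if "i \<le> n" for i s
    using row_facts[of k] that by (simp add: row_lower_def mult.commute)
  \<comment> \<open>The two ratios coincide only for k = 1, where the new box does not have the
    colour \<open>bad\<close>.\<close>
  have ne: "c (?k + 1) \<noteq> c 2" if "k > 0" "color ?k = bad"
  proof -
    have "?k \<noteq> 1" using that color_neq[of 1 "-1"] by (auto simp: bad_def)
    then show ?thesis by (simp add: c_inj)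
  qed
  let ?B = "inverse (c (?k + 1) - c 2) *\<^sub>C ?A bad"
  define z where "z s = xm bad s (row k) - c (?k + 1) powi s *\<^sub>C ?B" for s
  have step: "z (s + 1) = c 2 *\<^sub>C z s" if k: "k > 0" for s
  proof -
    have B: "(c (?k + 1) - c 2) *\<^sub>C ?B = ?A bad"
      using ne[OF k] by simp
    have "c (?k + 1) powi (s + 1) *\<^sub>C ?B - c 2 *\<^sub>C (c (?k + 1) powi s *\<^sub>C ?B) =
        (c (?k + 1) powi s * (c (?k + 1) - c 2)) *\<^sub>C ?B"
      unfolding scaleC_scaleC cvec.scale_left_diff_distrib[symmetric]
      by (simp add: power_int_add right_diff_distrib mult.commute)
    also have "\<dots> = c (?k + 1) powi s *\<^sub>C ?A bad"
      unfolding scaleC_scaleC[symmetric] B ..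
    finally have "z (s + 1) - c 2 *\<^sub>C z s = (xm bad (s + 1) (row k) - c 2 *\<^sub>C xm bad s (row k))
        - c (?k + 1) powi s *\<^sub>C ?A bad"
      unfolding z_def cvec.scale_right_diff_distrib[of "c 2"] by (simp only: algebra_simps)
    also have "\<dots> = 0" using L[OF bad_le, of s] k by (simp add: ym_def)
    finally show ?thesis by simp
  qed
  have z: "z s = c 2 powi s *\<^sub>C z 0" if k: "k > 0" for s
  proof (induction s rule: int_induct[of _ 0])
    case base then show ?case by simp
  next
    case (step1 s) then show ?case by (simp add: step[OF k] power_int_add mult.commute)
  next
    case (step2 s)
    then have "c 2 *\<^sub>C z (s - 1) = c 2 *\<^sub>C (c 2 powi (s - 1) *\<^sub>C z 0)"
      using step[OF k, of "s - 1"] by (simp add: power_int_diff)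
    then show ?case using cvec.scale_left_imp_eq[of "c 2"] c_nonzero by blast
  qed
  show ?thesis
  proof (intro exI[of _ "z 0"] allI impI)
    fix i s assume i: "i \<le> n"
    show "xm i s (row k) =
     (if i = color ?k then (rowcoeff (?k + 1) * c (?k + 1) powi s) *\<^sub>C row (k + 1) else 0)
     + (if i = bad \<and> k > 0 then c 2 powi s *\<^sub>C z 0 else 0)"
    proof (cases "i = bad \<and> k > 0")
      case True
      then have "xm i s (row k) = c (?k + 1) powi s *\<^sub>C ?B + c 2 powi s *\<^sub>C z 0"
        using z[of s] by (simp add: z_def algebra_simps)
      then show ?thesis
        using True by (simp add: rowcoeff_def cst_def divide_inverse mult_ac)
    next
      case False
      then have "xm i s (row k) = ym i ?k s (row k)" by (auto simp: ym_def)
      moreover have "rowcoeff (?k + 1) = cst (?k + 1)" if "i = color ?k"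
        using False that color_neq[of 0 "-1"] by (auto simp: rowcoeff_def cst_def bad_def)
      ultimately show ?thesis
        using False L[OF i, of s] by (auto simp: mult.commute)
    qed
  qed
qed

text \<open>The zero of psi at \<open>c 2\<close> is met at z^-1 = \<open>c 0\<close>, where
  \<open>linephi\<close> is regular once k is positive. In the tensor product this suppresses the
  terms that move the weight vector of the other factor while the row is nonempty.\<close>

lemma rowphi_value_zero:
  assumes "k \<ge> 1"
  shows "fps_value (rowphi Neg bad k) (c 0) 0"
proof -
  have c2: "c 2 = q ^ 2 * c 0" "c 1 = q * c 0" using c_shift[of 0 2] c_shift[of 0 1] by simp_all
  have "c 0 \<noteq> c 2" by (simp add: c_inj)
  moreover have "poly (poly_lin Neg q (c 2 / q)) (c 0) = 0"
    by (simp add: c2(1) power2_eq_square mult.commute)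
  ultimately have p: "fps_value (psi_series t Neg (c 2)) (c 0) 0"
    using fps_value_psi[of "c 2" Neg "c 0" t] by simp
  have "\<exists>z. fps_value (linephi Neg bad k) (c 0) z"
  proof -
    have "c 0 \<noteq> c (k + 1)" using assms by (simp add: c_inj)
    then have 1: "\<exists>z. fps_value (psi_series t Neg (c (k + 1))) (c 0) z"
      using fps_value_psi[of "c (k + 1)" Neg "c 0" t] by auto
    have "c (k + 2) / q = c (k + 1)" using c_shift[of "k + 1" 1] by (simp add: add.assoc)
    moreover have "c 1 \<noteq> c (k + 1)" using assms by (simp add: c_inj)
    ultimately have 2: "\<exists>z. fps_value (inverse (psi_series t Neg (c (k + 2)))) (c 0) z"
      using fps_value_inverse_psi[of "c (k + 2)" Neg t "c 0"] by (auto simp: c2(2) mult.commute)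
    show ?thesis using 1 2 fps_value_one by (auto simp: linephi_def)
  qed
  then obtain z where "fps_value (linephi Neg bad k) (c 0) z" ..
  from fps_value_mult[OF this p] show ?thesis by (simp add: rowphi_def)
qed

lemma phi_row: "i \<le> n \<Longrightarrow> ph \<epsilon> i r (row k) = coef \<epsilon> (rowphi \<epsilon> i (int k)) r *\<^sub>C row k"
  using row_facts[of k] by (simp add: row_inv_def)

lemma xp_row: "i \<le> n \<Longrightarrow> xp i r (row k) =
    (if k > 0 \<and> i = color (int k - 1) then c (int k) powi r *\<^sub>C row (k - 1) else 0)"
  using row_facts[of k] by (simp add: row_inv_def)

lemma k_row: "h \<in> cartan_space n \<Longrightarrow> kk h (row k) = qexp t (rowweight k h) *\<^sub>C row k"
  using row_facts[of k] by (simp add: row_inv_def)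

end

section \<open>Exponential and logarithm of operator series\<close>

lemma series_power_diagonal:
  assumes "\<And>s. s \<ge> 1 \<Longrightarrow> s \<le> m \<Longrightarrow> clin (A s)" "\<And>s. s \<ge> 1 \<Longrightarrow> s \<le> m \<Longrightarrow> A s v = fps_nth f s *\<^sub>C v"
    "fps_nth f 0 = 0"
  shows "series_power A k m v = fps_nth (f ^ k) m *\<^sub>C v"
  using assms
proof (induction k arbitrary: m)
  case 0 then show ?case by auto
next
  case (Suc k)
  have "series_power A (Suc k) m v = (\<Sum>s = 1..m. (fps_nth f s * fps_nth (f ^ k) (m - s)) *\<^sub>C v)"
    using Suc by (auto intro!: sum.cong simp: clin_scale mult.commute)
  also have "\<dots> = (\<Sum>s = 0..m. fps_nth f s * fps_nth (f ^ k) (m - s)) *\<^sub>C v"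
    using Suc.prems(3) by (simp add: sum.atLeast_Suc_atMost[of 0 m] cvec.scale_sum_left)
  finally show ?case by (simp add: fps_mult_nth)
qed

lemma clin_series_power:
  assumes "\<And>s. s \<ge> 1 \<Longrightarrow> s \<le> m \<Longrightarrow> clin (A s)"
  shows "clin (series_power A k m)"
  using assms
proof (induction k arbitrary: m)
  case 0 then show ?case by (cases "m = 0") (simp_all add: clin_intros)
next
  case (Suc k)
  have "clin (\<lambda>v. A s (series_power A k (m - s) v))" if "s \<in> {1..m}" for s
  proof (rule clin_compose[of "A s" "series_power A k (m - s)"])
    show "clin (A s)" using that Suc.prems by simp
    show "clin (series_power A k (m - s))" by (rule Suc.IH) (use that Suc.prems in simp)
  qed
  then show ?case unfolding series_power.simps by (rule clin_sum_fun)
qed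

text \<open>\<open>fps_ln 1\<close> is the series of log(1 + X), so the exponential composed with it
  is 1 + X.\<close>

lemma fps_exp_compose_ln:
  assumes "fps_nth (B :: complex fps) 0 = 1"
  shows "fps_exp 1 oo (fps_ln 1 oo (B - 1)) = B"
proof -
  have "(fps_exp 1 - 1) oo fps_ln 1 = (fps_X :: complex fps)"
    by (subst fps_ln_fps_exp_inv) (simp_all add: fps_inv_right)
  then have e: "fps_exp 1 oo fps_ln 1 = (1 + fps_X :: complex fps)"
    by (simp add: fps_compose_sub_distrib algebra_simps)
  have "fps_exp 1 oo (fps_ln 1 oo (B - 1)) = (fps_exp 1 oo fps_ln 1) oo (B - 1)"
    by (rule fps_compose_assoc) (simp_all add: assms fps_ln_def)
  also have "\<dots> = B"
    unfolding e fps_compose_add_distrib by (simp add: fps_compose_1 assms)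
  finally show ?thesis .
qed

text \<open>The operators h_{i,m} inside \<open>qmod_of_phi\<close>, named so that they can be
  treated apart from the record.\<close>

definition log_op :: "complex \<Rightarrow> (cartan \<Rightarrow> 'v \<Rightarrow> 'v) \<Rightarrow> (pm \<Rightarrow> nat \<Rightarrow> nat \<Rightarrow> 'v \<Rightarrow> 'v) \<Rightarrow> nat \<Rightarrow> int
    \<Rightarrow> 'v \<Rightarrow> 'v::complex_vector" where
  "log_op t K \<Phi> i m v = (let \<epsilon> = (if m > 0 then Pos else Neg); N = nat \<bar>m\<bar> in
         (of_int (sgz \<epsilon>) / (exp t - inverse (exp t))) *\<^sub>C
         (\<Sum>k = 1..N. ((- 1) ^ (k + 1) / of_nat k) *\<^sub>C
            series_power (\<lambda>s. K (- signed_coroot \<epsilon> i) \<circ> \<Phi> \<epsilon> i s) k N v))"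

lemma qmod_of_phi_sel [simp]:
  "space (qmod_of_phi t S X K \<Phi>) = S" "xop (qmod_of_phi t S X K \<Phi>) = X"
  "kop (qmod_of_phi t S X K \<Phi>) = K" "hop (qmod_of_phi t S X K \<Phi>) = log_op t K \<Phi>"
  by (simp_all add: qmod_of_phi_def log_op_def fun_eq_iff)

lemma clin_log_op:
  assumes "\<And>\<epsilon>. clin (K (- signed_coroot \<epsilon> i))" "\<And>\<epsilon> s. clin (\<Phi> \<epsilon> i s)"
  shows "clin (log_op t K \<Phi> i m)"
proof -
  have S: "clin (series_power (\<lambda>s. K (- signed_coroot \<epsilon> i) \<circ> \<Phi> \<epsilon> i s) k N)" for \<epsilon> k N
    using clin_compose[OF assms] by (intro clin_series_power) (simp add: o_def)
  show ?thesis
    unfolding log_op_def Let_def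
    by (rule clin_intros(6), rule clin_sum_fun, rule clin_intros(6), rule S)
qed

lemma sgz_times_pos: "m > 0 \<Longrightarrow> (if sgz \<epsilon> * int m > 0 then Pos else Neg) = \<epsilon>"
  by (cases \<epsilon>) auto

lemma sgz_square [simp]: "sgz \<epsilon> * sgz \<epsilon> = 1"
  by (cases \<epsilon>) auto

lemma log_op_diagonal:
  assumes "\<And>s. clin (K (- signed_coroot \<epsilon> i) \<circ> \<Phi> \<epsilon> i s)"
    "\<And>s. (K (- signed_coroot \<epsilon> i) \<circ> \<Phi> \<epsilon> i s) v = fps_nth B s *\<^sub>C v" "fps_nth B 0 = 1" "m > 0"
  shows "log_op t K \<Phi> i (sgz \<epsilon> * int m) v =
    (of_int (sgz \<epsilon>) / (exp t - inverse (exp t)) * fps_nth (fps_ln 1 oo (B - 1)) m) *\<^sub>C v"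
proof -
  have "series_power (\<lambda>s. K (- signed_coroot \<epsilon> i) \<circ> \<Phi> \<epsilon> i s) k m v = fps_nth ((B - 1) ^ k) m *\<^sub>C v" for k
    by (rule series_power_diagonal) (use assms in auto)
  moreover have "fps_nth (fps_ln 1 oo (B - 1)) m = (\<Sum>k = 1..m. (- 1) ^ (k + 1) / of_nat k * fps_nth ((B - 1) ^ k) m)"
  proof -
    have "fps_nth (fps_ln 1 oo (B - 1)) m = (\<Sum>k = 1..m. fps_nth (fps_ln 1) k * fps_nth ((B - 1) ^ k) m)"
      by (simp add: fps_compose_nth sum.atLeast_Suc_atMost[of 0 m] fps_ln_def)
    also have "\<dots> = (\<Sum>k = 1..m. (- 1) ^ (k + 1) / of_nat k * fps_nth ((B - 1) ^ k) m)"
    proof (rule sum.cong)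
      fix k assume "k \<in> {1..m}"
      then obtain k' where "k = Suc k'" by (cases k) auto
      then show "fps_nth (fps_ln 1) k * fps_nth ((B - 1) ^ k) m = (- 1) ^ (k + 1) / of_nat k * fps_nth ((B - 1) ^ k) m"
        by (simp add: fps_ln_def)
    qed simp
    finally show ?thesis .
  qed
  moreover have "nat \<bar>sgz \<epsilon> * int m\<bar> = m" by (cases \<epsilon>) auto
  ultimately show ?thesis
    using sgz_times_pos[OF assms(4), of \<epsilon>]
    by (simp add: log_op_def Let_def cvec.scale_sum_left scaleC_scaleC cvec.scale_sum_right
        sum_distrib_left mult.assoc)
qed

text \<open>\<open>phi\<close> exponentiates operators that were themselves obtained as a logarithm.
  On a simultaneous eigenvector both reduce to scalar power series, where exp undoes log.\<close>

lemma phi_log_op: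
  assumes hop: "\<And>m. m > 0 \<Longrightarrow> hop M i (sgz \<epsilon> * int m) = log_op t K \<Phi> i (sgz \<epsilon> * int m)"
    and K: "\<And>\<epsilon>. clin (K (- signed_coroot \<epsilon> i))" "\<And>\<epsilon> s. clin (\<Phi> \<epsilon> i s)"
    and eig: "\<And>s. K (- signed_coroot \<epsilon> i) (\<Phi> \<epsilon> i s v) = fps_nth B s *\<^sub>C v" "fps_nth B 0 = 1"
    and q: "exp t - inverse (exp t) \<noteq> 0"
  shows "phi t M \<epsilon> i s v = kop M (signed_coroot \<epsilon> i) (fps_nth B s *\<^sub>C v)"
proof -
  let ?h = "of_int (sgz \<epsilon>) * (exp t - inverse (exp t))"
  let ?L = "fps_ln 1 oo (B - 1)"
  let ?f = "fps_const (inverse ?h) * ?L"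
  have sg: "of_int (sgz \<epsilon>) * of_int (sgz \<epsilon>) = (1::complex)"
    by (metis of_int_1 of_int_mult sgz_square)
  then have h0: "?h \<noteq> 0" using q by auto
  have hi: "of_int (sgz \<epsilon>) / (exp t - inverse (exp t)) = inverse ?h"
    using sg q by (cases \<epsilon>) (auto simp: field_simps)
  have L0: "fps_nth ?f 0 = 0" by (simp add: fps_compose_nth fps_ln_def)
  have C: "clin (log_op t K \<Phi> i m)" for m
    by (rule clin_log_op) (rule K)+
  have "series_power (\<lambda>m. hop M i (sgz \<epsilon> * int m)) k s v = fps_nth (?f ^ k) s *\<^sub>C v" for k
  proof (rule series_power_diagonal)
    show "clin (hop M i (sgz \<epsilon> * int m))" if "m \<ge> 1" "m \<le> s" for m
      using that hop[of m] C by simp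
    show "hop M i (sgz \<epsilon> * int m) v = fps_nth ?f m *\<^sub>C v" if "m \<ge> 1" "m \<le> s" for m
    proof -
      have "log_op t K \<Phi> i (sgz \<epsilon> * int m) v = (of_int (sgz \<epsilon>) / (exp t - inverse (exp t)) * fps_nth ?L m) *\<^sub>C v"
        by (rule log_op_diagonal) (use that eig clin_compose[OF K(1) K(2)] in \<open>auto simp: o_def\<close>)
      then show ?thesis using that hop[of m] by (simp only: hi) simp
    qed
  qed (rule L0)
  then have "(\<Sum>k\<le>s. (?h ^ k / fact k) *\<^sub>C series_power (\<lambda>m. hop M i (sgz \<epsilon> * int m)) k s v) =
      (\<Sum>k = 0..s. ?h ^ k / fact k * fps_nth (?f ^ k) s) *\<^sub>C v"
    by (simp add: scaleC_scaleC cvec.scale_sum_left atMost_atLeast0)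
  also have "(\<Sum>k = 0..s. ?h ^ k / fact k * fps_nth (?f ^ k) s) = (\<Sum>k = 0..s. fps_nth (fps_exp 1) k * fps_nth (?L ^ k) s)"
  proof (rule sum.cong)
    fix k
    have "?f ^ k = fps_const (inverse ?h ^ k) * ?L ^ k"
      by (simp add: power_mult_distrib fps_const_power)
    then have "?h ^ k * fps_nth (?f ^ k) s = (?h ^ k * inverse ?h ^ k) * fps_nth (?L ^ k) s"
      by simp
    also have "?h ^ k * inverse ?h ^ k = 1"
      unfolding power_mult_distrib[symmetric] right_inverse[OF h0] by simp
    finally have e: "?h ^ k * fps_nth (?f ^ k) s = fps_nth (?L ^ k) s" by (simp only: mult_1)
    show "?h ^ k / fact k * fps_nth (?f ^ k) s = fps_nth (fps_exp 1) k * fps_nth (?L ^ k) s"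
      unfolding times_divide_eq_left e by simp
  qed simp
  also have "\<dots> = fps_nth B s"
    using arg_cong[OF fps_exp_compose_ln[OF eig(2)], of "\<lambda>f. fps_nth f s"] by (simp add: fps_compose_nth)
  finally show ?thesis by (simp add: phi_def)
qed

lemma log_op_cong:
  assumes "\<And>\<epsilon> s. K (- signed_coroot \<epsilon> i) \<circ> \<Phi> \<epsilon> i s = K' (- signed_coroot \<epsilon> i') \<circ> \<Phi>' \<epsilon> i' s"
  shows "log_op t K \<Phi> i m = log_op t K' \<Phi>' i' m"
  by (rule ext) (simp only: log_op_def assms)

lemma clin_phi:
  assumes "clin (kop M (signed_coroot \<epsilon> i))" "\<And>m. m \<noteq> 0 \<Longrightarrow> clin (hop M i m)"
  shows "clin (phi t M \<epsilon> i s)"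
proof -
  have S: "clin (series_power (\<lambda>m. hop M i (sgz \<epsilon> * int m)) k s)" for k
    by (rule clin_series_power) (rule assms(2), cases \<epsilon>, auto)
  have "clin (\<lambda>v. \<Sum>k\<le>s. ((of_int (sgz \<epsilon>) * (exp t - inverse (exp t))) ^ k / fact k) *\<^sub>C
          series_power (\<lambda>m. hop M i (sgz \<epsilon> * int m)) k s v)"
    by (rule clin_sum_fun, rule clin_intros(6), rule S)
  from clin_compose[OF assms(1) this] show ?thesis by (simp add: phi_def[abs_def])
qed

section \<open>The explicit module\<close>

lemma neg_vertex_vertex: "neg_vertex n (vertex n x) = vertex n (- x)"
proof -
  have "int (vertex n x) = x mod (int n + 1)" by (simp add: vertex_def)
  then show ?thesis by (simp add: neg_vertex_def vertex_def mod_simps)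
qed

lemma neg_vertex_eq_iff: "i \<le> n \<Longrightarrow> neg_vertex n i = vertex n x \<longleftrightarrow> i = vertex n (- x)"
  using neg_vertex_vertex[of n "int i"] neg_vertex_vertex[of n "- x"] neg_vertex_vertex[of n x]
    neg_vertex_vertex[of n "- int i"]
  by (auto simp: vertex_of_nat)

lemma neg_vertex_le: "neg_vertex n i \<le> n"
  by (simp add: neg_vertex_def vertex_le)

lemma lookup_iota_cartan:
  "Poly_Mapping.lookup (iota_cartan n h) k =
    (if k \<le> n then Poly_Mapping.lookup h (neg_vertex n k)
     else if k = n + 1 then Poly_Mapping.lookup h (n + 1) else 0)"
proof -
  have "(\<Sum>i\<le>n. if k = neg_vertex n i then Poly_Mapping.lookup h i else 0) =
      (if k \<le> n then Poly_Mapping.lookup h (neg_vertex n k) else 0)"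
  proof (cases "k \<le> n")
    case True
    have "k = neg_vertex n i \<longleftrightarrow> i = neg_vertex n k" if "i \<le> n" for i
      using neg_vertex_eq_iff[OF that, of "int k"] True
      by (simp add: vertex_of_nat eq_commute[of k]) (simp add: neg_vertex_def)
    then have "(\<Sum>i\<le>n. if k = neg_vertex n i then Poly_Mapping.lookup h i else 0) =
        (\<Sum>i\<le>n. if i = neg_vertex n k then Poly_Mapping.lookup h i else 0)"
      by (intro sum.cong) auto
    then show ?thesis using True by (simp add: neg_vertex_le)
  next
    case False
    then have "k \<noteq> neg_vertex n i" for i using neg_vertex_le[of n i] by auto
    then show ?thesis using False by simp
  qed
  then show ?thesis
    by (auto simp: iota_cartan_def lookup_add lookup_sum lookup_single_if)
qed

lemma pairing_iota_simple_root:
  assumes "n \<ge> 2"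
  shows "pairing n (simple_root n (vertex n x)) (iota_cartan n h) = pairing n (simple_root n (vertex n (- x))) h"
proof -
  have "vertex n x = 0 \<longleftrightarrow> vertex n (- x) = 0"
    using vertex_eq_iff[of n x 0] vertex_eq_iff[of n "- x" 0] by (simp add: vertex_def)
  moreover have "- (x + 1) = - x - 1" "- (x - 1) = - x + 1" by simp_all
  ultimately show ?thesis
    by (simp only: pairing_simple_root[OF assms vertex_le] lookup_iota_cartan vertex_le neg_vertex_vertex
      vertex_int_vertex vertex_int_vertex_diff if_True) simp
qed

lemma pairing_varpi: "l \<le> n \<Longrightarrow> pairing n (varpi l) h = Poly_Mapping.lookup h l - Poly_Mapping.lookup h 0"
proof -
  assume "l \<le> n"
  have "pairing n (varpi l) h = (\<Sum>k\<le>n+1. (if k = l then Poly_Mapping.lookup h l else 0) -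
      (if k = 0 then Poly_Mapping.lookup h 0 else 0))"
    unfolding pairing_def
    by (rule sum.cong) (auto simp: varpi_def fund_weight_def lookup_minus lookup_single_if simp del: single_one)
  then show ?thesis using \<open>l \<le> n\<close> by (simp add: sum_subtractf)
qed

lemma box_weight_step: "box_weight n (j + 1) = box_weight n j - simple_root n (vertex n j)"
proof -
  consider "j \<ge> 1" | "j = 0" | "j < 0" by linarith
  then show ?thesis
  proof cases
    case 1
    then have "{1..j} = insert j {1..j - 1}" by auto
    then show ?thesis using 1 by (simp add: box_weight_def algebra_simps)
  next
    case 2
    then show ?thesis by (simp add: box_weight_def)
  next
    case 3
    then have "{j..0} = insert j {j + 1..0}" by auto
    then show ?thesis using 3 by (simp add: box_weight_def algebra_simps)
  qed
qed

lemma linear_extension_eq: "linear_extension = pm_extend"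
  by (simp add: fun_eq_iff linear_extension_def pm_extend_def)

lemma pairing_coroot: "i \<le> n \<Longrightarrow> pairing n \<mu> (coroot i) = Poly_Mapping.lookup \<mu> i"
proof -
  assume "i \<le> n"
  have "pairing n \<mu> (coroot i) = (\<Sum>k\<le>n+1. if k = i then Poly_Mapping.lookup \<mu> i else 0)"
    unfolding pairing_def by (rule sum.cong) (auto simp: coroot_def lookup_single_if)
  then show ?thesis using \<open>i \<le> n\<close> by simp
qed

lemma pairing_signed_coroot:
  "i \<le> n \<Longrightarrow> pairing n \<mu> (signed_coroot \<epsilon> i) = of_int (sgz \<epsilon>) * Poly_Mapping.lookup \<mu> i"
proof -
  assume "i \<le> n"
  have "pairing n \<mu> (signed_coroot \<epsilon> i) = (\<Sum>k\<le>n+1. if k = i then of_int (sgz \<epsilon>) * Poly_Mapping.lookup \<mu> i else 0)"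
    unfolding pairing_def by (rule sum.cong) (auto simp: signed_coroot_def lookup_single_if)
  then show ?thesis using \<open>i \<le> n\<close> by simp
qed

lemma signed_coroot_in: "i \<le> n \<Longrightarrow> signed_coroot \<epsilon> i \<in> cartan_space n"
  by (auto simp: cartan_space_def signed_coroot_def)

lemma neg_cartan_space: "h \<in> cartan_space n \<Longrightarrow> - h \<in> cartan_space n"
  by (simp add: cartan_space_def)

lemma add_cartan_space: "h \<in> cartan_space n \<Longrightarrow> h' \<in> cartan_space n \<Longrightarrow> h + h' \<in> cartan_space n"
  using keys_add[of h h'] by (auto simp: cartan_space_def)

lemma pairing_add_right: "pairing n \<mu> (h + h') = pairing n \<mu> h + pairing n \<mu> h'"
  by (simp add: pairing_def lookup_add sum.distrib algebra_simps)

lemma qexp_of_int: "qexp t (of_int m) = exp t powi m"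
  by (simp add: qexp_def exp_power_int mult.commute)

text \<open>The Cartan subalgebra is rational: if a coordinate of the two weights differed by y,
  then 1/y times the matching basis vector would give pairings that differ by 1, forcing q =
  1.\<close>

lemma weight_characters_distinct:
  assumes "exp t \<noteq> 1" "\<mu> \<in> cartan_space n" "\<nu> \<in> cartan_space n"
    "\<And>h. h \<in> cartan_space n \<Longrightarrow> qexp t (pairing n \<mu> h) = qexp t (pairing n \<nu> h)"
  shows "\<mu> = \<nu>"
proof (rule poly_mapping_eqI)
  fix k
  show "Poly_Mapping.lookup \<mu> k = Poly_Mapping.lookup \<nu> k"
  proof (cases "k \<le> n + 1")
    case True
    let ?y = "Poly_Mapping.lookup \<mu> k - Poly_Mapping.lookup \<nu> k"
    define h where "h = Poly_Mapping.single k (1 / ?y)"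
    have P: "pairing n \<rho> h = Poly_Mapping.lookup \<rho> k / ?y" for \<rho>
    proof -
      have "pairing n \<rho> h = (\<Sum>x\<le>n+1. if x = k then Poly_Mapping.lookup \<rho> k / ?y else 0)"
        unfolding pairing_def by (rule sum.cong) (auto simp: h_def lookup_single_if)
      then show ?thesis using True by simp
    qed
    have "h \<in> cartan_space n" using True by (auto simp: h_def cartan_space_def)
    from assms(4)[OF this] have "qexp t (pairing n \<mu> h - pairing n \<nu> h) = 1"
      by (simp add: qexp_diff)
    then have "?y \<noteq> 0 \<Longrightarrow> exp t = 1"
      unfolding P diff_divide_distrib[symmetric] by (simp add: qexp_1)
    then show ?thesis using assms(1) by auto
  next
    case False
    then have "k \<notin> Poly_Mapping.keys \<mu>" "k \<notin> Poly_Mapping.keys \<nu>"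
      using assms(2,3) by (auto simp: cartan_space_def)
    then show ?thesis by (simp add: in_keys_iff)
  qed
qed

lemma vertex_minus_1: "vertex n (- 1) = n"
proof -
  have "vertex n (- 1) = vertex n (int n)"
    unfolding vertex_eq_iff by (auto intro: dvdI[of _ _ "- 1"])
  then show ?thesis by (simp add: vertex_of_nat)
qed

lemma iota_neg_signed_coroot:
  assumes "i \<le> n"
  shows "iota_cartan n (- signed_coroot \<epsilon> i) = - signed_coroot \<epsilon> (neg_vertex n i)"
proof (rule poly_mapping_eqI)
  fix k
  have "i = neg_vertex n k \<longleftrightarrow> k = neg_vertex n i" if "k \<le> n"
    using neg_vertex_eq_iff[OF assms, of "int k"] neg_vertex_eq_iff[OF that, of "int i"] that assms
    by (auto simp: vertex_of_nat neg_vertex_def)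
  then show "Poly_Mapping.lookup (iota_cartan n (- signed_coroot \<epsilon> i)) k =
      Poly_Mapping.lookup (- signed_coroot \<epsilon> (neg_vertex n i)) k"
    using neg_vertex_le[of n i] assms
    by (auto simp: lookup_iota_cartan signed_coroot_def lookup_single_if)
qed

lemma int_line_induct:
  assumes "P (0::int)" "\<And>k. P k \<longleftrightarrow> P (k + 1)"
  shows "P k"
proof (induction k rule: int_induct[of _ 0])
  case base then show ?case by (rule assms(1))
next
  case (step1 i) then show ?case using assms(2) by blast
next
  case (step2 i) then show ?case using assms(2)[of "i - 1"] by simp
qed

text \<open>The colours run through the cyclic diagram upwards if \<open>sg = 1\<close> (the case \<open>l = 1\<close>) and downwards if
  \<open>sg = - 1\<close> (the case \<open>l = n\<close>, that is the twist).  Indices are shifted by one, \<open>bx k\<close> being the box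
  \<open>k + 1\<close>, so that the generating vector has index 0.\<close>

locale loop_line = colored_line n t sg sg a for n :: nat and t :: complex and sg :: int and a :: complex
begin

definition F :: "(int \<Rightarrow>\<^sub>0 complex) qmod" where "F = fund_loop_module n t (color 0) a"

definition bx :: "int \<Rightarrow> (int \<Rightarrow>\<^sub>0 complex)" where "bx k = box (k + 1)"

definition wt :: "int \<Rightarrow> cartan" where
  "wt k = (if k \<ge> 0 then varpi (color 0) - (\<Sum>m = 0..k - 1. simple_root n (color m))
           else varpi (color 0) + (\<Sum>m = k..-1. simple_root n (color m)))"

lemma wt_step: "wt (k + 1) = wt k - simple_root n (color k)"
proof -
  consider "k \<ge> 0" | "k = -1" | "k < -1" by linarith
  then show ?thesis
  proof cases
    case 1
    then have "{0..k} = insert k {0..k - 1}" by auto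
    then show ?thesis using 1 by (simp add: wt_def algebra_simps)
  next
    case 2
    then show ?thesis by (simp add: wt_def)
  next
    case 3
    then have "{k..-1} = insert k {k + 1..-1}" by auto
    then show ?thesis using 3 by (simp add: wt_def algebra_simps)
  qed
qed

lemma color_shift: "color k = vertex n (sg * (k + 1))"
  by (simp add: color_def algebra_simps)

lemma color_m1: "color (-1) = 0"
  by (simp add: color_def vertex_def)

lemma color_0: "color 0 = (if sg = 1 then 1 else n)"
  unfolding color_def using sg n2 vertex_of_nat[of 1 n] by (auto simp: vertex_minus_1)

lemma color_0_pos: "color 0 \<noteq> 0"
  using n2 by (simp add: color_0)

text \<open>The diagram automorphism for l = n and the identity for l = 1, so that both cases share
  one set of formulas.\<close>

definition tw :: "nat \<Rightarrow> nat" where "tw i = (if sg = 1 then i else neg_vertex n i)"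

definition tw_cartan :: "cartan \<Rightarrow> cartan" where
  "tw_cartan h = (if sg = 1 then h else iota_cartan n h)"

lemma tw_eq_iff: "i \<le> n \<Longrightarrow> tw i = vertex n j \<longleftrightarrow> i = color (j - 1)"
  unfolding tw_def color_shift using sg by (elim disjE) (simp_all add: neg_vertex_eq_iff)

lemma F_sel:
  "space F = UNIV"
  "xop F \<epsilon> i r = pm_extend (box_x n t a \<epsilon> (tw i) r)"
  "kop F h = pm_extend (\<lambda>j. qexp t (pairing n (box_weight n j) (tw_cartan h)) *\<^sub>C box j)"
  "hop F i m = log_op t (\<lambda>h. pm_extend (\<lambda>j. qexp t (pairing n (box_weight n j) h) *\<^sub>C box j))
     (\<lambda>\<epsilon> i s. pm_extend (\<lambda>j. fps_nth (box_phi n t a \<epsilon> i j) s *\<^sub>C box j)) (tw i) m"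
proof -
  have "color 0 = 1 \<longleftrightarrow> sg = 1" using n2 by (simp add: color_0)
  then have F: "F = (if sg = 1 then vector_rep n t a else iota_twist n (vector_rep n t a))"
    by (simp add: F_def fund_loop_module_def)
  show "space F = UNIV"
    "xop F \<epsilon> i r = pm_extend (box_x n t a \<epsilon> (tw i) r)"
    "kop F h = pm_extend (\<lambda>j. qexp t (pairing n (box_weight n j) (tw_cartan h)) *\<^sub>C box j)"
    "hop F i m = log_op t (\<lambda>h. pm_extend (\<lambda>j. qexp t (pairing n (box_weight n j) h) *\<^sub>C box j))
     (\<lambda>\<epsilon> i s. pm_extend (\<lambda>j. fps_nth (box_phi n t a \<epsilon> i j) s *\<^sub>C box j)) (tw i) m"
    unfolding F tw_def tw_cartan_def by (simp_all add: vector_rep_def iota_twist_def linear_extension_eq)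
qed

lemma pairing_wt:
  "pairing n (box_weight n (k + 1)) (tw_cartan h) = pairing n (wt k) h"
proof (induction k rule: int_line_induct)
  case 1
  have "neg_vertex n 1 = n" by (simp add: neg_vertex_def vertex_minus_1)
  moreover have "neg_vertex n 0 = 0" by (simp add: neg_vertex_def vertex_def)
  ultimately show ?case
    using n2 by (simp add: box_weight_def wt_def pairing_varpi lookup_iota_cartan color_0 tw_cartan_def)
next
  case (2 k)
  have "pairing n (simple_root n (vertex n (k + 1))) (tw_cartan h) = pairing n (simple_root n (color k)) h"
    unfolding color_shift tw_cartan_def using sg pairing_iota_simple_root[OF n2, of "k + 1" h]
    by (elim disjE) simp_all
  then show ?case
    unfolding wt_step box_weight_step pairing_diff_left by simp
qed

lemma clin_xF: "clin (xop F \<epsilon> i r)"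
  and clin_kF: "clin (kop F h)"
  by (simp_all add: F_sel clin_pm_extend)

lemma xF_pos:
  "i \<le> n \<Longrightarrow> xop F Pos i r (bx k) = (if i = color (k - 1) then c k powi r *\<^sub>C bx (k - 1) else 0)"
  and xF_neg:
  "i \<le> n \<Longrightarrow> xop F Neg i r (bx k) = (if i = color k then c (k + 1) powi r *\<^sub>C bx (k + 1) else 0)"
  by (simp_all add: F_sel bx_def box_def c_def tw_eq_iff)

lemma kF: "kop F h (bx k) = qexp t (pairing n (wt k) h) *\<^sub>C bx k"
  using pairing_wt[of k h] by (simp add: F_sel bx_def box_def)

text \<open>The twist is already absorbed into the colours; \<open>hopF\<close> identifies the
  h_{i,m} of \<open>F\<close> as the logarithm of these operators.\<close>

definition PhiF :: "pm \<Rightarrow> nat \<Rightarrow> nat \<Rightarrow> (int \<Rightarrow>\<^sub>0 complex) \<Rightarrow> (int \<Rightarrow>\<^sub>0 complex)" where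
  "PhiF \<epsilon> i s = pm_extend (\<lambda>j. fps_nth (linephi \<epsilon> i (j - 1)) s *\<^sub>C box j)"

lemma clin_PhiF: "clin (PhiF \<epsilon> i s)"
  by (simp add: PhiF_def clin_pm_extend)

lemma PhiF_bx: "PhiF \<epsilon> i s (bx k) = fps_nth (linephi \<epsilon> i k) s *\<^sub>C bx k"
  by (simp add: PhiF_def bx_def box_def)

lemma linephi_box_phi: "i \<le> n \<Longrightarrow> box_phi n t a \<epsilon> (tw i) j = linephi \<epsilon> i (j - 1)"
  by (simp add: box_phi_def linephi_def tw_eq_iff c_def add.commute[of 1])

lemma hopF:
  assumes "i \<le> n"
  shows "hop F i m = log_op t (kop F) PhiF i m"
proof -
  have "tw_cartan (- signed_coroot \<epsilon> i) = - signed_coroot \<epsilon> (tw i)" for \<epsilon>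
    using iota_neg_signed_coroot[OF assms] by (simp add: tw_def tw_cartan_def)
  then show ?thesis
    unfolding F_sel(4) by (intro log_op_cong) (simp add: F_sel PhiF_def linephi_box_phi[OF assms])
qed

text \<open>Only the values 0, 1 and -1 occur, which is why each S_i later moves a basis vector by
  at most one place.\<close>

lemma lookup_wt:
  assumes "i \<le> n"
  shows "Poly_Mapping.lookup (wt k) i = (if i = color k then 1 else 0) - (if i = color (k - 1) then 1 else 0)"
proof (induction k rule: int_line_induct)
  case 1
  show ?case using color_m1 color_0_pos
    by (auto simp: wt_def varpi_def fund_weight_def lookup_minus lookup_single_if simp del: single_one)
next
  case (2 k)
  have "color (k + 1) \<noteq> color k" "color (k + 1) \<noteq> color (k - 1)" "color k \<noteq> color (k - 1)"
    by (rule color_neq; simp)+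
  then show ?case
    using assms by (auto simp: wt_step lookup_minus lookup_simple_root cartan_matrix_color)
qed

lemma wt_lattice: "wt k \<in> weight_lattice n"
proof -
  have 0: "Poly_Mapping.lookup (wt k) x = 0" if "x > n + 1" for x
  proof (induction k rule: int_line_induct)
    case 1
    show ?case using that color_le[of 0]
      by (auto simp: wt_def varpi_def fund_weight_def lookup_minus lookup_single_if simp del: single_one)
  next
    case (2 k)
    show ?case using that by (simp add: wt_step lookup_minus lookup_simple_root)
  qed
  have "wt k \<in> cartan_space n"
    unfolding cartan_space_def using 0 by (auto simp: in_keys_iff not_less[symmetric])
  then show ?thesis
    by (auto simp: weight_lattice_def pairing_coroot lookup_wt)
qed

lemma linephi_nth_0:
  assumes "i \<le> n"
  shows "fps_nth (linephi \<epsilon> i k) 0 = qexp t (pairing n (wt k) (signed_coroot \<epsilon> i))"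
proof -
  have "color k \<noteq> color (k - 1)" by (rule color_neq; simp)
  then show ?thesis
    by (cases \<epsilon>) (auto simp: pairing_signed_coroot assms lookup_wt linephi_def psi_nth_0 qexp_1 qexp_neg)
qed

lemma phiF:
  assumes "i \<le> n"
  shows "phi t F \<epsilon> i s (bx k) = fps_nth (linephi \<epsilon> i k) s *\<^sub>C bx k"
proof -
  let ?x = "qexp t (pairing n (wt k) (signed_coroot \<epsilon> i))"
  have "phi t F \<epsilon> i s (bx k) = kop F (signed_coroot \<epsilon> i) (fps_nth (fps_const (inverse ?x) * linephi \<epsilon> i k) s *\<^sub>C bx k)"
  proof (rule phi_log_op[where K = "kop F" and \<Phi> = PhiF])
    show "kop F (- signed_coroot \<epsilon> i) (PhiF \<epsilon> i s (bx k)) = fps_nth (fps_const (inverse ?x) * linephi \<epsilon> i k) s *\<^sub>C bx k" for s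
      by (simp add: PhiF_bx clin_scale[OF clin_kF] kF pairing_neg_right qexp_neg scaleC_scaleC mult.commute)
  qed (simp_all add: hopF assms clin_kF clin_PhiF linephi_nth_0 q_diff[simplified])
  then show ?thesis
    by (simp add: clin_scale[OF clin_kF] kF scaleC_scaleC)
qed

lemma clin_hopF: "i \<le> n \<Longrightarrow> clin (hop F i m)"
  unfolding hopF by (rule clin_log_op) (rule clin_kF clin_PhiF)+

lemma clin_phiF: "i \<le> n \<Longrightarrow> clin (phi t F \<epsilon> i s)"
  by (rule clin_phi) (auto simp: clin_kF clin_hopF)

lemma clin_phi_intF: "i \<le> n \<Longrightarrow> clin (phi_int t F \<epsilon> i r)"
  unfolding phi_int_def[abs_def] using clin_phiF by (cases "sgz \<epsilon> * r \<ge> 0") (simp_all add: clin_intros)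

lemma phi_intF: "i \<le> n \<Longrightarrow> phi_int t F \<epsilon> i r (bx k) = coef \<epsilon> (linephi \<epsilon> i k) r *\<^sub>C bx k"
  by (simp add: phi_int_def phiF coef_def)

section \<open>Defining relations of the explicit module\<close>

lemma F_eqI:
  assumes "clin A" "clin B" "\<And>k. A (bx k) = B (bx k)"
  shows "A v = B v"
proof (rule clin_poly_mapping_eqI[OF assms(1,2)])
  fix j show "A (Poly_Mapping.single j 1) = B (Poly_Mapping.single j 1)"
    using assms(3)[of "j - 1"] by (simp add: bx_def box_def)
qed

lemma clin_F_rules:
  "clin g \<Longrightarrow> clin (\<lambda>v. xop F \<epsilon> i r (g v))"
  "clin g \<Longrightarrow> clin (\<lambda>v. kop F h (g v))"
  "i \<le> n \<Longrightarrow> clin g \<Longrightarrow> clin (\<lambda>v. phi_int t F \<epsilon> i r (g v))"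
  using clin_compose clin_xF clin_kF clin_phi_intF by blast+

lemmas F_simps = xF_pos xF_neg kF phi_intF clin_scale[OF clin_xF] clin_scale[OF clin_kF]
  clin_scale[OF clin_phi_intF] clin_zero[OF clin_xF] clin_zero[OF clin_kF] clin_zero[OF clin_phi_intF]

lemmas spaceF = F_sel(1)

text \<open>Successive steps of the line have different colours, and so have steps at distance two,
  because the cycle has at least three vertices. With \<open>xF_aba\<close> this makes every
  monomial of the Serre relations act by zero.\<close>

lemma xF_twice: "i \<le> n \<Longrightarrow> xop F \<sigma> i r (xop F \<sigma> i s v) = 0"
proof (rule F_eqI[where A = "\<lambda>v. xop F \<sigma> i r (xop F \<sigma> i s v)" and B = "\<lambda>v. 0"])
  fix k assume i: "i \<le> n"
  have "color (k + 1) \<noteq> color k" "color (k - 1) \<noteq> color (k - 1 - 1)" by (rule color_neq; simp)+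
  then show "xop F \<sigma> i r (xop F \<sigma> i s (bx k)) = 0"
    using i by (cases \<sigma>) (auto simp: F_simps)
qed (intro clin_F_rules clin_intros)+

lemma xF_aba: "i \<le> n \<Longrightarrow> j \<le> n \<Longrightarrow> xop F \<sigma> i r (xop F \<sigma> j p (xop F \<sigma> i s v)) = 0"
proof (rule F_eqI[where A = "\<lambda>v. xop F \<sigma> i r (xop F \<sigma> j p (xop F \<sigma> i s v))" and B = "\<lambda>v. 0"])
  fix k assume i: "i \<le> n" "j \<le> n"
  have "color (k + 1 + 1) \<noteq> color k" "color (k - 1) \<noteq> color (k - 1 - 1 - 1)" by (rule color_neq; simp)+
  then show "xop F \<sigma> i r (xop F \<sigma> j p (xop F \<sigma> i s (bx k))) = 0"
    using i by (cases \<sigma>) (auto simp: F_simps)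
qed (intro clin_F_rules clin_intros)+

lemma F_k_x:
  assumes "h \<in> cartan_space n" "j \<le> n"
  shows "kop F h (xop F \<sigma> j r (kop F (- h) v)) =
    qexp t (of_int (sgz \<sigma>) * pairing n (simple_root n j) h) *\<^sub>C xop F \<sigma> j r v"
proof (rule F_eqI[where A = "\<lambda>v. kop F h (xop F \<sigma> j r (kop F (- h) v))"])
  fix k
  show "kop F h (xop F \<sigma> j r (kop F (- h) (bx k))) =
    qexp t (of_int (sgz \<sigma>) * pairing n (simple_root n j) h) *\<^sub>C xop F \<sigma> j r (bx k)"
  proof (cases \<sigma>)
    case Pos
    have "wt k = wt (k - 1) - simple_root n (color (k - 1))" using wt_step[of "k - 1"] by simp
    then have "pairing n (wt (k - 1)) h = pairing n (wt k) h + pairing n (simple_root n (color (k - 1))) h"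
      by (simp add: pairing_diff_left)
    then show ?thesis using Pos assms
      by (auto simp: F_simps scaleC_scaleC pairing_neg_right qexp_neg qexp_add)
  next
    case Neg
    have "pairing n (wt (k + 1)) h = pairing n (wt k) h - pairing n (simple_root n (color k)) h"
      by (simp add: pairing_diff_left wt_step)
    then show ?thesis using Neg assms
      by (auto simp: F_simps scaleC_scaleC pairing_neg_right qexp_neg qexp_diff divide_inverse)
  qed
qed (intro clin_F_rules clin_intros)+

text \<open>For lowering modes this is \<open>linephi_step\<close> in coefficients. Raising modes
  run the same step backwards, and multiplication by the inverse coefficient turns one form into the
  other.\<close>

lemma F_phi_x:
  assumes i: "i \<le> n" and j: "j \<le> n"
  defines "Q \<equiv> \<lambda>\<sigma>. q powi (sgz \<sigma> * cartan_matrix n i j)"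
  shows "phi_int t F \<epsilon> i r (xop F \<sigma> j (s - 1) v) - Q \<sigma> *\<^sub>C phi_int t F \<epsilon> i (r - 1) (xop F \<sigma> j s v) =
     Q \<sigma> *\<^sub>C xop F \<sigma> j (s - 1) (phi_int t F \<epsilon> i r v) - xop F \<sigma> j s (phi_int t F \<epsilon> i (r - 1) v)"
proof (rule F_eqI[where A = "\<lambda>v. phi_int t F \<epsilon> i r (xop F \<sigma> j (s - 1) v) - Q \<sigma> *\<^sub>C phi_int t F \<epsilon> i (r - 1) (xop F \<sigma> j s v)"])
  fix k
  let ?E = "\<lambda>k r. coef \<epsilon> (linephi \<epsilon> i k) r"
  have st: "?E (k + 1) r - Q Neg * c (k + 1) * ?E (k + 1) (r - 1) = Q Neg * ?E k r - c (k + 1) * ?E k (r - 1)"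
    if "j = color k" for k
    using coef_recurrence[OF linephi_step[OF i refl], of \<epsilon> k r] that
    by (simp add: Q_def mult_ac)
  have Q: "Q Pos * Q Neg = 1" by (simp add: Q_def flip: power_int_add)
  have p: "c k powi s = c k powi (s - 1) * c k" for k
    using power_int_add[of "c k" "s - 1" 1] by simp
  show "phi_int t F \<epsilon> i r (xop F \<sigma> j (s - 1) (bx k)) - Q \<sigma> *\<^sub>C phi_int t F \<epsilon> i (r - 1) (xop F \<sigma> j s (bx k)) =
     Q \<sigma> *\<^sub>C xop F \<sigma> j (s - 1) (phi_int t F \<epsilon> i r (bx k)) - xop F \<sigma> j s (phi_int t F \<epsilon> i (r - 1) (bx k))"
  proof (cases \<sigma>)
    case Pos
    show ?thesis
    proof (cases "j = color (k - 1)")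
      case True
      have "?E k r - Q Neg * c k * ?E k (r - 1) = Q Neg * ?E (k - 1) r - c k * ?E (k - 1) (r - 1)"
        using st[OF True] by simp
      then have "Q Pos * (?E k r - Q Neg * c k * ?E k (r - 1)) = Q Pos * (Q Neg * ?E (k - 1) r - c k * ?E (k - 1) (r - 1))"
        by simp
      then have "Q Pos * ?E k r - (Q Pos * Q Neg) * c k * ?E k (r - 1) = (Q Pos * Q Neg) * ?E (k - 1) r - Q Pos * c k * ?E (k - 1) (r - 1)"
        by (simp only: right_diff_distrib mult.assoc)
      then have e: "?E (k - 1) r - Q Pos * c k * ?E (k - 1) (r - 1) = Q Pos * ?E k r - c k * ?E k (r - 1)"
        by (simp add: Q)
      have "c k powi (s - 1) * (?E (k - 1) r - Q Pos * c k * ?E (k - 1) (r - 1)) = c k powi (s - 1) * (Q Pos * ?E k r - c k * ?E k (r - 1))"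
        by (simp only: e)
      then show ?thesis
        using Pos True i j
        by (simp add: F_simps scaleC_scaleC p[of k] right_diff_distrib mult_ac flip: cvec.scale_left_diff_distrib)
    qed (use Pos i j in \<open>simp add: F_simps\<close>)
  next
    case Neg
    show ?thesis
    proof (cases "j = color k")
      case True
      let ?c = "c (k + 1)"
      have "?c powi (s - 1) * (?E (k + 1) r - Q Neg * ?c * ?E (k + 1) (r - 1)) = ?c powi (s - 1) * (Q Neg * ?E k r - ?c * ?E k (r - 1))"
        by (simp only: st[OF True])
      then show ?thesis
        using Neg True i j
        by (simp add: F_simps scaleC_scaleC p[of "k + 1"] right_diff_distrib mult_ac flip: cvec.scale_left_diff_distrib)
    qed (use Neg i j in \<open>simp add: F_simps\<close>)
  qed
qed (use i in \<open>intro clin_F_rules clin_intros; assumption\<close>)+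

text \<open>Each of the two products takes a step and retraces it; the two poles in
  \<open>jump_linephi\<close> belong to the step after k and the step before k.\<close>

lemma F_xp_xm:
  assumes "i \<le> n" "j \<le> n"
  shows "xop F Pos i r (xop F Neg j s v) - xop F Neg j s (xop F Pos i r v) =
          (if i = j then inverse (q - inverse q) *\<^sub>C (phi_int t F Pos i (r + s) v - phi_int t F Neg i (r + s) v)
           else 0)"
proof (rule F_eqI[where A = "\<lambda>v. xop F Pos i r (xop F Neg j s v) - xop F Neg j s (xop F Pos i r v)"])
  fix k
  have d: "color k \<noteq> color (k - 1)" by (rule color_neq; simp)
  have "inverse (q - inverse q) *\<^sub>C (phi_int t F Pos i (r + s) (bx k) - phi_int t F Neg i (r + s) (bx k)) =
      (inverse (q - inverse q) * jump (\<lambda>\<epsilon>. linephi \<epsilon> i k) (r + s)) *\<^sub>C bx k"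
    using assms by (simp add: phi_intF jump_def scaleC_scaleC flip: cvec.scale_left_diff_distrib)
  also have "inverse (q - inverse q) * jump (\<lambda>\<epsilon>. linephi \<epsilon> i k) (r + s) =
     (if i = color k then c (k + 1) powi (r + s) else if i = color (k - 1) then - (c k powi (r + s)) else 0)"
  proof -
    have h: "inverse (q - inverse q) * ((q - inverse q) * X) = X" for X
      unfolding mult.assoc[symmetric] left_inverse[OF q_diff] by simp
    have "inverse (q - inverse q) * (- (q - inverse q) * X) = - X" for X
      unfolding mult_minus_left mult_minus_right h ..
    with h show ?thesis
      unfolding jump_linephi by (simp only: mult_zero_right split: if_split) simp
  qed
  finally show "xop F Pos i r (xop F Neg j s (bx k)) - xop F Neg j s (xop F Pos i r (bx k)) =
          (if i = j then inverse (q - inverse q) *\<^sub>C (phi_int t F Pos i (r + s) (bx k) - phi_int t F Neg i (r + s) (bx k))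
           else 0)"
    using assms d by (auto simp: F_simps scaleC_scaleC power_int_add mult.commute)
qed (intro clin_intros(7) clin_intros(6) clin_intros(5) clin_intros(2) clin_F_rules clin_intros(1) assms)+

text \<open>Each side vanishes by itself: consecutive parameters differ by the factor q, which is
  what the coefficient compensates when the two colours follow each other on the line.\<close>

lemma F_x_x:
  assumes i: "i \<le> n" and j: "j \<le> n"
  defines "Q \<equiv> \<lambda>\<sigma>. q powi (sgz \<sigma> * cartan_matrix n i j)"
  shows "xop F \<sigma> i r (xop F \<sigma> j (s - 1) v) - Q \<sigma> *\<^sub>C xop F \<sigma> i (r - 1) (xop F \<sigma> j s v) =
     Q \<sigma> *\<^sub>C xop F \<sigma> j (s - 1) (xop F \<sigma> i r v) - xop F \<sigma> j s (xop F \<sigma> i (r - 1) v)"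
proof (rule F_eqI[where A = "\<lambda>v. xop F \<sigma> i r (xop F \<sigma> j (s - 1) v) - Q \<sigma> *\<^sub>C xop F \<sigma> i (r - 1) (xop F \<sigma> j s v)"])
  fix k
  have p: "c k powi r = c k powi (r - 1) * c k" for k r
    using power_int_add[of "c k" "r - 1" 1] by simp
  have C: "cartan_matrix n (color k) (color k') = - 1" if "k = k' + 1 \<or> k = k' - 1" for k k'
    using color_neq[of k k'] that cartan_matrix_color[OF color_le, of k k'] by auto
  have cs: "c (k + 1) = q * c k" for k using c_shift[of k 1] by simp
  have "c (2 + k) = q * c (k + 1)" using cs[of "k + 1"] by (simp add: add.commute)
  then have p2: "c (2 + k) powi r = c (2 + k) powi (r - 1) * (q * c (k + 1))" for r
    using p[of "2 + k" r] by simp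
  show "xop F \<sigma> i r (xop F \<sigma> j (s - 1) (bx k)) - Q \<sigma> *\<^sub>C xop F \<sigma> i (r - 1) (xop F \<sigma> j s (bx k)) =
     Q \<sigma> *\<^sub>C xop F \<sigma> j (s - 1) (xop F \<sigma> i r (bx k)) - xop F \<sigma> j s (xop F \<sigma> i (r - 1) (bx k))"
  proof (cases \<sigma>)
    case Neg
    have "xop F Neg i r (xop F Neg j (s - 1) (bx k)) = Q Neg *\<^sub>C xop F Neg i (r - 1) (xop F Neg j s (bx k))"
    proof (cases "j = color k \<and> i = color (k + 1)")
      case True
      then have "Q Neg = q" using C[of "k + 1" k] by (simp add: Q_def)
      then show ?thesis using True i j
        by (simp add: F_simps scaleC_scaleC p[of "k + 1" s] p2[of r])
    qed (use i j in \<open>auto simp: F_simps\<close>)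
    moreover have "Q Neg *\<^sub>C xop F Neg j (s - 1) (xop F Neg i r (bx k)) = xop F Neg j s (xop F Neg i (r - 1) (bx k))"
    proof (cases "i = color k \<and> j = color (k + 1)")
      case True
      then have "Q Neg = q" using C[of k "k + 1"] by (simp add: Q_def)
      then show ?thesis using True i j
        by (simp add: F_simps scaleC_scaleC p[of "k + 1" r] p2[of s])
    qed (use i j in \<open>auto simp: F_simps\<close>)
    ultimately show ?thesis using Neg by simp
  next
    case Pos
    have "c k = q * c (k - 1)" using cs[of "k - 1"] by simp
    then have p3: "c k powi r = c k powi (r - 1) * (q * c (k - 1))" for r
      using p[of k r] by simp
    have "xop F Pos i r (xop F Pos j (s - 1) (bx k)) = Q Pos *\<^sub>C xop F Pos i (r - 1) (xop F Pos j s (bx k))"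
    proof (cases "j = color (k - 1) \<and> i = color (k - 1 - 1)")
      case True
      then have "Q Pos = inverse q" using C[of "k - 1 - 1" "k - 1"] by (simp add: Q_def power_int_minus)
      then show ?thesis using True i j
        by (simp add: F_simps scaleC_scaleC p[of "k - 1" r] p3[of s])
    qed (use i j in \<open>auto simp: F_simps\<close>)
    moreover have "Q Pos *\<^sub>C xop F Pos j (s - 1) (xop F Pos i r (bx k)) = xop F Pos j s (xop F Pos i (r - 1) (bx k))"
    proof (cases "i = color (k - 1) \<and> j = color (k - 1 - 1)")
      case True
      then have "Q Pos = inverse q" using C[of "k - 1" "k - 1 - 1"] by (simp add: Q_def power_int_minus)
      then show ?thesis using True i j
        by (simp add: F_simps scaleC_scaleC p[of "k - 1" s] p3[of r])
    qed (use i j in \<open>auto simp: F_simps\<close>)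
    ultimately show ?thesis using Pos by simp
  qed
qed (intro clin_F_rules clin_intros)+

text \<open>Both products vanish, since two successive steps always have adjacent colours.\<close>

lemma F_commute:
  assumes "i \<le> n" "j \<le> n" "i \<noteq> j" "j \<noteq> vertex n (int i + 1)" "j \<noteq> vertex n (int i - 1)"
  shows "xop F \<sigma> i r (xop F \<sigma> j s v) = xop F \<sigma> j s (xop F \<sigma> i r v)"
proof (rule F_eqI[where A = "\<lambda>v. xop F \<sigma> i r (xop F \<sigma> j s v)"])
  fix k
  have C: "cartan_matrix n i j = 0" using assms by (simp add: cartan_matrix_def)
  have "\<not> (i = color k' \<and> j = color (k' + 1))" "\<not> (j = color k' \<and> i = color (k' + 1))" for k'
    using C cartan_matrix_color[OF assms(1), of k'] cartan_matrix_color[OF assms(1), of "k' + 1"]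
      color_neq[of k' "k' + 1"] by (auto split: if_splits)
  from this[of k] this[of "k - 1 - 1"]
  show "xop F \<sigma> i r (xop F \<sigma> j s (bx k)) = xop F \<sigma> j s (xop F \<sigma> i r (bx k))"
    using assms(1,2) by (cases \<sigma>) (auto simp: F_simps)
qed (intro clin_F_rules clin_intros)+

lemma is_qmodule_F: "is_qmodule n t F"
proof -
  have gen: "\<forall>f\<in>generators n F. f ` space F \<subseteq> space F \<and> linear_on_space (space F) f"
    by (auto simp: generators_def spaceF linear_on_UNIV clin_xF clin_kF clin_hopF)
  have kk: "kop F h (kop F h' v) = kop F (h + h') v" for h h' v
    by (rule F_eqI[where A = "\<lambda>v. kop F h (kop F h' v)"])
      (auto intro!: clin_F_rules clin_intros simp: F_simps scaleC_scaleC pairing_add_right qexp_add mult.commute)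
  have k0: "kop F 0 v = v" for v
    by (rule F_eqI[where A = "\<lambda>v. kop F 0 v"])
      (auto intro!: clin_F_rules clin_intros simp: F_simps pairing_def scaleC_one)
  have kp: "kop F h (phi_int t F \<epsilon> i r v) = phi_int t F \<epsilon> i r (kop F h v)" if "i \<le> n" for h \<epsilon> i r v
    by (rule F_eqI[where A = "\<lambda>v. kop F h (phi_int t F \<epsilon> i r v)"])
      (use that in \<open>auto intro!: clin_F_rules clin_intros simp: F_simps scaleC_scaleC mult.commute\<close>)
  have pp: "phi_int t F \<epsilon> i r (phi_int t F \<epsilon>' j s v) = phi_int t F \<epsilon>' j s (phi_int t F \<epsilon> i r v)"
    if "i \<le> n" "j \<le> n" for \<epsilon> \<epsilon>' i j r s v
    by (rule F_eqI[where A = "\<lambda>v. phi_int t F \<epsilon> i r (phi_int t F \<epsilon>' j s v)"])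
      (use that in \<open>auto intro!: clin_F_rules clin_intros simp: F_simps scaleC_scaleC mult.commute\<close>)
  show ?thesis
    unfolding is_qmodule_def Let_def
  proof (intro conjI ballI allI impI)
    show "cvec.subspace (space F)" by (simp add: spaceF cvec.subspace_UNIV)
  qed (use gen in \<open>auto simp: kk k0 kp pp F_k_x F_phi_x F_xp_xm F_x_x xF_twice xF_aba clin_zero[OF clin_xF]
        intro: F_commute\<close>)
qed

section \<open>Integrability\<close>

lemma q_not_1: "q \<noteq> 1"
  using not_root[of 1] by simp

lemma lattice_cartan: "\<mu> \<in> weight_lattice n \<Longrightarrow> \<mu> \<in> cartan_space n"
  by (simp add: weight_lattice_def)

lemma lookup_bx: "Poly_Mapping.lookup (bx k) (k' + 1) = (if k' = k then 1 else 0)"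
  by (simp add: bx_def box_def lookup_single_if)

lemma bx_weight: "bx k \<in> weight_space n t F (wt k)"
  by (simp add: weight_space_def spaceF kF)

lemma clin_lookup: "clin (\<lambda>v :: int \<Rightarrow>\<^sub>0 complex. Poly_Mapping.lookup v j)"
  by (simp add: clin_iff lookup_add scaleC_poly_mapping.rep_eq)

lemma lookup_kF: "Poly_Mapping.lookup (kop F h v) (k + 1) = qexp t (pairing n (wt k) h) * Poly_Mapping.lookup v (k + 1)"
proof (rule F_eqI[where A = "\<lambda>v. Poly_Mapping.lookup (kop F h v) (k + 1)"
      and B = "\<lambda>v. qexp t (pairing n (wt k) h) * Poly_Mapping.lookup v (k + 1)"])
  show "clin (\<lambda>v. Poly_Mapping.lookup (kop F h v) (k + 1))"
    by (rule clin_compose[OF clin_lookup clin_kF])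
  show "clin (\<lambda>v. qexp t (pairing n (wt k) h) * Poly_Mapping.lookup v (k + 1))"
    using clin_intros(6)[OF clin_lookup] by (simp add: scaleC_complex_def)
qed (simp add: kF scaleC_poly_mapping.rep_eq scaleC_complex_def lookup_bx)

lemma weight_unique:
  assumes "v \<in> weight_space n t F \<mu>" "\<mu> \<in> weight_lattice n" "Poly_Mapping.lookup v (k + 1) \<noteq> 0"
  shows "\<mu> = wt k"
proof (rule weight_characters_distinct[OF q_not_1])
  show "\<mu> \<in> cartan_space n" "wt k \<in> cartan_space n"
    using assms wt_lattice by (simp_all add: lattice_cartan)
  fix h assume "h \<in> cartan_space n"
  then have "kop F h v = qexp t (pairing n \<mu> h) *\<^sub>C v"
    using assms by (simp add: weight_space_def)
  then have "qexp t (pairing n \<mu> h) * Poly_Mapping.lookup v (k + 1) = qexp t (pairing n (wt k) h) * Poly_Mapping.lookup v (k + 1)"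
    using lookup_kF[of h v k] by (simp add: scaleC_poly_mapping.rep_eq scaleC_complex_def)
  then show "qexp t (pairing n \<mu> h) = qexp t (pairing n (wt k) h)" using assms by simp
qed

lemma span_bx:
  assumes "\<And>k. Poly_Mapping.lookup v (k + 1) \<noteq> 0 \<Longrightarrow> bx k \<in> S"
  shows "v \<in> cvec.span S"
proof -
  have "Poly_Mapping.single j 1 \<in> S" if "j \<in> Poly_Mapping.keys v" for j
    using assms[of "j - 1"] that by (simp add: bx_def box_def in_keys_iff)
  then show ?thesis
    by (subst poly_mapping_sum_single)
      (auto intro!: cvec.span_sum cvec.span_scale intro: cvec.span_base)
qed

lemma integrable_F: "integrable n t F"
  unfolding integrable_def
proof (intro conjI ballI allI impI)
  show "is_qmodule n t F" by (rule is_qmodule_F)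
  have "v \<in> cvec.span (\<Union>\<mu>\<in>weight_lattice n. weight_space n t F \<mu>)" for v
    by (rule span_bx) (use wt_lattice bx_weight in blast)
  then show "space F = cvec.span (\<Union>\<mu>\<in>weight_lattice n. weight_space n t F \<mu>)"
    by (auto simp: spaceF)
next
  fix \<mu> assume \<mu>: "\<mu> \<in> weight_lattice n"
  let ?U = "\<Union>\<nu>\<in>weight_lattice n - {\<mu>}. weight_space n t F \<nu>"
  have "v = 0" if v: "v \<in> weight_space n t F \<mu>" "v \<in> cvec.span ?U" for v
  proof (rule poly_mapping_eqI)
    fix j
    show "Poly_Mapping.lookup v j = Poly_Mapping.lookup 0 j"
    proof (cases "\<mu> = wt (j - 1)")
      case False
      then show ?thesis using weight_unique[OF v(1) \<mu>, of "j - 1"] by auto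
    next
      case True
      have "Poly_Mapping.lookup v j = 0"
        using v(2)
      proof (rule cvec.span_induct)
        show "cvec.subspace {v. Poly_Mapping.lookup v j = 0}"
          by (auto simp: cvec.subspace_def lookup_add scaleC_poly_mapping.rep_eq)
        fix w assume "w \<in> ?U"
        then obtain \<nu> where "\<nu> \<in> weight_lattice n" "\<nu> \<noteq> \<mu>" "w \<in> weight_space n t F \<nu>" by auto
        then show "Poly_Mapping.lookup w j = 0" using weight_unique[of w \<nu> "j - 1"] True by auto
      qed
      then show ?thesis by simp
    qed
  qed
  moreover have "0 \<in> weight_space n t F \<mu>"
    by (simp add: weight_space_def spaceF clin_zero[OF clin_kF])
  ultimately show "weight_space n t F \<mu> \<inter> cvec.span ?U = {0}"
    using cvec.span_zero by blast
next
  fix \<epsilon> i v assume "i \<le> n"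
  then have "(xop F \<epsilon> i 0 ^^ 2) v = 0" by (simp add: numeral_2_eq_2 xF_twice)
  then show "\<exists>p. (xop F \<epsilon> i 0 ^^ p) v = 0" ..
qed

section \<open>Extremality of the generating vector\<close>

lemma S_op_bx:
  assumes "i \<le> n"
  shows "S_op n t F (wt k) i (bx k) \<in> range bx"
proof -
  have d: "color k \<noteq> color (k - 1)" by (rule color_neq; simp)
  have q1: "qfact t 1 = 1" "qfact t 0 = 1"
    using q_diff by (simp_all add: qfact_def qint_def power_int_minus)
  have p: "pairing n (wt k) (coroot i) = (if i = color k then 1 else if i = color (k - 1) then - 1 else 0)"
    using d by (simp add: pairing_coroot assms lookup_wt)
  have fl: "\<lfloor>- 1 :: rat\<rfloor> = - 1" using floor_of_int[of "- 1", where 'a = rat] by (simp only: of_int_minus of_int_1)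
  consider "i = color k" | "i = color (k - 1)" "i \<noteq> color k" | "i \<noteq> color k" "i \<noteq> color (k - 1)" by blast
  then show ?thesis
  proof cases
    case 1
    then have "S_op n t F (wt k) i (bx k) = bx (k + 1)"
      unfolding S_op_def p using q1 assms by (simp add: xF_neg)
    then show ?thesis by simp
  next
    case 2
    then have "S_op n t F (wt k) i (bx k) = bx (k - 1)"
      unfolding S_op_def p using q1 assms fl by (simp add: xF_pos Let_def)
    then show ?thesis by simp
  next
    case 3
    then have "S_op n t F (wt k) i (bx k) = bx k"
      unfolding S_op_def p using q1 by simp
    then show ?thesis by simp
  qed
qed

text \<open>The orbit stays among the basis vectors, and their weights are unique, so the choice of
  weight in \<open>S_orbit\<close> is unambiguous. A basis vector is i-extremal because the steps
  before and after it have different colours.\<close>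

lemma extremal_bx: "extremal n t F (bx 0)"
proof -
  have u: "\<mu> = wt k" if "\<mu> \<in> weight_lattice n" "bx k \<in> weight_space n t F \<mu>" for \<mu> k
    by (rule weight_unique[OF that(2,1)]) (simp add: lookup_bx)
  have orbit: "w \<in> range bx" if "w \<in> S_orbit n t F (bx 0)" for w
    using that
  proof induction
    case start then show ?case by simp
  next
    case (step w \<mu> i)
    then obtain k where "w = bx k" by auto
    moreover from this have "\<mu> = wt k" using step u by blast
    ultimately show ?case using S_op_bx[OF step.hyps(4), of k] by simp
  qed
  have "i_extremal n F (wt k) i (bx k)" if "i \<le> n" for k i
  proof -
    have "color k \<noteq> color (k - 1)" by (rule color_neq; simp)
    then show ?thesis
      using that by (auto simp: i_extremal_def pairing_coroot lookup_wt xF_pos xF_neg)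
  qed
  then show ?thesis
    unfolding extremal_def using orbit u wt_lattice bx_weight by fastforce
qed

section \<open>Monomial and l-weight of the generating vector\<close>

lemma monomial_top:
  "is_monomial n (varpi (color 0), \<lambda>i c. Ymon (color 0) a i c - Ymon 0 (a * q) i c)"
proof -
  have s: "{c. Ymon (color 0) a i c - Ymon 0 (a * q) i c \<noteq> 0} =
      (if i = color 0 then {a} else if i = 0 then {a * q} else {})" for i
    using color_0_pos by (auto simp: Ymon_def)
  have "wt 0 = varpi (color 0)" by (simp add: wt_def)
  then have l: "varpi (color 0) \<in> weight_lattice n"
    and k: "Poly_Mapping.lookup (varpi (color 0)) i = (if i = color 0 then 1 else 0) - (if i = 0 then 1 else 0)"
    if "i \<le> n" for i
    using wt_lattice[of 0] lookup_wt[OF that, of 0] color_m1 by simp_all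
  show ?thesis
    unfolding is_monomial_def prod.case s
    using l[of 0] a0 color_0_pos by (auto simp: pairing_coroot k) (auto simp: Ymon_def)
qed

lemma monomial_series_top:
  assumes "i \<le> n"
  shows "monomial_series t (\<lambda>i c. Ymon (color 0) a i c - Ymon 0 (a * q) i c) \<epsilon> i = linephi \<epsilon> i 0"
proof -
  have s: "{c. Ymon (color 0) a i c - Ymon 0 (a * q) i c \<noteq> 0} =
      (if i = color 0 then {a} else if i = 0 then {a * q} else {})"
    using color_0_pos by (auto simp: Ymon_def)
  \<comment> \<open>A factor Y at parameter b contributes psi at b q; the two parameters a and a q
    thus become \<open>c 1\<close> and \<open>c 2\<close>.\<close>
  have "c 1 = a * q" "c 2 = a * q * q" by (simp_all add: c_def power2_eq_square)
  then show ?thesis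
    unfolding monomial_series_def s linephi_def using color_m1 color_0_pos
    by (auto simp: Ymon_def power_int_minus)
qed

lemma lweight_top:
  "bx 0 \<in> lweight_space n t F (varpi (color 0), \<lambda>i c. Ymon (color 0) a i c - Ymon 0 (a * q) i c)"
proof -
  have "wt 0 = varpi (color 0)" by (simp add: wt_def)
  then have "bx 0 \<in> weight_space n t F (varpi (color 0))" using bx_weight[of 0] by simp
  moreover have "((\<lambda>w. phi t F \<epsilon> i s w - fps_nth (monomial_series t (\<lambda>i c. Ymon (color 0) a i c - Ymon 0 (a * q) i c) \<epsilon> i) s *\<^sub>C w) ^^ 1) (bx 0) = 0"
    if "i \<le> n" for \<epsilon> i s
    using that by (simp add: monomial_series_top phiF)
  ultimately show ?thesis unfolding lweight_space_def by blast
qed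

lemma cyclic_F: "cyclic_span (generators n F) (bx 0) = space F"
proof -
  have "v \<in> N" if N: "cvec.subspace N" "bx 0 \<in> N" "\<forall>f\<in>generators n F. f ` N \<subseteq> N" for N v
  proof -
    have x: "xop F \<epsilon> i r w \<in> N" if "w \<in> N" "i \<le> n" for \<epsilon> i r w
    proof -
      have "xop F \<epsilon> i r \<in> generators n F" using that by (auto simp: generators_def)
      then show ?thesis using N(3) that by blast
    qed
    have "bx k \<in> N" for k
    proof (induction k rule: int_line_induct)
      case 1 then show ?case by (rule N(2))
    next
      case (2 k)
      have "xop F Neg (color k) 0 (bx k) = bx (k + 1)" "xop F Pos (color k) 0 (bx (k + 1)) = bx k"
        by (simp_all add: xF_neg xF_pos color_le)
      then show ?case using x color_le by metis
    qed
    then have "v \<in> cvec.span N" by (intro span_bx) simp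
    then show ?thesis using N(1) by (metis cvec.span_eq_iff)
  qed
  then show ?thesis by (auto simp: cyclic_span_def spaceF)
qed

section \<open>Finiteness over the vertical subalgebras\<close>

lemma color_surj:
  assumes "j \<le> n"
  shows "\<exists>k \<ge> b. color k = j" "\<exists>k \<le> b. color k = j"
proof -
  \<comment> \<open>Solves sg + sg * m = j because sg * sg = 1. Adding multiples of the period n + 1
    then reaches either side of b.\<close>
  define m where "m = sg * (int j - sg)"
  have "sg * sg = 1" using sg by auto
  then have "sg + sg * m = int j" by (simp add: m_def flip: mult.assoc)
  then have m: "color m = j" using assms by (simp add: color_def vertex_of_nat)
  have p: "color (m + (int n + 1) * y) = j" for y
    using m color_eq_iff[of "m + (int n + 1) * y" m] by simp
  have "(int n + 1) * \<bar>b - m\<bar> \<ge> \<bar>b - m\<bar>" by (simp add: algebra_simps)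
  then have "m + (int n + 1) * \<bar>b - m\<bar> \<ge> b" "m + (int n + 1) * (- \<bar>b - m\<bar>) \<le> b" by auto
  then show "\<exists>k \<ge> b. color k = j" "\<exists>k \<le> b. color k = j" using p by blast+
qed

text \<open>Steps of colour j act as walls. Without that colour no generator leads from
  \<open>lo + 1\<close> down to \<open>lo\<close> or from \<open>hi\<close> up to
  \<open>hi + 1\<close>, so the finitely many basis vectors in between span a stable space.\<close>

lemma vertical_finite:
  assumes "j \<le> n"
  shows "finite_dimensional (cyclic_span (vertical_generators n j F) w)"
proof -
  obtain b where b: "\<And>k. Poly_Mapping.lookup w (k + 1) \<noteq> 0 \<Longrightarrow> \<bar>k\<bar> \<le> b"
  proof
    fix k assume "Poly_Mapping.lookup w (k + 1) \<noteq> 0"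
    then have "k + 1 \<in> Poly_Mapping.keys w" by (simp add: in_keys_iff)
    then have "\<bar>k\<bar> \<le> Max ((\<lambda>j. \<bar>j - 1\<bar>) ` Poly_Mapping.keys w)"
      by (intro Max_ge finite_imageI) (auto intro!: image_eqI[of _ _ "k + 1"])
    then show "\<bar>k\<bar> \<le> Max ((\<lambda>j. \<bar>j - 1\<bar>) ` Poly_Mapping.keys w)" .
  qed
  obtain hi where hi: "hi \<ge> b" "color hi = j" using color_surj(1)[OF assms] by blast
  \<comment> \<open>One below - b, because \<open>lo\<close> itself lies outside the interval that
    has to contain the support of w.\<close>
  obtain lo where lo: "lo \<le> - b - 1" "color lo = j" using color_surj(2)[OF assms] by blast
  define B where "B = bx ` {lo + 1..hi}"
  have stable: "f v \<in> cvec.span B" if f: "clin f" "\<And>k. lo < k \<Longrightarrow> k \<le> hi \<Longrightarrow> f (bx k) \<in> cvec.span B"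
    and v: "v \<in> cvec.span B" for f v
    using v
  proof (rule cvec.span_induct)
    show "cvec.subspace {v. f v \<in> cvec.span B}"
      using f(1) by (auto simp: cvec.subspace_def clin_zero clin_add clin_scale cvec.span_zero
          cvec.span_add cvec.span_scale)
    show "f v \<in> cvec.span B" if "v \<in> B" for v
      using that f(2) by (auto simp: B_def)
  qed
  have diag: "z *\<^sub>C bx k \<in> cvec.span B" if "lo < k" "k \<le> hi" for k z
    using that by (intro cvec.span_scale cvec.span_base) (auto simp: B_def)
  have xn: "xop F \<epsilon> i r (bx k) \<in> cvec.span B" if "i \<le> n" "i \<noteq> j" "lo < k" "k \<le> hi" for \<epsilon> i r k
  proof (cases \<epsilon>)
    case Pos
    have "k - 1 \<noteq> lo" if "i = color (k - 1)" using that lo \<open>i \<noteq> j\<close> by auto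
    then show ?thesis using that Pos by (auto simp: xF_pos cvec.span_zero intro!: diag)
  next
    case Neg
    have "k \<noteq> hi" if "i = color k" using that hi \<open>i \<noteq> j\<close> by auto
    then show ?thesis using that Neg by (auto simp: xF_neg cvec.span_zero intro!: diag)
  qed
  have hn: "hop F i m (bx k) \<in> cvec.span B" if "i \<le> n" "m \<noteq> 0" "lo < k" "k \<le> hi" for i m k
  proof -
    let ?e = "if m > 0 then Pos else Neg"
    let ?x = "qexp t (pairing n (wt k) (signed_coroot ?e i))"
    have "m = sgz ?e * int (nat \<bar>m\<bar>)" by auto
    moreover have "\<exists>z. log_op t (kop F) PhiF i (sgz ?e * int (nat \<bar>m\<bar>)) (bx k) = z *\<^sub>C bx k"
    proof (intro exI, rule log_op_diagonal[where B = "fps_const (inverse ?x) * linephi ?e i k"])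
      show "clin (kop F (- signed_coroot ?e i) \<circ> PhiF ?e i s)" for s
        using clin_compose[OF clin_kF clin_PhiF] by (simp add: o_def)
    qed (use that in \<open>simp_all add: PhiF_bx clin_scale[OF clin_kF] kF pairing_neg_right qexp_neg
        mult.commute linephi_nth_0\<close>)
    ultimately show ?thesis using that diag by (metis hopF)
  qed
  have "w \<in> cvec.span B"
  proof (rule span_bx)
    fix k assume "Poly_Mapping.lookup w (k + 1) \<noteq> 0"
    then have "k \<in> {lo + 1..hi}" using b[of k] hi lo by auto
    then show "bx k \<in> B" by (simp add: B_def)
  qed
  moreover have "f v \<in> cvec.span B" if "f \<in> vertical_generators n j F" "v \<in> cvec.span B" for f v
  proof -
    consider \<epsilon> i r where "f = xop F \<epsilon> i r" "i \<le> n" "i \<noteq> j" | i m where "f = hop F i m" "i \<le> n" "m \<noteq> 0"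
      | h where "f = kop F h"
      using \<open>f \<in> _\<close> unfolding vertical_generators_def by blast
    then show ?thesis
    proof cases
      case 1
      show ?thesis unfolding 1(1) by (rule stable[OF clin_xF xn that(2)]) (use 1 in auto)
    next
      case 2
      show ?thesis unfolding 2(1) by (rule stable[OF clin_hopF hn that(2)]) (use 2 in auto)
    next
      case 3
      show ?thesis unfolding 3 by (rule stable[OF clin_kF _ that(2)]) (simp add: kF diag)
    qed
  qed
  ultimately have "cyclic_span (vertical_generators n j F) w \<subseteq> cvec.span B"
    unfolding cyclic_span_def by (intro Inter_lower) (auto intro: cvec.subspace_span)
  then show ?thesis
    unfolding finite_dimensional_def by (intro exI[of _ B]) (simp add: B_def)
qed

lemma extremal_loop_weight_F:
  "extremal_loop_weight_module n t
     (varpi (color 0), \<lambda>i c. Ymon (color 0) a i c - Ymon 0 (a * q) i c) F"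
  unfolding extremal_loop_weight_module_def
  using monomial_top integrable_F lweight_top cyclic_F extremal_bx vertical_finite by blast

end

section \<open>Transport of structure along an intertwiner\<close>

lemma cyclic_span_image_subset:
  assumes g: "clin g" and G: "\<And>f'. f' \<in> G' \<Longrightarrow> \<exists>f\<in>G. \<forall>v. f' (g v) = g (f v)"
  shows "cyclic_span G' (g v) \<subseteq> g ` cyclic_span G v"
proof -
  have sub: "cvec.subspace (cyclic_span G v)"
    unfolding cyclic_span_def by (rule cvec.subspace_Inter) auto
  have st: "f ` cyclic_span G v \<subseteq> cyclic_span G v" if "f \<in> G" for f
    using that unfolding cyclic_span_def by blast
  have "cvec.subspace (g ` cyclic_span G v)"
    by (rule cpair.linear_subspace_image[OF g sub])
  moreover have "g v \<in> g ` cyclic_span G v"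
    unfolding cyclic_span_def by blast
  moreover have "f' ` g ` cyclic_span G v \<subseteq> g ` cyclic_span G v" if "f' \<in> G'" for f'
    using G[OF that] st by fastforce
  ultimately show ?thesis
    unfolding cyclic_span_def[of G'] by (intro Inter_lower) auto
qed

lemma cyclic_span_image_superset:
  assumes g: "clin g" and G: "\<And>f. f \<in> G \<Longrightarrow> \<exists>f'\<in>G'. \<forall>v. f' (g v) = g (f v)"
  shows "g ` cyclic_span G v \<subseteq> cyclic_span G' (g v)"
proof -
  have "g w \<in> N" if N: "cvec.subspace N" "g v \<in> N" "\<forall>f'\<in>G'. f' ` N \<subseteq> N" and w: "w \<in> cyclic_span G v" for N w
  proof -
    have "cvec.subspace (g -` N)"
      using cpair.linear_subspace_vimage[OF g N(1)] .
    moreover have "f ` (g -` N) \<subseteq> g -` N" if "f \<in> G" for f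
      using G[OF that] N(3) by fastforce
    ultimately have "cyclic_span G v \<subseteq> g -` N"
      unfolding cyclic_span_def using N(2) by (intro Inter_lower) auto
    then show ?thesis using w by auto
  qed
  then show ?thesis unfolding cyclic_span_def[of G'] by blast
qed

lemma series_power_intertwine:
  assumes "clin g" "\<And>s v. s \<ge> 1 \<Longrightarrow> A' s (g v) = g (A s v)"
  shows "series_power A' k m (g v) = g (series_power A k m v)"
  by (induction k arbitrary: m) (auto simp: clin_zero assms clin_sum)

text \<open>Operators are compared on the range of \<open>g\<close> only, which is where the
  deformed operators of the tensor product are known.\<close>

locale intertwiner =
  fixes n :: nat and t :: complex and M :: "('a::complex_vector) qmod"
    and M' :: "('b::complex_vector) qmod" and g :: "'a \<Rightarrow> 'b"
  assumes g: "clin g" and x: "i \<le> n \<Longrightarrow> xop M' \<epsilon> i r (g v) = g (xop M \<epsilon> i r v)"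
    and k: "h \<in> cartan_space n \<Longrightarrow> kop M' h (g v) = g (kop M h v)"
    and hm: "i \<le> n \<Longrightarrow> m \<noteq> 0 \<Longrightarrow> hop M' i m (g v) = g (hop M i m v)"
begin

lemma generators_cyclic: "cyclic_span (generators n M') (g v) = g ` cyclic_span (generators n M) v"
proof
  show "cyclic_span (generators n M') (g v) \<subseteq> g ` cyclic_span (generators n M) v"
  proof (rule cyclic_span_image_subset[OF g])
    fix f' assume "f' \<in> generators n M'"
    then show "\<exists>f\<in>generators n M. \<forall>v. f' (g v) = g (f v)"
      unfolding generators_def using x k hm by blast
  qed
  show "g ` cyclic_span (generators n M) v \<subseteq> cyclic_span (generators n M') (g v)"
  proof (rule cyclic_span_image_superset[OF g])
    fix f assume "f \<in> generators n M"
    then show "\<exists>f'\<in>generators n M'. \<forall>v. f' (g v) = g (f v)"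
      unfolding generators_def using x k hm by blast
  qed
qed

lemma vertical_cyclic:
  "cyclic_span (vertical_generators n j M') (g v) \<subseteq> g ` cyclic_span (vertical_generators n j M) v"
proof (rule cyclic_span_image_subset[OF g])
  have "h \<in> cartan_space n" if "Poly_Mapping.keys h \<subseteq> {..n} - {j}" for h :: cartan
    using that by (force simp: cartan_space_def)
  then show "\<exists>f\<in>vertical_generators n j M. \<forall>v. f' (g v) = g (f v)" if "f' \<in> vertical_generators n j M'" for f'
    using that unfolding vertical_generators_def using x k hm by blast
qed

lemma phi: "i \<le> n \<Longrightarrow> phi t M' \<epsilon> i s (g v) = g (phi t M \<epsilon> i s v)"
proof -
  assume i: "i \<le> n"
  have S: "series_power (\<lambda>m. hop M' i (sgz \<epsilon> * int m)) k s (g v) =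
      g (series_power (\<lambda>m. hop M i (sgz \<epsilon> * int m)) k s v)" for k
    by (rule series_power_intertwine[OF g]) (rule hm[OF i], cases \<epsilon>, auto)
  show ?thesis
    unfolding phi_def S clin_scale[OF g, symmetric] clin_sum[OF g, symmetric]
      k[OF signed_coroot_in[OF i]] ..
qed

lemma phi_int: "i \<le> n \<Longrightarrow> phi_int t M' \<epsilon> i r (g v) = g (phi_int t M \<epsilon> i r v)"
  by (simp add: phi_int_def phi clin_zero[OF g])

text \<open>Every relation at g w is the image under \<open>g\<close> of the relation at w.\<close>

lemma is_qmodule_image:
  assumes M: "is_qmodule n t M" "space M = UNIV" "space M' = range g"
  shows "is_qmodule n t M'"
proof -
  note gs = x k phi_int clin_diff[OF g, symmetric] clin_add[OF g, symmetric] clin_scale[OF g, symmetric]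
  have lin: "clin f" if "f \<in> generators n M" for f
    using M that by (auto simp: is_qmodule_def Let_def linear_on_UNIV)
  have G: "f' ` range g \<subseteq> range g \<and> linear_on_space (range g) f'" if f': "f' \<in> generators n M'" for f'
  proof -
    have "\<exists>f\<in>generators n M. \<forall>v. f' (g v) = g (f v)"
      using f' unfolding generators_def using x k hm by blast
    then obtain f where f: "f \<in> generators n M" "\<And>v. f' (g v) = g (f v)" by blast
    have "f' (g v + g w) = f' (g v) + f' (g w)" "f' (c *\<^sub>C g v) = c *\<^sub>C f' (g v)" for v w c
      by (simp_all only: f(2) clin_add[OF g, symmetric] clin_scale[OF g, symmetric]
          clin_add[OF lin[OF f(1)]] clin_scale[OF lin[OF f(1)]])
    then show ?thesis by (auto simp: linear_on_space_def f(2))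
  qed
  \<comment> \<open>The relations at an arbitrary vector; \<open>R\<close> splits them into the ten
    conjuncts of \<open>is_qmodule\<close>.\<close>
  note A = bspec[OF conjunct2[OF conjunct2[OF M(1)[unfolded is_qmodule_def Let_def M(2)]]] UNIV_I]
  note R = A[THEN conjunct1]
    A[THEN conjunct2, THEN conjunct1]
    A[THEN conjunct2, THEN conjunct2, THEN conjunct1]
    A[THEN conjunct2, THEN conjunct2, THEN conjunct2, THEN conjunct1]
    A[THEN conjunct2, THEN conjunct2, THEN conjunct2, THEN conjunct2, THEN conjunct1]
    A[THEN conjunct2, THEN conjunct2, THEN conjunct2, THEN conjunct2, THEN conjunct2, THEN conjunct1]
    A[THEN conjunct2, THEN conjunct2, THEN conjunct2, THEN conjunct2, THEN conjunct2, THEN conjunct2, THEN conjunct1]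
    A[THEN conjunct2, THEN conjunct2, THEN conjunct2, THEN conjunct2, THEN conjunct2, THEN conjunct2, THEN conjunct2, THEN conjunct1]
    A[THEN conjunct2, THEN conjunct2, THEN conjunct2, THEN conjunct2, THEN conjunct2, THEN conjunct2, THEN conjunct2, THEN conjunct2, THEN conjunct1]
    A[THEN conjunct2, THEN conjunct2, THEN conjunct2, THEN conjunct2, THEN conjunct2, THEN conjunct2, THEN conjunct2, THEN conjunct2, THEN conjunct2]
  show ?thesis
    unfolding is_qmodule_def Let_def M(3)
  proof (intro conjI ballI allI impI)
    show "cvec.subspace (range g)"
      using cpair.linear_subspace_image[OF g cvec.subspace_UNIV] .
  next
    fix f' assume "f' \<in> generators n M'"
    then show "f' ` range g \<subseteq> range g" "linear_on_space (range g) f'" using G by auto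
  next
    fix v h h' assume v: "v \<in> range g" and asm: "h \<in> cartan_space n" "h' \<in> cartan_space n"
    obtain w where w: "v = g w" using v by auto
    show "kop M' h (kop M' h' v) = kop M' (h + h') v"
      using R(1)[of w] asm unfolding w by (auto simp: k add_cartan_space)
  next
    fix v assume v: "v \<in> range g"
    have asm: "0 \<in> cartan_space n" by (simp add: cartan_space_def)
    obtain w where w: "v = g w" using v by auto
    show "kop M' 0 v = v" using R(2)[of w] asm unfolding w by (auto simp: k)
  next
    fix v h \<epsilon> i r assume v: "v \<in> range g" and asm: "h \<in> cartan_space n" "i \<le> n"
    obtain w where w: "v = g w" using v by auto
    show "kop M' h (phi_int t M' \<epsilon> i r v) = phi_int t M' \<epsilon> i r (kop M' h v)"
      using R(3)[of w] asm unfolding w by (auto simp: gs)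
  next
    fix v \<epsilon> \<epsilon>' i j r s assume v: "v \<in> range g" and asm: "i \<le> n" "j \<le> n"
    obtain w where w: "v = g w" using v by auto
    show "phi_int t M' \<epsilon> i r (phi_int t M' \<epsilon>' j s v) = phi_int t M' \<epsilon>' j s (phi_int t M' \<epsilon> i r v)"
      using R(4)[of w] asm unfolding w by (auto simp: gs)
  next
    fix v h \<sigma> j r assume v: "v \<in> range g" and asm: "h \<in> cartan_space n" "j \<le> n"
    obtain w where w: "v = g w" using v by auto
    show "kop M' h (xop M' \<sigma> j r (kop M' (- h) v)) =
            qexp t (of_int (sgz \<sigma>) * pairing n (simple_root n j) h) *\<^sub>C xop M' \<sigma> j r v"
      using R(5)[of w] asm unfolding w by (auto simp: gs neg_cartan_space)
  next
    fix v \<epsilon> \<sigma> i j r s assume v: "v \<in> range g" and asm: "i \<le> n" "j \<le> n"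
    obtain w where w: "v = g w" using v by auto
    show "phi_int t M' \<epsilon> i r (xop M' \<sigma> j (s - 1) v) - (exp t powi (sgz \<sigma> * cartan_matrix n i j)) *\<^sub>C phi_int t M' \<epsilon> i (r - 1) (xop M' \<sigma> j s v) =
          (exp t powi (sgz \<sigma> * cartan_matrix n i j)) *\<^sub>C xop M' \<sigma> j (s - 1) (phi_int t M' \<epsilon> i r v) - xop M' \<sigma> j s (phi_int t M' \<epsilon> i (r - 1) v)"
      using R(6)[of w] asm unfolding w by (auto simp: gs)
  next
    fix v i j r s assume v: "v \<in> range g" and asm: "i \<le> n" "j \<le> n"
    obtain w where w: "v = g w" using v by auto
    show "xop M' Pos i r (xop M' Neg j s v) - xop M' Neg j s (xop M' Pos i r v) =
          (if i = j then inverse (exp t - inverse (exp t)) *\<^sub>C (phi_int t M' Pos i (r + s) v - phi_int t M' Neg i (r + s) v) else 0)"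
      using R(7)[of w] asm clin_zero[OF g] unfolding w by (auto simp: gs)
  next
    fix v \<sigma> i j r s assume v: "v \<in> range g" and asm: "i \<le> n" "j \<le> n"
    obtain w where w: "v = g w" using v by auto
    show "xop M' \<sigma> i r (xop M' \<sigma> j (s - 1) v) - (exp t powi (sgz \<sigma> * cartan_matrix n i j)) *\<^sub>C xop M' \<sigma> i (r - 1) (xop M' \<sigma> j s v) =
          (exp t powi (sgz \<sigma> * cartan_matrix n i j)) *\<^sub>C xop M' \<sigma> j (s - 1) (xop M' \<sigma> i r v) - xop M' \<sigma> j s (xop M' \<sigma> i (r - 1) v)"
      using R(8)[of w] asm unfolding w by (auto simp: gs)
  next
    fix v \<sigma> i j r s p assume v: "v \<in> range g" and asm: "i \<le> n" "j \<le> n" "j = vertex n (int i + 1) \<or> j = vertex n (int i - 1)"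
    obtain w where w: "v = g w" using v by auto
    show "(xop M' \<sigma> i r (xop M' \<sigma> i s (xop M' \<sigma> j p v)) - (exp t + inverse (exp t)) *\<^sub>C xop M' \<sigma> i r (xop M' \<sigma> j p (xop M' \<sigma> i s v))
             + xop M' \<sigma> j p (xop M' \<sigma> i r (xop M' \<sigma> i s v))) +
          (xop M' \<sigma> i s (xop M' \<sigma> i r (xop M' \<sigma> j p v)) - (exp t + inverse (exp t)) *\<^sub>C xop M' \<sigma> i s (xop M' \<sigma> j p (xop M' \<sigma> i r v))
             + xop M' \<sigma> j p (xop M' \<sigma> i s (xop M' \<sigma> i r v))) = 0"
      using R(9)[of w] asm clin_zero[OF g] unfolding w by (auto simp only: gs)
  next
    fix v \<sigma> i j r s assume v: "v \<in> range g" and asm: "i \<le> n" "j \<le> n" "i \<noteq> j \<and> \<not> (j = vertex n (int i + 1) \<or> j = vertex n (int i - 1))"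
    obtain w where w: "v = g w" using v by auto
    show "xop M' \<sigma> i r (xop M' \<sigma> j s v) = xop M' \<sigma> j s (xop M' \<sigma> i r v)"
    proof -
      have "xop M \<sigma> i r (xop M \<sigma> j s w) = xop M \<sigma> j s (xop M \<sigma> i r w)"
        using R(10)[of w] asm by blast
      then show ?thesis using asm unfolding w by (simp add: gs)
    qed
  qed
qed

end

locale embedding = intertwiner +
  assumes inj: "inj g" and UNIV: "space M = UNIV" and range: "space M' = range g"
begin

lemma weight_space: "weight_space n t M' \<mu> = g ` weight_space n t M \<mu>"
proof -
  have "g v \<in> weight_space n t M' \<mu> \<longleftrightarrow> v \<in> weight_space n t M \<mu>" for v
    by (simp add: weight_space_def UNIV range k flip: clin_scale[OF g]) (simp add: inj_eq[OF inj])
  then show ?thesis by (auto simp: weight_space_def range)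
qed

lemma power_image: "(\<And>v. f' (g v) = g (f v)) \<Longrightarrow> (f' ^^ p) (g v) = g ((f ^^ p) v)"
  by (induction p) auto

lemma integrable_image:
  assumes "integrable n t M"
  shows "integrable n t M'"
proof -
  have U: "(\<Union>\<mu>\<in>X. weight_space n t M' \<mu>) = g ` (\<Union>\<mu>\<in>X. weight_space n t M \<mu>)" for X
    by (auto simp: weight_space)
  have S: "cvec.span (g ` X) = g ` cvec.span X" for X
    by (rule cpair.linear_span_image[OF g])
  have 0: "g ` {0} = {0}" by (simp add: clin_zero[OF g])
  note I = assms[unfolded integrable_def]
  show ?thesis
    unfolding integrable_def
  proof (intro conjI ballI allI impI)
    show "is_qmodule n t M'" using I UNIV range by (intro is_qmodule_image) auto
    show "space M' = cvec.span (\<Union>\<mu>\<in>weight_lattice n. weight_space n t M' \<mu>)"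
      unfolding U S using I range UNIV by metis
  next
    fix \<mu> assume "\<mu> \<in> weight_lattice n"
    then have "weight_space n t M \<mu> \<inter> cvec.span (\<Union>\<nu>\<in>weight_lattice n - {\<mu>}. weight_space n t M \<nu>) = {0}"
      using I by blast
    moreover have "cvec.span (\<Union>\<nu>\<in>weight_lattice n - {\<mu>}. weight_space n t M' \<nu>) =
        g ` cvec.span (\<Union>\<nu>\<in>weight_lattice n - {\<mu>}. weight_space n t M \<nu>)"
      by (simp only: U S)
    ultimately show "weight_space n t M' \<mu> \<inter> cvec.span (\<Union>\<nu>\<in>weight_lattice n - {\<mu>}. weight_space n t M' \<nu>) = {0}"
      by (simp only: weight_space image_Int[OF inj, symmetric] 0)
  next
    fix \<epsilon> i v assume i: "i \<le> n" and "v \<in> space M'"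
    then obtain w where w: "v = g w" using range by auto
    obtain p where "(xop M \<epsilon> i 0 ^^ p) w = 0" using I i UNIV by blast
    then have "(xop M' \<epsilon> i 0 ^^ p) v = 0"
      unfolding w using power_image[of "xop M' \<epsilon> i 0" "xop M \<epsilon> i 0" p w] by (simp add: x i clin_zero[OF g])
    then show "\<exists>p. (xop M' \<epsilon> i 0 ^^ p) v = 0" ..
  qed
qed

lemma lweight_image:
  assumes "v \<in> lweight_space n t M m"
  shows "g v \<in> lweight_space n t M' m"
proof -
  obtain \<omega> u where m: "m = (\<omega>, u)" by (cases m)
  have "\<exists>p. ((\<lambda>w. phi t M' \<epsilon> i s w - fps_nth (monomial_series t u \<epsilon> i) s *\<^sub>C w) ^^ p) (g v) = 0"
    if i: "i \<le> n" for \<epsilon> i s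
  proof -
    let ?f = "\<lambda>M w. phi t M \<epsilon> i s w - fps_nth (monomial_series t u \<epsilon> i) s *\<^sub>C w"
    have "\<exists>p. ((\<lambda>w. phi t M \<epsilon> i s w - fps_nth (monomial_series t u \<epsilon> i) s *\<^sub>C w) ^^ p) v = 0"
      using assms i unfolding m lweight_space_def by simp
    then obtain p where p: "((\<lambda>w. phi t M \<epsilon> i s w - fps_nth (monomial_series t u \<epsilon> i) s *\<^sub>C w) ^^ p) v = 0" ..
    have "((\<lambda>w. phi t M' \<epsilon> i s w - fps_nth (monomial_series t u \<epsilon> i) s *\<^sub>C w) ^^ p) (g v) =
        g (((\<lambda>w. phi t M \<epsilon> i s w - fps_nth (monomial_series t u \<epsilon> i) s *\<^sub>C w) ^^ p) v)"
      by (rule power_image) (simp add: phi i clin_diff[OF g] clin_scale[OF g])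
    then show ?thesis using p clin_zero[OF g] by metis
  qed
  moreover have "g v \<in> weight_space n t M' \<omega>"
    using assms unfolding m lweight_space_def weight_space by auto
  ultimately show ?thesis unfolding m lweight_space_def by auto
qed

lemma weight_space_iff: "g v \<in> weight_space n t M' \<mu> \<longleftrightarrow> v \<in> weight_space n t M \<mu>"
  unfolding weight_space by (metis imageE imageI inj injD)

lemma S_op_image:
  assumes "i \<le> n"
  shows "S_op n t M' \<mu> i (g w) = g (S_op n t M \<mu> i w)"
proof -
  have "(xop M' \<epsilon> i r ^^ p) (g v) = g ((xop M \<epsilon> i r ^^ p) v)" for \<epsilon> r p v
    by (rule power_image) (rule x[OF assms])
  then show ?thesis by (simp add: S_op_def Let_def clin_scale[OF g])
qed

text \<open>The orbit is pulled back along \<open>g\<close> step by step. Injectivity ensures that w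
  and g w have the same weights and satisfy the same vanishing conditions.\<close>

lemma extremal_image:
  assumes "extremal n t M v"
  shows "extremal n t M' (g v)"
proof -
  have orbit: "\<exists>p\<in>S_orbit n t M v. w = g p" if "w \<in> S_orbit n t M' (g v)" for w
    using that
  proof induction
    case start then show ?case using S_orbit.start by blast
  next
    case (step w \<mu> i)
    then obtain p where "p \<in> S_orbit n t M v" "w = g p" by blast
    then show ?case
      using step S_op_image[of i \<mu> p] weight_space_iff S_orbit.step by metis
  qed
  have z: "g w = 0 \<longleftrightarrow> w = 0" for w using inj clin_zero[OF g] by (metis injD)
  have ext: "i_extremal n M' \<mu> i (g w) \<longleftrightarrow> i_extremal n M \<mu> i w" if "i \<le> n" for \<mu> i w
    by (simp add: i_extremal_def x[OF that] z)
  show ?thesis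
    unfolding extremal_def
  proof
    fix w assume "w \<in> S_orbit n t M' (g v)"
    then obtain p where "p \<in> S_orbit n t M v" "w = g p" using orbit by blast
    then show "(\<exists>\<mu>\<in>weight_lattice n. w \<in> weight_space n t M' \<mu>) \<and>
        (\<forall>\<mu>\<in>weight_lattice n. w \<in> weight_space n t M' \<mu> \<longrightarrow> (\<forall>i\<le>n. i_extremal n M' \<mu> i w))"
      using assms ext unfolding extremal_def by (simp add: weight_space_iff)
  qed
qed

lemma extremal_loop_weight_image:
  assumes "extremal_loop_weight_module n t m M"
  shows "extremal_loop_weight_module n t m M'"
proof -
  obtain v where m: "is_monomial n m" "integrable n t M"
    and v: "v \<in> lweight_space n t M m" "cyclic_span (generators n M) v = space M" "extremal n t M v"
    and f: "\<And>j w. j \<le> n \<Longrightarrow> w \<in> space M \<Longrightarrow> finite_dimensional (cyclic_span (vertical_generators n j M) w)"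
    using assms unfolding extremal_loop_weight_module_def by blast
  have fin: "finite_dimensional (cyclic_span (vertical_generators n j M') w)" if j: "j \<le> n" and w: "w \<in> space M'" for j w
  proof -
    obtain p where p: "w = g p" using w range by auto
    obtain B where B: "finite B" "cyclic_span (vertical_generators n j M) p \<subseteq> cvec.span B"
      using f[OF j, of p] UNIV unfolding finite_dimensional_def by auto
    have "cyclic_span (vertical_generators n j M') w \<subseteq> cvec.span (g ` B)"
      unfolding p cpair.linear_span_image[OF g] using vertical_cyclic[of j p] B(2) by blast
    then show ?thesis
      unfolding finite_dimensional_def using B(1) by blast
  qed
  have "cyclic_span (generators n M') (g v) = space M'"
    by (simp add: generators_cyclic v(2) UNIV range)
  then show ?thesis
    unfolding extremal_loop_weight_module_def
    using m integrable_image lweight_image[OF v(1)] extremal_image[OF v(3)] fin by blast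
qed

lemma iso_image: "qmodule_iso n M' M"
proof -
  let ?f = "inv_into UNIV g"
  have f: "?f (g v) = v" for v by (simp add: inj)
  have "bij_betw ?f (space M') (space M)"
    unfolding UNIV range by (rule bij_betw_inv_into) (simp add: inj bij_betw_def)
  moreover have "linear_on_space (space M') ?f"
    unfolding linear_on_space_def range
    by (auto simp: f simp flip: clin_add[OF g] clin_scale[OF g])
  moreover have "\<forall>v\<in>space M'. (\<forall>\<epsilon>. \<forall>i\<le>n. \<forall>r. ?f (xop M' \<epsilon> i r v) = xop M \<epsilon> i r (?f v)) \<and>
          (\<forall>h\<in>cartan_space n. ?f (kop M' h v) = kop M h (?f v)) \<and>
          (\<forall>i\<le>n. \<forall>m. m \<noteq> 0 \<longrightarrow> ?f (hop M' i m v) = hop M i m (?f v))"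
    unfolding range by (auto simp: x k hm f)
  ultimately show ?thesis unfolding qmodule_iso_def by blast
qed

end

section \<open>Simple modules as highest weight modules\<close>

text \<open>The first-order term of the exponential recovers \<open>h\<^sub>i\<^sub>,\<^sub>m\<close> from \<open>\<phi>\<^sub>i\<^sub>,\<^sub>m\<close> and the \<open>h\<^sub>i\<^sub>,\<^sub>s\<close> with smaller \<open>s\<close>.\<close>

lemma hop_stable:
  fixes M :: "('v::complex_vector) qmod"
  assumes N: "cvec.subspace N" and lin: "\<And>m. m \<noteq> 0 \<Longrightarrow> clin (hop M i m)"
    and ki: "\<And>\<epsilon> v. kop M (- signed_coroot \<epsilon> i) (kop M (signed_coroot \<epsilon> i) v) = v"
    and k: "\<And>\<epsilon> v. v \<in> N \<Longrightarrow> kop M (- signed_coroot \<epsilon> i) v \<in> N"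
    and ph: "\<And>\<epsilon> s v. v \<in> N \<Longrightarrow> phi t M \<epsilon> i s v \<in> N"
    and q: "exp t - inverse (exp t) \<noteq> 0" and m: "m \<noteq> 0" and v: "v \<in> N"
  shows "hop M i m v \<in> N"
proof -
  define \<epsilon> where "\<epsilon> = (if m > 0 then Pos else Neg)"
  define A where "A = (\<lambda>m. hop M i (sgz \<epsilon> * int m))"
  let ?h = "of_int (sgz \<epsilon>) * (exp t - inverse (exp t))"
  have h0: "?h \<noteq> 0" using q by (cases \<epsilon>) auto
  have clinA: "clin (A s)" if "s \<ge> 1" for s
    unfolding A_def by (rule lin) (use that in \<open>cases \<epsilon>; simp\<close>)
  have "A p v \<in> N" if "p \<ge> 1" "v \<in> N" for p v
    using that
  proof (induction p arbitrary: v rule: less_induct)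
    case (less p)
    have SN: "series_power A k r v \<in> N" if "r < p" for k r
      using that
    proof (induction k arbitrary: r)
      case 0 then show ?case using less.prems cvec.subspace_0[OF N] by simp
    next
      case (Suc k)
      then show ?case
        using less.IH by (auto intro!: cvec.subspace_sum[OF N])
    qed
    \<comment> \<open>From the second power on, the mode p would be multiplied by a coefficient of
      z^0, which is zero; only modes below p contribute.\<close>
    have big: "series_power A (Suc (Suc k)) p v \<in> N" for k
    proof -
      have "A s (series_power A (Suc k) (p - s) v) \<in> N" if "s \<in> {1..p}" for s
      proof (cases "s = p")
        case True
        then show ?thesis using that clin_zero[OF clinA, of s] cvec.subspace_0[OF N] by simp
      next
        case False
        then show ?thesis using that SN less.IH[of s] by (simp del: series_power.simps)
      qed
      then show ?thesis
        unfolding series_power.simps(2)[of A "Suc k"] by (intro cvec.subspace_sum[OF N])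
    qed
    have one: "series_power A (Suc 0) p v = A p v"
    proof -
      have "series_power A (Suc 0) p v = (\<Sum>s = 1..p. if s = p then A p v else 0)"
        unfolding series_power.simps by (rule sum.cong) (use clin_zero[OF clinA] in auto)
      then show ?thesis using less.prems by simp
    qed
    let ?z = "\<Sum>k\<le>p. (?h ^ k / fact k) *\<^sub>C series_power A k p v"
    have "kop M (signed_coroot \<epsilon> i) ?z = phi t M \<epsilon> i p v"
      by (simp add: phi_def A_def)
    then have zN: "?z \<in> N"
      using k[OF ph[OF less.prems(2)], of \<epsilon> \<epsilon> p] ki[of \<epsilon> ?z] by simp
    obtain p' where p': "p = Suc p'" using less.prems by (cases p) auto
    have "?z = series_power A 0 p v + ((?h ^ Suc 0 / fact (Suc 0)) *\<^sub>C series_power A (Suc 0) p v +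
        (\<Sum>k<p'. (?h ^ Suc (Suc k) / fact (Suc (Suc k))) *\<^sub>C series_power A (Suc (Suc k)) p v))"
      unfolding p' by (simp only: sum.atMost_Suc_shift lessThan_Suc_atMost[symmetric] sum.lessThan_Suc_shift)
        (simp del: series_power.simps(2))
    also have "\<dots> = ?h *\<^sub>C A p v + (\<Sum>k<p'. (?h ^ Suc (Suc k) / fact (Suc (Suc k))) *\<^sub>C series_power A (Suc (Suc k)) p v)"
      using p' one by (simp del: series_power.simps(2))
    finally have "?h *\<^sub>C A p v = ?z - (\<Sum>k<p'. (?h ^ Suc (Suc k) / fact (Suc (Suc k))) *\<^sub>C series_power A (Suc (Suc k)) p v)"
      by (simp only: algebra_simps)
    also have "\<dots> \<in> N"
      by (intro cvec.subspace_diff[OF N] zN cvec.subspace_sum[OF N] cvec.subspace_scale[OF N] big)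
    finally have "inverse ?h *\<^sub>C (?h *\<^sub>C A p v) \<in> N" by (rule cvec.subspace_scale[OF N])
    then show ?case unfolding scaleC_scaleC left_inverse[OF h0] scaleC_one .
  qed
  from this[of "nat \<bar>m\<bar>" v] show ?thesis
    using m v by (cases "m > 0") (auto simp: A_def \<epsilon>_def)
qed

context
  fixes n :: nat and t :: complex and M :: "('v::complex_vector) qmod"
  assumes M: "is_qmodule n t M" and U: "space M = UNIV"
begin

lemma qmodule_clin:
  "i \<le> n \<Longrightarrow> clin (xop M \<epsilon> i r)" "h \<in> cartan_space n \<Longrightarrow> clin (kop M h)"
  "i \<le> n \<Longrightarrow> m \<noteq> 0 \<Longrightarrow> clin (hop M i m)"
proof -
  have "clin f" if "f \<in> generators n M" for f
    using M that by (simp add: is_qmodule_def Let_def linear_on_UNIV U)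
  then show "i \<le> n \<Longrightarrow> clin (xop M \<epsilon> i r)" "h \<in> cartan_space n \<Longrightarrow> clin (kop M h)"
    "i \<le> n \<Longrightarrow> m \<noteq> 0 \<Longrightarrow> clin (hop M i m)"
    unfolding generators_def by blast+
qed

lemma qmodule_clin_phi: "i \<le> n \<Longrightarrow> clin (phi t M \<epsilon> i s)" "i \<le> n \<Longrightarrow> clin (phi_int t M \<epsilon> i r)"
proof -
  show c: "clin (phi t M \<epsilon> i s)" if "i \<le> n" for \<epsilon> s
    by (rule clin_phi) (use that in \<open>auto intro: qmodule_clin signed_coroot_in\<close>)
  show "clin (phi_int t M \<epsilon> i r)" if "i \<le> n"
    unfolding phi_int_def[abs_def] using c[OF that] by (cases "sgz \<epsilon> * r \<ge> 0") (simp_all add: clin_intros)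
qed

lemmas qmodule_relations = bspec[OF conjunct2[OF conjunct2[OF M[unfolded is_qmodule_def Let_def U]]] UNIV_I]

lemma qmodule_kk: "h \<in> cartan_space n \<Longrightarrow> h' \<in> cartan_space n \<Longrightarrow> kop M h (kop M h' v) = kop M (h + h') v"
  and qmodule_k0: "kop M 0 v = v"
  and qmodule_k_phi: "h \<in> cartan_space n \<Longrightarrow> i \<le> n \<Longrightarrow> kop M h (phi_int t M \<epsilon> i r v) = phi_int t M \<epsilon> i r (kop M h v)"
  using qmodule_relations[of v, THEN conjunct1] qmodule_relations[of v, THEN conjunct2, THEN conjunct1]
    qmodule_relations[of v, THEN conjunct2, THEN conjunct2, THEN conjunct1] by blast+

lemma qmodule_k_x:
  assumes "h \<in> cartan_space n" "j \<le> n"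
  shows "kop M h (xop M \<sigma> j r v) =
    qexp t (of_int (sgz \<sigma>) * pairing n (simple_root n j) h) *\<^sub>C xop M \<sigma> j r (kop M h v)"
proof -
  have "kop M h (xop M \<sigma> j r (kop M (- h) (kop M h v))) =
    qexp t (of_int (sgz \<sigma>) * pairing n (simple_root n j) h) *\<^sub>C xop M \<sigma> j r (kop M h v)"
    using qmodule_relations[of "kop M h v", THEN conjunct2, THEN conjunct2, THEN conjunct2, THEN conjunct2, THEN conjunct1] assms
    by blast
  then show ?thesis using assms by (simp add: qmodule_kk neg_cartan_space qmodule_k0)
qed

lemma qmodule_phi_x:
  "i \<le> n \<Longrightarrow> j \<le> n \<Longrightarrow>
   phi_int t M \<epsilon> i r (xop M \<sigma> j (s - 1) v) - (exp t powi (sgz \<sigma> * cartan_matrix n i j)) *\<^sub>C phi_int t M \<epsilon> i (r - 1) (xop M \<sigma> j s v) =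
   (exp t powi (sgz \<sigma> * cartan_matrix n i j)) *\<^sub>C xop M \<sigma> j (s - 1) (phi_int t M \<epsilon> i r v) - xop M \<sigma> j s (phi_int t M \<epsilon> i (r - 1) v)"
  using qmodule_relations[of v, THEN conjunct2, THEN conjunct2, THEN conjunct2, THEN conjunct2, THEN conjunct2, THEN conjunct1]
  by blast

lemma qmodule_x_x:
  "i \<le> n \<Longrightarrow> j \<le> n \<Longrightarrow> xop M Pos i r (xop M Neg j s v) - xop M Neg j s (xop M Pos i r v) =
     (if i = j then inverse (exp t - inverse (exp t)) *\<^sub>C (phi_int t M Pos i (r + s) v - phi_int t M Neg i (r + s) v) else 0)"
  using qmodule_relations[of v, THEN conjunct2, THEN conjunct2, THEN conjunct2, THEN conjunct2, THEN conjunct2, THEN conjunct2, THEN conjunct1]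
  by blast

text \<open>Passes from the modes of phi, in which \<open>highest_module\<close> states simplicity,
  to the generators h_{i,m}, in which it is given.\<close>

lemma qmodule_hop_stable:
  assumes "cvec.subspace N" "\<And>h v. h \<in> cartan_space n \<Longrightarrow> v \<in> N \<Longrightarrow> kop M h v \<in> N"
    "\<And>\<epsilon> i r v. i \<le> n \<Longrightarrow> v \<in> N \<Longrightarrow> phi_int t M \<epsilon> i r v \<in> N" "exp t - inverse (exp t) \<noteq> 0"
    "i \<le> n" "m \<noteq> 0" "v \<in> N"
  shows "hop M i m v \<in> N"
proof (rule hop_stable[OF assms(1) _ _ _ _ assms(4,6,7)])
  fix \<epsilon> s v
  show "kop M (- signed_coroot \<epsilon> i) (kop M (signed_coroot \<epsilon> i) v) = v"
    by (simp add: qmodule_kk neg_cartan_space signed_coroot_in assms(5) qmodule_k0)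
  show "kop M (- signed_coroot \<epsilon> i) v \<in> N" if "v \<in> N"
    using assms(2) that by (simp add: neg_cartan_space signed_coroot_in assms(5))
  have "phi t M \<epsilon> i s v = phi_int t M \<epsilon> i (sgz \<epsilon> * int s) v"
    by (cases \<epsilon>) (simp_all add: phi_int_def)
  then show "phi t M \<epsilon> i s v \<in> N" if "v \<in> N"
    using assms(3,5) that by simp
qed (rule qmodule_clin(3)[OF assms(5)])

end

section \<open>The tensor product\<close>

locale tensor_setup = loop_line n t sg a for n :: nat and t :: complex and sg :: int and a :: complex +
  fixes V :: "('v::complex_vector) qmod" and vp :: 'v
    and W :: "('w::complex_vector) qmod" and vm :: 'w
  assumes V_UNIV: "space V = UNIV"
    and V_simple: "simple_lweight_module n t Pos (fund_weight (color 0), Ymon (color 0) a) V vp"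
    and W_UNIV: "space W = UNIV"
    and W_simple: "simple_lweight_module n t Neg (- fund_weight 0, \<lambda>i c. - Ymon 0 (a * exp t) i c) W vm"
begin

lemma V_facts:
  "is_qmodule n t V" "i \<le> n \<Longrightarrow> xop V Pos i r vp = 0"
  "h \<in> cartan_space n \<Longrightarrow> kop V h vp = qexp t (pairing n (fund_weight (color 0)) h) *\<^sub>C vp"
  "i \<le> n \<Longrightarrow> phi t V \<epsilon> i s vp = fps_nth (if i = color 0 then psi_series t \<epsilon> (c 1) else 1) s *\<^sub>C vp"
  "cvec.subspace N \<Longrightarrow> (\<forall>f\<in>generators n V. f ` N \<subseteq> N) \<Longrightarrow> N = {0} \<or> N = UNIV" "vp \<noteq> 0"
proof -
  note A = V_simple[unfolded simple_lweight_module_def prod.case simple_qmodule_def V_UNIV]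
  note A1 = A[THEN conjunct1, THEN conjunct1] and A2 = A[THEN conjunct1, THEN conjunct2]
    and A3 = A[THEN conjunct2, THEN conjunct2, THEN conjunct1]
    and A4 = A[THEN conjunct2, THEN conjunct2, THEN conjunct2, THEN conjunct1]
    and A5 = A[THEN conjunct2, THEN conjunct2, THEN conjunct2, THEN conjunct2, THEN conjunct1]
    and A6 = A[THEN conjunct2, THEN conjunct2, THEN conjunct2, THEN conjunct2, THEN conjunct2]
  have "{c. Ymon (color 0) a i c \<noteq> 0} = (if i = color 0 then {a} else {})" for i
    by (auto simp: Ymon_def)
  then have m: "monomial_series t (Ymon (color 0) a) \<epsilon> i = (if i = color 0 then psi_series t \<epsilon> (c 1) else 1)" for \<epsilon> i
    by (simp add: monomial_series_def c_def Ymon_def)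
  show "is_qmodule n t V" "i \<le> n \<Longrightarrow> xop V Pos i r vp = 0"
    "h \<in> cartan_space n \<Longrightarrow> kop V h vp = qexp t (pairing n (fund_weight (color 0)) h) *\<^sub>C vp"
    "i \<le> n \<Longrightarrow> phi t V \<epsilon> i s vp = fps_nth (if i = color 0 then psi_series t \<epsilon> (c 1) else 1) s *\<^sub>C vp"
    "cvec.subspace N \<Longrightarrow> (\<forall>f\<in>generators n V. f ` N \<subseteq> N) \<Longrightarrow> N = {0} \<or> N = UNIV"
    using A1 A2[THEN conjunct2] A4 A5 A6[unfolded m] by (simp_all)
  show "vp \<noteq> 0"
  proof
    assume "vp = 0"
    moreover have "\<forall>f\<in>generators n V. f ` {0} \<subseteq> {0}"
      using A1 by (auto simp: is_qmodule_def Let_def V_UNIV linear_on_UNIV clin_zero)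
    ultimately have "cyclic_span (generators n V) vp \<subseteq> {0}"
      unfolding cyclic_span_def by (intro Inter_lower) auto
    then show False using A2[THEN conjunct1] A3 by auto
  qed
qed

lemma W_facts:
  "is_qmodule n t W" "i \<le> n \<Longrightarrow> xop W Neg i r vm = 0"
  "h \<in> cartan_space n \<Longrightarrow> kop W h vm = qexp t (- pairing n (fund_weight 0) h) *\<^sub>C vm"
  "i \<le> n \<Longrightarrow> phi t W \<epsilon> i s vm = fps_nth (if i = 0 then inverse (psi_series t \<epsilon> (c 2)) else 1) s *\<^sub>C vm"
  "cvec.subspace N \<Longrightarrow> (\<forall>f\<in>generators n W. f ` N \<subseteq> N) \<Longrightarrow> N = {0} \<or> N = UNIV" "vm \<noteq> 0"
proof -
  note A = W_simple[unfolded simple_lweight_module_def prod.case simple_qmodule_def W_UNIV pairing_neg_left]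
  note A1 = A[THEN conjunct1, THEN conjunct1] and A2 = A[THEN conjunct1, THEN conjunct2]
    and A3 = A[THEN conjunct2, THEN conjunct2, THEN conjunct1]
    and A4 = A[THEN conjunct2, THEN conjunct2, THEN conjunct2, THEN conjunct1]
    and A5 = A[THEN conjunct2, THEN conjunct2, THEN conjunct2, THEN conjunct2, THEN conjunct1]
    and A6 = A[THEN conjunct2, THEN conjunct2, THEN conjunct2, THEN conjunct2, THEN conjunct2]
  have "{c. - Ymon 0 (a * q) i c \<noteq> 0} = (if i = 0 then {a * q} else {})" for i
    by (auto simp: Ymon_def)
  then have m: "monomial_series t (\<lambda>i c. - Ymon 0 (a * q) i c) \<epsilon> i = (if i = 0 then inverse (psi_series t \<epsilon> (c 2)) else 1)" for \<epsilon> i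
    by (simp add: monomial_series_def c_def Ymon_def power_int_minus power2_eq_square mult.assoc)
  show "is_qmodule n t W" "i \<le> n \<Longrightarrow> xop W Neg i r vm = 0"
    "h \<in> cartan_space n \<Longrightarrow> kop W h vm = qexp t (- pairing n (fund_weight 0) h) *\<^sub>C vm"
    "i \<le> n \<Longrightarrow> phi t W \<epsilon> i s vm = fps_nth (if i = 0 then inverse (psi_series t \<epsilon> (c 2)) else 1) s *\<^sub>C vm"
    "cvec.subspace N \<Longrightarrow> (\<forall>f\<in>generators n W. f ` N \<subseteq> N) \<Longrightarrow> N = {0} \<or> N = UNIV"
    using A1 A2[THEN conjunct2] A4 A5 A6[unfolded m] by (simp_all)
  show "vm \<noteq> 0"
  proof
    assume "vm = 0"
    moreover have "\<forall>f\<in>generators n W. f ` {0} \<subseteq> {0}"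
      using A1 by (auto simp: is_qmodule_def Let_def W_UNIV linear_on_UNIV clin_zero)
    ultimately have "cyclic_span (generators n W) vm \<subseteq> {0}"
      unfolding cyclic_span_def by (intro Inter_lower) auto
    then show False using A2[THEN conjunct1] A3 by auto
  qed
qed

lemmas V_rel = qmodule_clin[OF V_facts(1) V_UNIV] qmodule_clin_phi[OF V_facts(1) V_UNIV]
  qmodule_kk[OF V_facts(1) V_UNIV] qmodule_k_phi[OF V_facts(1) V_UNIV] qmodule_k_x[OF V_facts(1) V_UNIV]
  qmodule_phi_x[OF V_facts(1) V_UNIV] qmodule_x_x[OF V_facts(1) V_UNIV]
lemmas W_rel = qmodule_clin[OF W_facts(1) W_UNIV] qmodule_clin_phi[OF W_facts(1) W_UNIV]
  qmodule_kk[OF W_facts(1) W_UNIV] qmodule_k_phi[OF W_facts(1) W_UNIV] qmodule_k_x[OF W_facts(1) W_UNIV]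
  qmodule_phi_x[OF W_facts(1) W_UNIV] qmodule_x_x[OF W_facts(1) W_UNIV]

text \<open>The parameter of \<open>W\<close> once 1/z has replaced z: by \<open>psi_opp\<close> the
  inverse of psi at \<open>c 2\<close> becomes psi at 1/a, which is \<open>aW * q\<close>.\<close>

definition aW :: complex where "aW = inverse (a * exp t)"

lemma phi_int_coef:
  assumes "\<And>s. phi t M \<epsilon> i s v = fps_nth f s *\<^sub>C v"
  shows "phi_int t M \<epsilon> i r v = coef \<epsilon> f r *\<^sub>C v"
  by (simp add: phi_int_def coef_def assms)

end

sublocale tensor_setup \<subseteq> V: highest_module n t sg sg a "xop V Pos" "xop V Neg" "phi_int t V" "kop V" vp
  "fund_weight (color 0)"
proof (intro highest_module.intro highest_module_axioms.intro)
  show "colored_line n t sg a" by (rule colored_line_axioms)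
next
  fix i \<epsilon> r v assume "sgz \<epsilon> * r < 0"
  then show "phi_int t V \<epsilon> i r v = 0" by (simp add: phi_int_def)
next
  fix N
  assume N: "cvec.subspace N" "\<And>i r v. i \<le> n \<Longrightarrow> v \<in> N \<Longrightarrow> xop V Pos i r v \<in> N"
    "\<And>i r v. i \<le> n \<Longrightarrow> v \<in> N \<Longrightarrow> xop V Neg i r v \<in> N"
    "\<And>\<epsilon> i r v. i \<le> n \<Longrightarrow> v \<in> N \<Longrightarrow> phi_int t V \<epsilon> i r v \<in> N"
    "\<And>h v. h \<in> cartan_space n \<Longrightarrow> v \<in> N \<Longrightarrow> kop V h v \<in> N"
  have "xop V \<epsilon> i r v \<in> N" if "i \<le> n" "v \<in> N" for \<epsilon> i r v
    using N(2,3) that by (cases \<epsilon>) auto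
  moreover have "hop V i m v \<in> N" if "i \<le> n" "m \<noteq> 0" "v \<in> N" for i m v
    using qmodule_hop_stable[OF V_facts(1) V_UNIV N(1,5,4) q_diff that] by simp
  ultimately have "f ` N \<subseteq> N" if "f \<in> generators n V" for f
    using that N(5) unfolding generators_def by blast
  then show "N = {0} \<or> N = UNIV" using V_facts(5)[OF N(1)] by blast
next
  fix i \<epsilon> r assume "i \<le> n"
  then show "phi_int t V \<epsilon> i r vp = coef \<epsilon> (if i = vertex n sg then psi_series t \<epsilon> (a * exp t) else 1) r *\<^sub>C vp"
    using phi_int_coef[of V \<epsilon> i vp, OF V_facts(4)] by (simp add: color_def c_def)
next
  fix h i r v assume "h \<in> cartan_space n" "i \<le> n"
  then show "kop V h (xop V Neg i r v) = inverse (qexp t (pairing n (simple_root n i) h)) *\<^sub>C xop V Neg i r (kop V h v)"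
    "kop V h (xop V Pos i r v) = qexp t (pairing n (simple_root n i) h) *\<^sub>C xop V Pos i r (kop V h v)"
    using V_rel(8)[of h i Neg r v] V_rel(8)[of h i Pos r v] by (simp_all add: qexp_neg)
next
  fix h h' v assume "h \<in> cartan_space n" "h' \<in> cartan_space n"
  then show "kop V h (kop V h' v) = kop V h' (kop V h v)" by (simp add: V_rel(6) add.commute)
next
  fix \<epsilon> i j r s v assume "i \<le> n" "j \<le> n"
  then show "phi_int t V \<epsilon> i r (xop V Pos j (s - 1) v) - (exp t powi cartan_matrix n i j) *\<^sub>C phi_int t V \<epsilon> i (r - 1) (xop V Pos j s v) =
      (exp t powi cartan_matrix n i j) *\<^sub>C xop V Pos j (s - 1) (phi_int t V \<epsilon> i r v) - xop V Pos j s (phi_int t V \<epsilon> i (r - 1) v)"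
    "phi_int t V \<epsilon> i r (xop V Neg j (s - 1) v) - (exp t powi (- cartan_matrix n i j)) *\<^sub>C phi_int t V \<epsilon> i (r - 1) (xop V Neg j s v) =
      (exp t powi (- cartan_matrix n i j)) *\<^sub>C xop V Neg j (s - 1) (phi_int t V \<epsilon> i r v) - xop V Neg j s (phi_int t V \<epsilon> i (r - 1) v)"
    using V_rel(9)[of i j \<epsilon> r Pos s v] V_rel(9)[of i j \<epsilon> r Neg s v] by simp_all
qed (simp_all add: V_rel V_facts(2,3,6))

text \<open>The involution replaces r and s by 1 - r and 1 - s, which swaps the two terms on each
  side of the exchange relation; multiplying by the inverse coefficient restores its form.\<close>

lemma reversed_relation:
  fixes x y z w :: "'v::complex_vector"
  assumes "Q * Q' = 1" "x - Q' *\<^sub>C y = Q' *\<^sub>C z - w"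
  shows "y - Q *\<^sub>C x = Q *\<^sub>C w - z"
proof -
  have "Q *\<^sub>C (x - Q' *\<^sub>C y) = Q *\<^sub>C (Q' *\<^sub>C z - w)" using assms(2) by simp
  then have "Q *\<^sub>C x - y = z - Q *\<^sub>C w"
    by (simp add: cvec.scale_right_diff_distrib scaleC_scaleC assms(1) scaleC_one)
  then show ?thesis by (simp add: algebra_simps)
qed

text \<open>The involution \<open>x\<^sup>\<plusminus>\<^sub>i\<^sub>,\<^sub>r \<mapsto> x\<^sup>\<mp>\<^sub>i\<^sub>,\<^sub>-\<^sub>r\<close>, \<open>\<phi>\<^sup>\<plusminus>(z) \<mapsto> \<phi>\<^sup>\<mp>(1/z)\<close>, \<open>k\<^sub>h \<mapsto> k\<^sub>-\<^sub>h\<close> turns the lowest weight module into a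
  highest weight module.\<close>

sublocale tensor_setup \<subseteq> W: highest_module n t 0 "- sg" aW
  "\<lambda>i r. xop W Neg i (- r)" "\<lambda>i r. xop W Pos i (- r)" "\<lambda>\<epsilon> i r. phi_int t W (opp \<epsilon>) i (- r)"
  "\<lambda>h. kop W (- h)" vm "fund_weight 0"
proof (intro highest_module.intro highest_module_axioms.intro)
  show "colored_line n t (- sg) (aW)"
    using sg a0 n2 not_root by unfold_locales (auto simp: aW_def)
next
  fix i \<epsilon> r v assume "sgz \<epsilon> * r < 0"
  then show "phi_int t W (opp \<epsilon>) i (- r) v = 0" by (simp add: phi_int_def)
next
  fix N
  assume N: "cvec.subspace N" "\<And>i r v. i \<le> n \<Longrightarrow> v \<in> N \<Longrightarrow> xop W Neg i (- r) v \<in> N"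
    "\<And>i r v. i \<le> n \<Longrightarrow> v \<in> N \<Longrightarrow> xop W Pos i (- r) v \<in> N"
    "\<And>\<epsilon> i r v. i \<le> n \<Longrightarrow> v \<in> N \<Longrightarrow> phi_int t W (opp \<epsilon>) i (- r) v \<in> N"
    "\<And>h v. h \<in> cartan_space n \<Longrightarrow> v \<in> N \<Longrightarrow> kop W (- h) v \<in> N"
  have k: "kop W h v \<in> N" if "h \<in> cartan_space n" "v \<in> N" for h v
    using N(5)[of "- h" v] that by (simp add: neg_cartan_space)
  have p: "phi_int t W \<epsilon> i r v \<in> N" if "i \<le> n" "v \<in> N" for \<epsilon> i r v
    using N(4)[OF that, of "opp \<epsilon>" "- r"] by simp
  have "xop W \<epsilon> i r v \<in> N" if "i \<le> n" "v \<in> N" for \<epsilon> i r v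
    using N(2,3)[OF that, of "- r"] by (cases \<epsilon>) auto
  moreover have "hop W i m v \<in> N" if "i \<le> n" "m \<noteq> 0" "v \<in> N" for i m v
    using qmodule_hop_stable[OF W_facts(1) W_UNIV N(1) k p q_diff that] by simp
  ultimately have "f ` N \<subseteq> N" if "f \<in> generators n W" for f
    using that k unfolding generators_def by blast
  then show "N = {0} \<or> N = UNIV" using W_facts(5)[OF N(1)] by blast
next
  fix i \<epsilon> r assume i: "i \<le> n"
  have "phi_int t W (opp \<epsilon>) i (- r) vm = coef \<epsilon> (if i = 0 then inverse (psi_series t (opp \<epsilon>) (c 2)) else 1) r *\<^sub>C vm"
    using phi_int_coef[of W "opp \<epsilon>" i vm, OF W_facts(4)[OF i]] by (simp only: coef_opp)
  moreover have "inverse (psi_series t (opp \<epsilon>) (c 2)) = psi_series t \<epsilon> (aW * exp t)"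
  proof -
    have w: "aW * q = inverse a" by (simp add: aW_def)
    have "c 2 = q ^ 2 * a" by (simp add: c_def)
    then show ?thesis unfolding w using psi_opp[OF a0, of t "opp \<epsilon>"] by simp
  qed
  moreover have "vertex n 0 = 0" by (simp add: vertex_def)
  ultimately show "phi_int t W (opp \<epsilon>) i (- r) vm = coef \<epsilon> (if i = vertex n 0 then psi_series t \<epsilon> (aW * exp t) else 1) r *\<^sub>C vm"
    by simp
next
  fix h i r v assume "h \<in> cartan_space n" "i \<le> n"
  then show "kop W (- h) (xop W Pos i (- r) v) = inverse (qexp t (pairing n (simple_root n i) h)) *\<^sub>C xop W Pos i (- r) (kop W (- h) v)"
    "kop W (- h) (xop W Neg i (- r) v) = qexp t (pairing n (simple_root n i) h) *\<^sub>C xop W Neg i (- r) (kop W (- h) v)"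
    using W_rel(8)[of "- h" i Neg "- r" v] W_rel(8)[of "- h" i Pos "- r" v]
    by (simp_all add: qexp_neg neg_cartan_space pairing_neg_right)
next
  fix h h' v assume "h \<in> cartan_space n" "h' \<in> cartan_space n"
  then show "kop W (- h) (kop W (- h') v) = kop W (- h') (kop W (- h) v)"
    by (simp add: W_rel(6) add.commute neg_cartan_space)
next
  fix \<epsilon> i j and r s :: int and v assume "i \<le> n" "j \<le> n"
  note P = W_rel(9)[OF this, of "opp \<epsilon>" "1 - r" _ "1 - s" v]
  have i: "1 - r - 1 = - r" "1 - s - 1 = - s" "- (r - 1) = 1 - r" "- (s - 1) = 1 - s" by simp_all
  have Q: "q powi cartan_matrix n i j * q powi (sgz Neg * cartan_matrix n i j) = 1"
    "q powi (- cartan_matrix n i j) * q powi (sgz Pos * cartan_matrix n i j) = 1"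
    by (simp_all flip: power_int_add)
  show "phi_int t W (opp \<epsilon>) i (- r) (xop W Neg j (- (s - 1)) v) - (exp t powi cartan_matrix n i j) *\<^sub>C phi_int t W (opp \<epsilon>) i (- (r - 1)) (xop W Neg j (- s) v) =
      (exp t powi cartan_matrix n i j) *\<^sub>C xop W Neg j (- (s - 1)) (phi_int t W (opp \<epsilon>) i (- r) v) - xop W Neg j (- s) (phi_int t W (opp \<epsilon>) i (- (r - 1)) v)"
    using reversed_relation[OF Q(1) P[of Neg]] unfolding i .
  show "phi_int t W (opp \<epsilon>) i (- r) (xop W Pos j (- (s - 1)) v) - (exp t powi (- cartan_matrix n i j)) *\<^sub>C phi_int t W (opp \<epsilon>) i (- (r - 1)) (xop W Pos j (- s) v) =
      (exp t powi (- cartan_matrix n i j)) *\<^sub>C xop W Pos j (- (s - 1)) (phi_int t W (opp \<epsilon>) i (- r) v) - xop W Pos j (- s) (phi_int t W (opp \<epsilon>) i (- (r - 1)) v)"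
    using reversed_relation[OF Q(2) P[of Pos]] unfolding i .
next
  fix i j r s v assume "i \<le> n" "j \<le> n"
  then show "xop W Neg i (- r) (xop W Pos j (- s) v) - xop W Pos j (- s) (xop W Neg i (- r) v) =
     (if i = j then inverse (exp t - inverse (exp t)) *\<^sub>C
        (phi_int t W (opp Pos) i (- (r + s)) v - phi_int t W (opp Neg) i (- (r + s)) v) else 0)"
    using W_rel(10)[of j i "- s" "- r" v] by (auto simp: algebra_simps cvec.scale_right_diff_distrib)
next
  fix h \<epsilon> i r v assume "h \<in> cartan_space n" "i \<le> n"
  then show "kop W (- h) (phi_int t W (opp \<epsilon>) i (- r) v) = phi_int t W (opp \<epsilon>) i (- r) (kop W (- h) v)"
    by (simp add: W_rel(7) neg_cartan_space)
qed (simp_all add: W_rel W_facts(2,3,6) neg_cartan_space pairing_neg_right)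

context tensor_setup
begin

section \<open>Common indexing of both factors\<close>

lemma V_bad: "V.bad = 0"
  by (simp add: V.bad_def color_m1)

lemma W_color: "W.color m = color (- m - 1)"
  by (simp add: W.color_def color_def algebra_simps)

lemma W_bad: "W.bad = color 0"
  by (simp add: W.bad_def W_color)

text \<open>The choice b = aq makes the rows of \<open>W\<close> continue the parameters of
  \<open>V\<close> to smaller indices, up to inversion.\<close>

lemma W_c: "W.c k = inverse (c (1 - k))"
proof -
  have "c (1 - k) = a * q * inverse (q powi k)" by (simp add: c_def power_int_diff divide_inverse)
  then show ?thesis unfolding W.c_def unfolding aW_def by simp
qed

text \<open>The sign of k tells which factor carries the row; both half lines start at the
  generating vector of \<open>T\<close>.\<close>

definition e :: "int \<Rightarrow> ('v, 'w) tensor" where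
  "e k = (if k \<ge> 0 then V.row (nat k) \<otimes>\<^sub>t vm else vp \<otimes>\<^sub>t W.row (nat (- k)))"

lemma e_nonneg: "e (int m) = V.row m \<otimes>\<^sub>t vm"
  by (simp add: e_def)

lemma e_nonpos: "e (- int m) = vp \<otimes>\<^sub>t W.row m"
  by (cases "m = 0") (auto simp: e_def)

lemma e_nonzero: "e k \<noteq> 0"
  by (simp add: e_def tensor_nonzero V.row_nonzero W.row_nonzero V_facts(6) W_facts(6))

section \<open>Deformed action on the two half lines\<close>

lemma drinfeld_coeff_Pos:
  assumes "i \<le> n"
  shows "drinfeld_coeff t V W Pos i r k (v \<otimes>\<^sub>t w) =
    (if k = 0 then xop V Pos i r v \<otimes>\<^sub>t w else 0) +
    (if k \<ge> r then phi t V Neg i (nat (k - r)) v \<otimes>\<^sub>t xop W Pos i k w else 0)"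
  using assms by (simp add: tensor_map_pure V_rel W_rel clin_intros)

lemma drinfeld_coeff_Neg:
  assumes "i \<le> n"
  shows "drinfeld_coeff t V W Neg i r k (v \<otimes>\<^sub>t w) =
    (if k \<ge> 0 then xop V Neg i (r - k) v \<otimes>\<^sub>t phi t W Pos i (nat k) w else 0) +
    (if k = r then v \<otimes>\<^sub>t xop W Neg i r w else 0)"
  using assms by (simp add: tensor_map_pure V_rel W_rel clin_intros)

declare drinfeld_coeff.simps [simp del]

lemma clin_drinfeld_coeff: "i \<le> n \<Longrightarrow> clin (drinfeld_coeff t V W \<epsilon> i r k)"
proof -
  assume i: "i \<le> n"
  have "clin (tensor_map (xop V Pos i r) id)" "clin (tensor_map (phi t V Neg i s) (xop W Pos i k))"
    "clin (tensor_map (xop V Neg i (r - k)) (phi t W Pos i s))" "clin (tensor_map id (xop W Neg i r))" for s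
    using i by (simp_all add: clin_tensor_map V_rel W_rel clin_intros)
  then show ?thesis by (cases \<epsilon>) (auto simp: drinfeld_coeff.simps clin_iff scaleC_add_right)
qed

lemma xW_Pos_row:
  "\<exists>u. \<forall>i\<le>n. \<forall>r. xop W Pos i r (W.row m) =
     (if i = color (- int m - 1) then (W.rowcoeff (int m + 1) * c (- int m) powi r) *\<^sub>C W.row (m + 1) else 0)
     + (if i = color 0 \<and> m > 0 then c (- 1) powi r *\<^sub>C u else 0)"
proof -
  obtain u where u: "\<And>i s. i \<le> n \<Longrightarrow> xop W Pos i (- s) (W.row m) =
     (if i = W.color (int m) then (W.rowcoeff (int m + 1) * W.c (int m + 1) powi s) *\<^sub>C W.row (m + 1) else 0)
     + (if i = W.bad \<and> m > 0 then W.c 2 powi s *\<^sub>C u else 0)"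
    using W.xm_row[of m] by blast
  have c: "W.c (int m + 1) powi (- r) = c (- int m) powi r" "W.c 2 powi (- r) = c (- 1) powi r" for r
    by (simp_all add: W_c power_int_minus power_int_inverse)
  show ?thesis
    by (rule exI[of _ u]) (use u[of _ "- _"] in \<open>auto simp: c W_color W_bad\<close>)
qed

lemma xW_Neg_row:
  "i \<le> n \<Longrightarrow> xop W Neg i r (W.row m) =
     (if m > 0 \<and> i = color (- int m) then c (1 - int m) powi r *\<^sub>C W.row (m - 1) else 0)"
  using W.xp_row[of i "- r" m] by (simp add: W_color W_c power_int_minus power_int_inverse)

lemma phiV_row: "i \<le> n \<Longrightarrow> phi t V \<epsilon> i s (V.row m) = fps_nth (V.rowphi \<epsilon> i (int m)) s *\<^sub>C V.row m"
  using V.phi_row[of i \<epsilon> "sgz \<epsilon> * int s" m] by (cases \<epsilon>) (simp_all add: phi_int_def coef_def)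

lemma phiW_row: "i \<le> n \<Longrightarrow> phi t W \<epsilon> i s (W.row m) = fps_nth (W.rowphi (opp \<epsilon>) i (int m)) s *\<^sub>C W.row m"
  using W.phi_row[of i "opp \<epsilon>" "sgz (opp \<epsilon>) * int s" m] by (cases \<epsilon>) (simp_all add: phi_int_def coef_def)

lemma color_minus_2: "color 1 \<noteq> color (- 1)"
  by (rule color_neq) auto

text \<open>With x the parameter of the new box and d = \<open>c 2\<close>, the first quotient is
  the value of phi on \<open>vm\<close> and the second is \<open>rowcoeff\<close>. As they are
  reciprocal, the next vector appears without an extra scalar.\<close>

lemma cross_factor:
  fixes x d :: complex
  assumes "x \<noteq> 0" "x \<noteq> d" "q * x \<noteq> d / q"
  shows "(1 - d / x) / (q - d / q / x) * ((q * x - d / q) / (x - d)) = 1"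
proof -
  have "1 - d / x = (x - d) / x" "q - d / q / x = (q * x - d / q) / x"
    using assms(1) by (simp_all add: diff_divide_distrib)
  then show ?thesis using assms by simp
qed

text \<open>Lowering modes kill \<open>vm\<close>, so only the row changes, and each pole is
  weighted with the value of phi on \<open>vm\<close>. At \<open>c (m + 1)\<close> this value
  inverts \<open>rowcoeff\<close>; at \<open>c 2\<close> it is zero in the colour 0, which removes
  the unknown vector \<open>u\<close>.\<close>

lemma e_xm_nonneg:
  assumes i: "i \<le> n"
  shows "has_value (\<lambda>\<kappa>. drinfeld_coeff t V W Neg i r \<kappa> (V.row m \<otimes>\<^sub>t vm))
     (if i = color (int m) then c (int m + 1) powi r *\<^sub>C (V.row (m + 1) \<otimes>\<^sub>t vm) else 0)"
proof -
  let ?k = "int m" and ?c = "c (int m + 1)"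
  define f where "f = (if i = 0 then inverse (psi_series t Pos (c 2)) else 1)"
  obtain u where u: "\<And>s. xop V Neg i s (V.row m) =
     (if i = color ?k then (V.rowcoeff (?k + 1) * ?c powi s) *\<^sub>C V.row (m + 1) else 0)
     + (if i = 0 \<and> m > 0 then c 2 powi s *\<^sub>C u else 0)"
    using V.xm_row[of m] i unfolding V_bad by blast
  let ?y1 = "if i = color ?k then V.rowcoeff (?k + 1) *\<^sub>C (V.row (m + 1) \<otimes>\<^sub>t vm) else 0"
  let ?y2 = "if i = 0 \<and> m > 0 then u \<otimes>\<^sub>t vm else 0"
  have eq: "drinfeld_coeff t V W Neg i r \<kappa> (V.row m \<otimes>\<^sub>t vm) =
      (if \<kappa> \<ge> 0 then (fps_nth f (nat \<kappa>) * ?c powi (r - \<kappa>)) *\<^sub>C ?y1 else 0)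
      + (if \<kappa> \<ge> 0 then (fps_nth f (nat \<kappa>) * c 2 powi (r - \<kappa>)) *\<^sub>C ?y2 else 0)" for \<kappa>
    using i W_facts(4)[OF i, of Pos "nat \<kappa>"]
    by (auto simp: drinfeld_coeff_Neg[OF i] u f_def W_facts(2) tensor_add_left tensor_scale_left tensor_scale_right
        clin_zero[OF clin_tensor_left] clin_zero[OF clin_tensor_right] scaleC_scaleC scaleC_add_right mult_ac)
  have h1: "has_value (\<lambda>\<kappa>. if \<kappa> \<ge> 0 then (fps_nth f (nat \<kappa>) * ?c powi (r - \<kappa>)) *\<^sub>C ?y1 else 0)
     (if i = color ?k then ?c powi r *\<^sub>C (V.row (m + 1) \<otimes>\<^sub>t vm) else 0)"
  proof (cases "i = color ?k")
    case False
    then show ?thesis by (simp add: has_value_zero cong: if_cong)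
  next
    case True
    have "\<exists>z. fps_value f (inverse ?c) z \<and> z * V.rowcoeff (?k + 1) = 1"
    proof (cases "i = 0")
      case False
      then show ?thesis using True fps_value_one by (auto simp: f_def V.rowcoeff_def V_bad)
    next
      case i0: True
      then have "?k \<noteq> 1" using True color_minus_2 color_m1 by metis
      then have c2: "?c \<noteq> c 2" by (simp add: c_inj)
      have "q * ?c = c (?k + 2)" "c 2 / q = c 1"
        using c_shift[of "?k + 1" 1] c_shift[of 1 1] by (simp_all add: add.assoc)
      then have qc: "q * ?c \<noteq> c 2 / q" by (simp add: c_inj)
      have "poly (poly_lin Pos q (c 2 / q)) (inverse ?c) = (q * ?c - c 2 / q) / ?c"
        by (simp add: field_simps)
      then have "poly (poly_lin Pos q (c 2 / q)) (inverse ?c) \<noteq> 0" using qc by simp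
      from fps_value_inverse_psi[OF c_nonzero this]
      have "fps_value f (inverse ?c) ((1 - c 2 / ?c) / (q - c 2 / q / ?c))"
        using i0 by (simp add: f_def divide_inverse mult_ac)
      moreover have "V.rowcoeff (?k + 1) = (q * ?c - c 2 / q) / (?c - c 2)"
        using True i0 by (simp add: V.rowcoeff_def V_bad)
      ultimately show ?thesis using cross_factor[OF c_nonzero c2 qc] by auto
    qed
    then obtain z where z: "fps_value f (inverse ?c) z" "z * V.rowcoeff (?k + 1) = 1" by blast
    have "(z * ?c powi r) *\<^sub>C ?y1 = (z * V.rowcoeff (?k + 1)) *\<^sub>C (?c powi r *\<^sub>C (V.row (m + 1) \<otimes>\<^sub>t vm))"
      using True by (simp add: scaleC_scaleC mult_ac)
    also have "\<dots> = (if i = color ?k then ?c powi r *\<^sub>C (V.row (m + 1) \<otimes>\<^sub>t vm) else 0)"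
      using True unfolding z(2) by (simp add: scaleC_one)
    finally have v: "(z * ?c powi r) *\<^sub>C ?y1 = \<dots>" .
    show ?thesis using has_value_geometric[OF z(1) c_nonzero, of r ?y1] unfolding v .
  qed
  have h2: "has_value (\<lambda>\<kappa>. if \<kappa> \<ge> 0 then (fps_nth f (nat \<kappa>) * c 2 powi (r - \<kappa>)) *\<^sub>C ?y2 else 0) 0"
  proof (cases "i = 0")
    case False
    then show ?thesis by (simp add: has_value_zero cong: if_cong)
  next
    case True
    have "poly (poly_lin Pos q (c 2 / q)) (inverse (c 2)) = q - inverse q"
      by (simp add: divide_inverse)
    then have "poly (poly_lin Pos q (c 2 / q)) (inverse (c 2)) \<noteq> 0" using q_diff by simp
    from fps_value_inverse_psi[OF c_nonzero this] have "fps_value f (inverse (c 2)) 0"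
      using True by (simp add: f_def)
    from has_value_geometric[OF this c_nonzero, of r ?y2] show ?thesis by simp
  qed
  from has_value_add[OF h1 h2] show ?thesis unfolding eq by simp
qed

text \<open>A raising mode shortens the row or acts on \<open>vm\<close>. The second term produces
  \<open>W.row 1\<close>, weighted with phi of the row at \<open>c 0\<close>: this is 1 on the empty
  row and zero on all others by \<open>rowphi_value_zero\<close>. Hence the half lines are joined at
  k = 0 only.\<close>

lemma e_xp_nonneg:
  assumes i: "i \<le> n"
  shows "has_value (\<lambda>\<kappa>. drinfeld_coeff t V W Pos i r \<kappa> (V.row m \<otimes>\<^sub>t vm))
     (if m > 0 then (if i = color (int m - 1) then c (int m) powi r *\<^sub>C (V.row (m - 1) \<otimes>\<^sub>t vm) else 0)
      else if i = 0 then c 0 powi r *\<^sub>C (vp \<otimes>\<^sub>t W.row 1) else 0)"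
proof -
  obtain u where u: "\<And>r. xop W Pos i r (W.row 0) =
     (if i = color (- 1) then (W.rowcoeff 1 * c 0 powi r) *\<^sub>C W.row 1 else 0)"
    using xW_Pos_row[of 0] i by auto
  have rc: "W.rowcoeff 1 = 1"
    using color_neq[of "-1" 0] by (simp add: W.rowcoeff_def W_color W_bad)
  let ?y = "if i = 0 then V.row m \<otimes>\<^sub>t W.row 1 else 0"
  define f where "f = V.rowphi Neg i (int m)"
  have eq: "drinfeld_coeff t V W Pos i r \<kappa> (V.row m \<otimes>\<^sub>t vm) =
     (if \<kappa> = 0 then xop V Pos i r (V.row m) \<otimes>\<^sub>t vm else 0)
      + (if \<kappa> \<ge> r then (fps_nth f (nat (\<kappa> - r)) * c 0 powi \<kappa>) *\<^sub>C ?y else 0)" for \<kappa>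
    using i u[of \<kappa>] by (auto simp: drinfeld_coeff_Pos[OF i] f_def phiV_row rc color_m1 tensor_scale_left tensor_scale_right
        clin_zero[OF clin_tensor_left] clin_zero[OF clin_tensor_right] scaleC_scaleC mult_ac)
  have "has_value (\<lambda>\<kappa>. if \<kappa> \<ge> r then (fps_nth f (nat (\<kappa> - r)) * c 0 powi \<kappa>) *\<^sub>C ?y else 0)
      (if m = 0 \<and> i = 0 then c 0 powi r *\<^sub>C (vp \<otimes>\<^sub>t W.row 1) else 0)"
  proof -
    consider "i \<noteq> 0" | "i = 0" "m = 0" | "i = 0" "m > 0" by blast
    then show ?thesis
    proof cases
      case 1
      then show ?thesis by (simp add: has_value_zero cong: if_cong)
    next
      case 2
      have "f = 1"
        using 2 color_m1 color_0_pos psi_inverse_mult[of "c 2" t Neg]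
        by (simp add: f_def V.rowphi_def linephi_def V_bad mult.commute)
      then show ?thesis
        using 2 has_value_geometric_shift[OF fps_value_one c_nonzero, where r = r and y = ?y and k1 = 0]
        by (simp cong: if_cong)
    next
      case 3
      then have "fps_value f (c 0) 0"
        using V.rowphi_value_zero[of "int m"] by (simp add: f_def V_bad)
      from has_value_geometric_shift[OF this c_nonzero, of r ?y] show ?thesis using 3 by simp
    qed
  qed
  note F = has_value_add[OF has_value_single this, of 0 "xop V Pos i r (V.row m) \<otimes>\<^sub>t vm"]
  have v: "xop V Pos i r (V.row m) \<otimes>\<^sub>t vm + (if m = 0 \<and> i = 0 then c 0 powi r *\<^sub>C (vp \<otimes>\<^sub>t W.row 1) else 0) =
      (if m > 0 then (if i = color (int m - 1) then c (int m) powi r *\<^sub>C (V.row (m - 1) \<otimes>\<^sub>t vm) else 0)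
      else if i = 0 then c 0 powi r *\<^sub>C (vp \<otimes>\<^sub>t W.row 1) else 0)"
    using V.xp_row[OF i, of r m]
    by (cases "m = 0") (simp_all add: tensor_scale_left clin_zero[OF clin_tensor_left])
  show ?thesis unfolding eq using F unfolding v .
qed

text \<open>Now phi on \<open>vp\<close> is psi at \<open>c 1\<close>, expanded at infinity. Here x
  is the parameter of the new box and y = \<open>c (- 1)\<close>, so that \<open>c 1\<close> is q^2
  y.\<close>

lemma cross_factor_dual:
  fixes x y :: complex
  assumes "x \<noteq> 0" "y \<noteq> 0" "x \<noteq> y" "x \<noteq> q ^ 2 * y"
  shows "(q * x - q * y) / (x - q ^ 2 * y) * ((q * inverse x - inverse y / q) / (inverse x - inverse y)) = 1"
proof -
  have "q * inverse x - inverse y / q = (q ^ 2 * y - x) / (q * x * y)"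
    using assms by (simp add: field_simps power2_eq_square)
  moreover have "inverse x - inverse y = (y - x) / (x * y)"
    using assms by (simp add: field_simps)
  ultimately have "(q * inverse x - inverse y / q) / (inverse x - inverse y) = (q ^ 2 * y - x) / (q * (y - x))"
    using assms by simp
  moreover have "(q * x - q * y) / (x - q ^ 2 * y) = (q * (y - x)) / (q ^ 2 * y - x)"
    by (metis minus_diff_eq minus_divide_divide right_diff_distrib)
  ultimately show ?thesis using assms by simp
qed

text \<open>The row in \<open>W\<close> grows. Its second pole lies at \<open>c (- 1)\<close>, where
  phi on \<open>vp\<close> vanishes in the colour \<open>color 0\<close>.\<close>

lemma e_xp_neg:
  assumes i: "i \<le> n" and m: "m > 0"
  shows "has_value (\<lambda>\<kappa>. drinfeld_coeff t V W Pos i r \<kappa> (vp \<otimes>\<^sub>t W.row m))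
     (if i = color (- int m - 1) then c (- int m) powi r *\<^sub>C (vp \<otimes>\<^sub>t W.row (m + 1)) else 0)"
proof -
  let ?k = "- int m" and ?c = "c (- int m)"
  define f where "f = (if i = color 0 then psi_series t Neg (c 1) else 1)"
  obtain u where u: "\<And>s. xop W Pos i s (W.row m) =
     (if i = color (?k - 1) then (W.rowcoeff (int m + 1) * ?c powi s) *\<^sub>C W.row (m + 1) else 0)
     + (if i = color 0 then c (- 1) powi s *\<^sub>C u else 0)"
    using xW_Pos_row[of m] i m by auto
  let ?y1 = "if i = color (?k - 1) then W.rowcoeff (int m + 1) *\<^sub>C (vp \<otimes>\<^sub>t W.row (m + 1)) else 0"
  let ?y2 = "if i = color 0 then vp \<otimes>\<^sub>t u else 0"
  have eq: "drinfeld_coeff t V W Pos i r \<kappa> (vp \<otimes>\<^sub>t W.row m) =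
      (if \<kappa> \<ge> r then (fps_nth f (nat (\<kappa> - r)) * ?c powi \<kappa>) *\<^sub>C ?y1 else 0)
      + (if \<kappa> \<ge> r then (fps_nth f (nat (\<kappa> - r)) * c (- 1) powi \<kappa>) *\<^sub>C ?y2 else 0)" for \<kappa>
    using i V_facts(4)[OF i, of Neg "nat (\<kappa> - r)"]
    by (auto simp: drinfeld_coeff_Pos[OF i] u f_def V_facts(2) tensor_add_right tensor_scale_left tensor_scale_right
        clin_zero[OF clin_tensor_left] clin_zero[OF clin_tensor_right] scaleC_scaleC scaleC_add_right mult_ac)
  have c1: "c 1 = q ^ 2 * c (- 1)" "c 1 / q = q * c (- 1)"
    using c_shift[of "-1" 2] by (simp_all add: power2_eq_square)
  have h1: "has_value (\<lambda>\<kappa>. if \<kappa> \<ge> r then (fps_nth f (nat (\<kappa> - r)) * ?c powi \<kappa>) *\<^sub>C ?y1 else 0)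
     (if i = color (?k - 1) then ?c powi r *\<^sub>C (vp \<otimes>\<^sub>t W.row (m + 1)) else 0)"
  proof (cases "i = color (?k - 1)")
    case False
    then show ?thesis by (simp add: has_value_zero cong: if_cong)
  next
    case True
    have "\<exists>z. fps_value f ?c z \<and> z * W.rowcoeff (int m + 1) = 1"
    proof (cases "i = color 0")
      case False
      then show ?thesis using True fps_value_one by (auto simp: f_def W.rowcoeff_def W_bad W_color)
    next
      case i0: True
      have "color (- 1 - 1) \<noteq> color 0" by (rule color_neq) auto
      then have "?k \<noteq> - 1" using True i0 by metis
      then have x: "?c \<noteq> c (- 1)" "?c \<noteq> q ^ 2 * c (- 1)"
        unfolding c1(1)[symmetric] by (simp_all add: c_inj)
      have "poly (poly_lin Neg 1 (c 1)) ?c \<noteq> 0" using x(2) by (simp add: c1(1))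
      moreover have "poly (poly_lin Neg q (c 1 / q)) ?c / poly (poly_lin Neg 1 (c 1)) ?c =
          (q * ?c - q * c (- 1)) / (?c - q ^ 2 * c (- 1))"
        unfolding c1(2) by (simp add: c1(1) mult.commute)
      ultimately have "fps_value f ?c ((q * ?c - q * c (- 1)) / (?c - q ^ 2 * c (- 1)))"
        using i0 fps_value_psi[OF c_nonzero, of Neg 1 ?c t] unfolding f_def by simp
      moreover have "W.rowcoeff (int m + 1) = (q * inverse ?c - inverse (c (- 1)) / q) / (inverse ?c - inverse (c (- 1)))"
        using True i0 by (simp add: W.rowcoeff_def W_bad W_color W_c)
      ultimately show ?thesis using cross_factor_dual[OF c_nonzero c_nonzero x] by auto
    qed
    then obtain z where z: "fps_value f ?c z" "z * W.rowcoeff (int m + 1) = 1" by blast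
    have "(z * ?c powi r) *\<^sub>C ?y1 = (z * W.rowcoeff (int m + 1)) *\<^sub>C (?c powi r *\<^sub>C (vp \<otimes>\<^sub>t W.row (m + 1)))"
      using True by (simp add: scaleC_scaleC mult_ac)
    also have "\<dots> = (if i = color (?k - 1) then ?c powi r *\<^sub>C (vp \<otimes>\<^sub>t W.row (m + 1)) else 0)"
      using True unfolding z(2) by (simp add: scaleC_one)
    finally have v: "(z * ?c powi r) *\<^sub>C ?y1 = \<dots>" .
    show ?thesis using has_value_geometric_shift[OF z(1) c_nonzero, of r ?y1] unfolding v .
  qed
  have h2: "has_value (\<lambda>\<kappa>. if \<kappa> \<ge> r then (fps_nth f (nat (\<kappa> - r)) * c (- 1) powi \<kappa>) *\<^sub>C ?y2 else 0) 0"
  proof (cases "i = color 0")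
    case False
    then show ?thesis by (simp add: has_value_zero cong: if_cong)
  next
    case True
    have "c (- 1) \<noteq> c 1" by (simp add: c_inj)
    then have "poly (poly_lin Neg 1 (c 1)) (c (- 1)) \<noteq> 0" by simp
    from fps_value_psi[OF c_nonzero this, of t] have "fps_value f (c (- 1)) 0"
      using True by (simp add: f_def c1(2) mult.commute)
    from has_value_geometric_shift[OF this c_nonzero, of r ?y2] show ?thesis by simp
  qed
  from has_value_add[OF h1 h2] show ?thesis unfolding eq by simp
qed

text \<open>Lowering \<open>vp\<close> would leave the line; that term is weighted with phi on a
  nonempty row of \<open>W\<close>, which is zero by \<open>W.rowphi_value_zero\<close>.\<close>

lemma e_xm_neg:
  assumes i: "i \<le> n" and m: "m > 0"
  shows "has_value (\<lambda>\<kappa>. drinfeld_coeff t V W Neg i r \<kappa> (vp \<otimes>\<^sub>t W.row m))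
     (if i = color (- int m) then c (1 - int m) powi r *\<^sub>C (vp \<otimes>\<^sub>t W.row (m - 1)) else 0)"
proof -
  obtain u where u: "\<And>s. xop V Neg i s vp =
     (if i = color 0 then (V.rowcoeff 1 * c 1 powi s) *\<^sub>C V.row 1 else 0)"
    using V.xm_row[of 0] i by auto
  have rc: "V.rowcoeff 1 = 1"
    using color_neq[of "-1" 0] color_m1 by (simp add: V.rowcoeff_def V_bad)
  let ?y = "if i = color 0 then V.row 1 \<otimes>\<^sub>t W.row m else 0"
  define f where "f = W.rowphi Neg i (int m)"
  have eq: "drinfeld_coeff t V W Neg i r \<kappa> (vp \<otimes>\<^sub>t W.row m) =
     (if \<kappa> \<ge> 0 then (fps_nth f (nat \<kappa>) * c 1 powi (r - \<kappa>)) *\<^sub>C ?y else 0)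
      + (if \<kappa> = r then vp \<otimes>\<^sub>t xop W Neg i r (W.row m) else 0)" for \<kappa>
    using i by (auto simp: drinfeld_coeff_Neg[OF i] u f_def phiW_row rc tensor_scale_left tensor_scale_right
        clin_zero[OF clin_tensor_left] clin_zero[OF clin_tensor_right] scaleC_scaleC mult_ac)
  have "has_value (\<lambda>\<kappa>. if \<kappa> \<ge> 0 then (fps_nth f (nat \<kappa>) * c 1 powi (r - \<kappa>)) *\<^sub>C ?y else 0) 0"
  proof (cases "i = color 0")
    case False
    then show ?thesis by (simp add: has_value_zero cong: if_cong)
  next
    case True
    have "fps_value f (inverse (c 1)) 0"
      using W.rowphi_value_zero[of "int m"] m True by (simp add: f_def W_bad W_c)
    from has_value_geometric[OF this c_nonzero, of r ?y] show ?thesis by simp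
  qed
  note F = has_value_add[OF this has_value_single, of r "vp \<otimes>\<^sub>t xop W Neg i r (W.row m)"]
  have v: "0 + vp \<otimes>\<^sub>t xop W Neg i r (W.row m) =
      (if i = color (- int m) then c (1 - int m) powi r *\<^sub>C (vp \<otimes>\<^sub>t W.row (m - 1)) else 0)"
    using i m by (simp add: xW_Neg_row tensor_scale_right clin_zero[OF clin_tensor_right])
  show ?thesis unfolding eq using F unfolding v .
qed

section \<open>The tensor product operators on the whole line\<close>

definition D :: "('v, 'w) tensor qmod" where "D = drinfeld_tensor t V W"

definition PhiD :: "pm \<Rightarrow> nat \<Rightarrow> nat \<Rightarrow> ('v, 'w) tensor \<Rightarrow> ('v, 'w) tensor" where
  "PhiD \<epsilon> i s y = (\<Sum>r\<le>s. tensor_map (phi t V \<epsilon> i r) (phi t W \<epsilon> i (s - r)) y)"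

lemma D_sel:
  "xop D \<epsilon> i m y = value_at_one (\<lambda>k. drinfeld_coeff t V W \<epsilon> i m k y)"
  "kop D h = tensor_map (kop V h) (kop W h)"
  "hop D = log_op t (kop D) PhiD"
  by (simp_all add: D_def drinfeld_tensor_def PhiD_def[abs_def])

lemma has_value_e_Neg:
  assumes i: "i \<le> n"
  shows "has_value (\<lambda>\<kappa>. drinfeld_coeff t V W Neg i r \<kappa> (e k))
    (if i = color k then c (k + 1) powi r *\<^sub>C e (k + 1) else 0)"
proof (cases "k \<ge> 0")
  case True
  then obtain m where k: "k = int m" using nonneg_int_cases by blast
  have "e (k + 1) = V.row (m + 1) \<otimes>\<^sub>t vm" using e_nonneg[of "m + 1"] by (simp add: k add.commute)
  then show ?thesis using e_xm_nonneg[OF i, of r m] e_nonneg[of m] by (simp only: k)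
next
  case False
  define m where "m = nat (- k)"
  have m: "m > 0" and k: "k = - int m" using False by (auto simp: m_def)
  have "- int m + 1 = - int (m - 1)" "1 - int m = - int m + 1" using m by auto
  then show ?thesis
    using e_xm_neg[OF i m, of r] e_nonpos[of m] e_nonpos[of "m - 1"] by (simp only: k)
qed

lemma has_value_e_Pos:
  assumes i: "i \<le> n"
  shows "has_value (\<lambda>\<kappa>. drinfeld_coeff t V W Pos i r \<kappa> (e k))
    (if i = color (k - 1) then c k powi r *\<^sub>C e (k - 1) else 0)"
proof -
  consider m where "k = int m" "m > 0" | "k = 0" | m where "k = - int m" "m > 0"
    by (cases k rule: int_cases3) auto
  then show ?thesis
  proof cases
    case (1 m)
    then have "int m - 1 = int (m - 1)" by auto
    then have "e (int m - 1) = V.row (m - 1) \<otimes>\<^sub>t vm" by (simp only: e_nonneg)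
    then show ?thesis
      using e_xp_nonneg[OF i, of r m] by (simp only: 1 e_nonneg if_True)
  next
    case 2
    then show ?thesis
      using e_xp_nonneg[OF i, of r 0] e_nonneg[of 0] e_nonpos[of 1] color_m1 by (simp cong: if_cong)
  next
    case (3 m)
    have "- int m - 1 = - int (m + 1)" by simp
    then show ?thesis
      using e_xp_neg[OF i 3(2), of r] e_nonpos[of m] e_nonpos[of "m + 1"] by (simp only: 3(1))
  qed
qed

lemma kD_e:
  assumes h: "h \<in> cartan_space n"
  shows "kop D h (e k) = qexp t (pairing n (wt k) h) *\<^sub>C e k"
proof -
  have T: "kop D h (v \<otimes>\<^sub>t w) = kop V h v \<otimes>\<^sub>t kop W h w" for v w
    by (simp add: D_sel tensor_map_pure V_rel W_rel h)
  have w0: "wt 0 = fund_weight (color 0) - fund_weight 0" by (simp add: wt_def varpi_def)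
  show ?thesis
  proof (cases "k \<ge> 0")
    case True
    then obtain m where k: "k = int m" using nonneg_int_cases by blast
    have "V.rowweight m h - pairing n (fund_weight 0) h = pairing n (wt (int m)) h"
    proof (induction m)
      case 0 then show ?case by (simp add: V.rowweight_def w0 pairing_diff_left)
    next
      case (Suc m)
      have "wt (int (Suc m)) = wt (int m) - simple_root n (color (int m))"
        using wt_step[of "int m"] by (simp add: add.commute)
      then show ?case using Suc by (simp add: V.rowweight_def pairing_diff_left)
    qed
    then have "qexp t (pairing n (wt (int m)) h) = qexp t (V.rowweight m h) * qexp t (- pairing n (fund_weight 0) h)"
      by (simp flip: qexp_add)
    then show ?thesis
      by (simp add: k e_nonneg T V.k_row[OF h] W_facts(3)[OF h] tensor_scale_left tensor_scale_right scaleC_scaleC mult.commute)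
  next
    case False
    then obtain m where k: "k = - int m" by (metis int_zle_neg nonpos_int_cases linear)
    have h': "- h \<in> cartan_space n" by (rule neg_cartan_space[OF h])
    have "kop W h (W.row m) = qexp t (W.rowweight m (- h)) *\<^sub>C W.row m"
      using W.k_row[OF h', of m] by simp
    moreover have "W.rowweight m (- h) + pairing n (fund_weight (color 0)) h = pairing n (wt (- int m)) h"
    proof (induction m)
      case 0 then show ?case by (simp add: W.rowweight_def w0 pairing_diff_left pairing_neg_right)
    next
      case (Suc m)
      have "wt (- int m) = wt (- int (Suc m)) - simple_root n (color (- int m - 1))"
      proof -
        have "- int (Suc m) = - int m - 1" by simp
        then show ?thesis using wt_step[of "- int m - 1"] by (simp only: diff_add_cancel)
      qed
      then show ?case using Suc by (simp add: W.rowweight_def pairing_diff_left pairing_neg_right W_color)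
    qed
    ultimately show ?thesis
      by (simp add: k e_nonpos T V_facts(3)[OF h] tensor_scale_left tensor_scale_right scaleC_scaleC flip: qexp_add)
  qed
qed

text \<open>\<open>psi_opp\<close> exchanges psi with its inverse, and the reversed walk exchanges
  the two neighbouring colours; the two changes cancel.\<close>

lemma W_linephi:
  "W.linephi (opp \<epsilon>) i (int m) = linephi \<epsilon> i (- int m)"
proof -
  have d: "color (- int m) \<noteq> color (- int m - 1)" by (rule color_neq; simp)
  have 1: "psi_series t (opp \<epsilon>) (W.c (int m + 1)) = inverse (psi_series t \<epsilon> (c (- int m + 2)))"
    using psi_opp[OF c_nonzero, of t \<epsilon> "- int m"] c_shift[of "- int m" 2] by (simp add: W_c)
  have "psi_series t (opp \<epsilon>) (W.c (int m + 2)) = inverse (psi_series t \<epsilon> (c (- int m + 1)))"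
  proof -
    have "W.c (int m + 2) = inverse (c (- int m - 1))"
      unfolding W_c by (rule arg_cong[where f = "\<lambda>x. inverse (c x)"]) simp
    moreover have "c (- int m + 1) = q ^ 2 * c (- int m - 1)"
      using c_shift[of "- int m - 1" 2] by simp
    ultimately show ?thesis using psi_opp[OF c_nonzero, of t \<epsilon> "- int m - 1"] by simp
  qed
  then have 2: "inverse (psi_series t (opp \<epsilon>) (W.c (int m + 2))) = psi_series t \<epsilon> (c (- int m + 1))"
    by (simp add: psi_nth_0 fps_inverse_idempotent)
  show ?thesis
    unfolding W.linephi_def linephi_def 1 2 W_color using d by auto
qed

text \<open>Eigenvalue series multiply, and the extra psi of a row cancels against phi on
  \<open>vm\<close> or \<open>vp\<close>.\<close>

lemma PhiD_e:
  assumes i: "i \<le> n"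
  shows "PhiD \<epsilon> i s (e k) = fps_nth (linephi \<epsilon> i k) s *\<^sub>C e k"
proof -
  have *: "PhiD \<epsilon> i s (v \<otimes>\<^sub>t w) = fps_nth (f * f') s *\<^sub>C (v \<otimes>\<^sub>t w)"
    if "\<And>r. phi t V \<epsilon> i r v = fps_nth f r *\<^sub>C v" "\<And>r. phi t W \<epsilon> i r w = fps_nth f' r *\<^sub>C w" for v w f f'
    using i by (simp add: PhiD_def tensor_map_pure V_rel W_rel that tensor_scale_left tensor_scale_right
        scaleC_scaleC fps_mult_nth cvec.scale_sum_left atMost_atLeast0) (simp add: mult.commute)
  show ?thesis
  proof (cases "k \<ge> 0")
    case True
    then obtain m where k: "k = int m" using nonneg_int_cases by blast
    have "V.rowphi \<epsilon> i (int m) * (if i = 0 then inverse (psi_series t \<epsilon> (c 2)) else 1) = linephi \<epsilon> i (int m)"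
      using psi_inverse_mult[of "c 2" t \<epsilon>] by (simp add: V.rowphi_def V_bad mult.assoc)
    then show ?thesis
      using *[OF phiV_row[OF i] W_facts(4)[OF i], of m] by (simp only: k e_nonneg)
  next
    case False
    then obtain m where k: "k = - int m" by (metis int_zle_neg nonpos_int_cases linear)
    have "psi_series t (opp \<epsilon>) (W.c 2) = inverse (psi_series t \<epsilon> (c 1))"
      using psi_opp[OF c_nonzero, of t \<epsilon> "- 1"] c_shift[of "- 1" 2] by (simp add: W_c)
    then have "(if i = color 0 then psi_series t \<epsilon> (c 1) else 1) * W.rowphi (opp \<epsilon>) i (int m) = linephi \<epsilon> i (- int m)"
      using psi_inverse_mult[of "c 1" t \<epsilon>]
      by (simp add: W.rowphi_def W_bad W_linephi mult.left_commute)
    then show ?thesis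
      using *[OF V_facts(4)[OF i] phiW_row[OF i], of m] by (simp only: k e_nonpos)
  qed
qed

section \<open>The intertwiner and its injectivity\<close>

definition g :: "(int \<Rightarrow>\<^sub>0 complex) \<Rightarrow> ('v, 'w) tensor" where "g = pm_extend (\<lambda>j. e (j - 1))"

lemma clin_g: "clin g"
  by (simp add: g_def clin_pm_extend)

lemma g_bx: "g (bx k) = e k"
  by (simp add: g_def bx_def box_def)

lemma g_sum: "g p = (\<Sum>j\<in>Poly_Mapping.keys p. Poly_Mapping.lookup p j *\<^sub>C e (j - 1))"
  by (simp add: g_def pm_extend_def)

text \<open>Values exist on the vectors \<open>e k\<close>. Linear combinations are formed at the
  level of \<open>has_value\<close>, and \<open>value_at_one\<close> is resolved only for the
  total.\<close>

lemma xD_g: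
  assumes i: "i \<le> n"
  shows "xop D \<epsilon> i r (g p) = g (xop F \<epsilon> i r p)"
proof -
  have E: "has_value (\<lambda>\<kappa>. drinfeld_coeff t V W \<epsilon> i r \<kappa> (e k)) (g (xop F \<epsilon> i r (bx k)))" for k
  proof (cases \<epsilon>)
    case Pos
    have "g (xop F Pos i r (bx k)) = (if i = color (k - 1) then c k powi r *\<^sub>C e (k - 1) else 0)"
      by (simp add: xF_pos i g_bx clin_scale[OF clin_g] clin_zero[OF clin_g])
    then show ?thesis using has_value_e_Pos[OF i, of r k] by (simp only: Pos)
  next
    case Neg
    have "g (xop F Neg i r (bx k)) = (if i = color k then c (k + 1) powi r *\<^sub>C e (k + 1) else 0)"
      by (simp add: xF_neg i g_bx clin_scale[OF clin_g] clin_zero[OF clin_g])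
    then show ?thesis using has_value_e_Neg[OF i, of r k] by (simp only: Neg)
  qed
  have "drinfeld_coeff t V W \<epsilon> i r \<kappa> (g p) =
      (\<Sum>j\<in>Poly_Mapping.keys p. Poly_Mapping.lookup p j *\<^sub>C drinfeld_coeff t V W \<epsilon> i r \<kappa> (e (j - 1)))" for \<kappa>
    unfolding g_sum clin_sum[OF clin_drinfeld_coeff[OF i]] clin_scale[OF clin_drinfeld_coeff[OF i]] ..
  moreover have "has_value (\<lambda>\<kappa>. \<Sum>j\<in>Poly_Mapping.keys p. Poly_Mapping.lookup p j *\<^sub>C drinfeld_coeff t V W \<epsilon> i r \<kappa> (e (j - 1)))
      (\<Sum>j\<in>Poly_Mapping.keys p. Poly_Mapping.lookup p j *\<^sub>C g (xop F \<epsilon> i r (bx (j - 1))))"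
    by (intro has_value_sum has_value_scale E) simp
  moreover have "(\<Sum>j\<in>Poly_Mapping.keys p. Poly_Mapping.lookup p j *\<^sub>C g (xop F \<epsilon> i r (bx (j - 1)))) = g (xop F \<epsilon> i r p)"
  proof -
    have "g (xop F \<epsilon> i r p) = g (xop F \<epsilon> i r (\<Sum>j\<in>Poly_Mapping.keys p. Poly_Mapping.lookup p j *\<^sub>C Poly_Mapping.single j 1))"
      using poly_mapping_sum_single[of p] by simp
    then show ?thesis
      by (simp add: clin_sum[OF clin_xF] clin_sum[OF clin_g] clin_scale[OF clin_xF] clin_scale[OF clin_g] bx_def box_def)
  qed
  ultimately have "has_value (\<lambda>\<kappa>. drinfeld_coeff t V W \<epsilon> i r \<kappa> (g p)) (g (xop F \<epsilon> i r p))"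
    by (simp only:)
  then show ?thesis unfolding D_sel by (rule value_at_one_eq)
qed

lemma kD_g:
  assumes "h \<in> cartan_space n"
  shows "kop D h (g p) = g (kop F h p)"
proof (rule F_eqI[where A = "\<lambda>p. kop D h (g p)"])
  have "clin (kop D h)" by (simp add: D_sel clin_tensor_map V_rel W_rel assms)
  then show "clin (\<lambda>p. kop D h (g p))" by (rule clin_compose[OF _ clin_g])
  show "clin (\<lambda>p. g (kop F h p))" by (rule clin_compose[OF clin_g clin_kF])
qed (simp add: g_bx kD_e assms kF clin_scale[OF clin_g])

lemma PhiD_g:
  assumes "i \<le> n"
  shows "PhiD \<epsilon> i s (g p) = g (PhiF \<epsilon> i s p)"
proof (rule F_eqI[where A = "\<lambda>p. PhiD \<epsilon> i s (g p)"])
  have "clin (PhiD \<epsilon> i s)"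
    unfolding PhiD_def[abs_def] by (intro clin_sum_fun) (simp add: clin_tensor_map V_rel W_rel assms)
  then show "clin (\<lambda>p. PhiD \<epsilon> i s (g p))" by (rule clin_compose[OF _ clin_g])
  show "clin (\<lambda>p. g (PhiF \<epsilon> i s p))" by (rule clin_compose[OF clin_g clin_PhiF])
qed (simp add: g_bx PhiD_e assms PhiF_bx clin_scale[OF clin_g])

lemma hD_g:
  assumes "i \<le> n"
  shows "hop D i m (g p) = g (hop F i m p)"
proof -
  have "series_power (\<lambda>s. kop D (- signed_coroot \<epsilon> i) \<circ> PhiD \<epsilon> i s) k N (g p) =
      g (series_power (\<lambda>s. kop F (- signed_coroot \<epsilon> i) \<circ> PhiF \<epsilon> i s) k N p)" for \<epsilon> k N
    by (rule series_power_intertwine[OF clin_g])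
      (simp add: PhiD_g assms kD_g neg_cartan_space signed_coroot_in)
  then show ?thesis
    by (simp add: D_sel hopF assms log_op_def Let_def clin_scale[OF clin_g] clin_sum[OF clin_g]
        clin_neg[OF clin_g])
qed

text \<open>The vectors \<open>e k\<close> are nonzero eigenvectors of k_h for
  \<open>coheight\<close>, with pairwise different eigenvalues because q is not a root of
  unity.\<close>

lemma inj_g: "inj g"
proof -
  define \<mu> where "\<mu> k = qexp t (pairing n (wt k) (coheight n))" for k
  have K: "Poly_Mapping.lookup (kop F (coheight n) v) j = \<mu> (j - 1) * Poly_Mapping.lookup v j" for v j
    using lookup_kF[of "coheight n" v "j - 1"] by (simp add: \<mu>_def)
  have P: "pairing n (wt k) (coheight n) = pairing n (wt 0) (coheight n) - of_int k" for k
    by (induction k rule: int_line_induct)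
      (simp_all add: wt_step pairing_diff_left pairing_coheight n2 color_le)
  have \<mu>: "\<mu> k = \<mu> 0 / q powi k" for k
    unfolding \<mu>_def P[of k] by (simp add: qexp_diff qexp_of_int)
  have inj_\<mu>: "\<mu> k = \<mu> k' \<longleftrightarrow> k = k'" for k k'
    using q_powi_inj[of k k'] unfolding \<mu>[of k] \<mu>[of k'] by (simp add: \<mu>_def)
  have "p = 0" if "g p = 0" for p
    using that
  proof (induction "card (Poly_Mapping.keys p)" arbitrary: p rule: less_induct)
    case less
    show ?case
    proof (rule ccontr)
      assume "p \<noteq> 0"
      then obtain j where j: "Poly_Mapping.lookup p j \<noteq> 0"
        by (metis poly_mapping_eqI lookup_zero)
      \<comment> \<open>Its support is that of p without j. By induction it vanishes, which leaves p
        as a multiple of a single basis vector.\<close>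
      define p' where "p' = kop F (coheight n) p - \<mu> (j - 1) *\<^sub>C p"
      have lp: "Poly_Mapping.lookup p' x = (\<mu> (x - 1) - \<mu> (j - 1)) * Poly_Mapping.lookup p x" for x
        by (simp add: p'_def lookup_minus K scaleC_poly_mapping.rep_eq scaleC_complex_def left_diff_distrib)
      have "Poly_Mapping.keys p' \<subset> Poly_Mapping.keys p"
        using j by (auto simp: in_keys_iff lp)
      then have "card (Poly_Mapping.keys p') < card (Poly_Mapping.keys p)"
        by (intro psubset_card_mono) auto
      moreover have "g p' = 0"
        using less.prems kD_g[OF coheight_in, of p] clin_zero[of "kop D (coheight n)"]
        by (simp add: p'_def clin_diff[OF clin_g] clin_scale[OF clin_g] D_sel clin_tensor_map V_rel W_rel coheight_in)
      ultimately have "p' = 0" by (rule less.hyps)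
      then have z: "Poly_Mapping.lookup p x = 0" if "x \<noteq> j" for x
        using lp[of x] that by (simp add: inj_\<mu>)
      have "p = Poly_Mapping.lookup p j *\<^sub>C bx (j - 1)"
        by (rule poly_mapping_eqI)
          (use z in \<open>auto simp: bx_def box_def scaleC_poly_mapping.rep_eq scaleC_complex_def lookup_single_if\<close>)
      then have "g p = Poly_Mapping.lookup p j *\<^sub>C e (j - 1)"
        by (metis clin_scale[OF clin_g] g_bx)
      then show False using less.prems j e_nonzero by simp
    qed
  qed
  then show ?thesis
    by (intro injI) (metis clin_diff[OF clin_g] eq_iff_diff_eq_0)
qed

definition T :: "('v, 'w) tensor qmod" where "T = tensor_submodule n t V W vp vm"

lemma T_sel:
  "xop T = xop D" "kop T = kop D" "hop T = hop D"
  "space T = cyclic_span (generators n D) (e 0)"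
  using e_nonneg[of 0]
  by (simp_all add: T_def tensor_submodule_def generated_submodule_def D_def)

lemma embedding_T: "embedding n F T g"
proof -
  interpret D: intertwiner n t F D g
    by unfold_locales (simp_all add: clin_g xD_g kD_g hD_g clin_iff[THEN iffD1, OF clin_g])
  \<comment> \<open>\<open>bx 0\<close> generates \<open>F\<close>, so the cyclic span of its image
    is the full range.\<close>
  have "space T = range g"
    using D.generators_cyclic[of "bx 0"] by (simp add: T_sel g_bx cyclic_F spaceF)
  then show ?thesis
    by (intro embedding.intro embedding_axioms.intro intertwiner.intro)
      (simp_all add: T_sel clin_g xD_g kD_g hD_g inj_g spaceF)
qed

theorem extremal_loop_weight_T:
  "extremal_loop_weight_module n t
     (varpi (color 0), \<lambda>i c. Ymon (color 0) a i c - Ymon 0 (a * q) i c) T \<and> qmodule_iso n T F"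
proof -
  interpret embedding n t F T g by (rule embedding_T)
  show ?thesis using extremal_loop_weight_image[OF extremal_loop_weight_F] iso_image by blast
qed

end

theorem theorem3p9:
  fixes n l :: nat and t a :: complex
    and V :: "('v::complex_vector) qmod" and vp :: 'v
    and W :: "('w::complex_vector) qmod" and vm :: 'w
  assumes "n \<ge> 2"
    and "\<And>k::nat. k > 0 \<Longrightarrow> exp t ^ k \<noteq> 1"
    and "l = 1 \<or> l = n"
    and "a \<noteq> 0"
    and "space V = UNIV"
    and "simple_lweight_module n t Pos (fund_weight l, Ymon l a) V vp"
    and "space W = UNIV"
    and "simple_lweight_module n t Neg (- fund_weight 0, \<lambda>i c. - Ymon 0 (a * exp t) i c) W vm"
  shows "extremal_loop_weight_module n t
           (varpi l, \<lambda>i c. Ymon l a i c - Ymon 0 (a * exp t) i c) (tensor_submodule n t V W vp vm)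
         \<and> qmodule_iso n (tensor_submodule n t V W vp vm) (fund_loop_module n t l a)"
proof -
  \<comment> \<open>The direction of the walk: upwards from the vertex 1, downwards from the vertex
    n.\<close>
  define sg :: int where "sg = (if l = 1 then 1 else - 1)"
  interpret L: loop_line n t sg a
    using assms(1,2,4) by unfold_locales (auto simp: sg_def)
  have "(if sg = 1 then 1 else n) = l" using assms(3) by (auto simp: sg_def)
  then have l: "L.color 0 = l" using L.color_0 by (rule trans[rotated])
  interpret tensor_setup n t sg a V vp W vm
    using assms(5-8) by unfold_locales (simp_all add: l)
  show ?thesis
    using extremal_loop_weight_T unfolding T_def L.F_def l .
qed

end
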